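(* Let $\alpha,\beta,\gamma\in I(d)$ with $\alpha\le\beta\le\gamma$ and let $Y^\gamma_{\alpha,\beta}=X^\gamma_\alpha\cap\{p_\beta\ne0\}$, whose coordinate ring is $P/I$ with $I=(f_{\tau,\beta}:\tau\in I(d),\ \alpha\not\le\tau\text{ or }\tau\not\le\gamma)$. Then the (images of the) standard monomials on $Y^\gamma_{\alpha,\beta}$ form a $k$-basis of $k[Y^\gamma_{\alpha,\beta}]=P/I$.
   Context: Setup. $k$ is an algebraically closed field of characteristic $\neq2$, $d\ge1$, $V=k^{2d}$ with basis $e_1,\dots,e_{2d}$ and symmetric form $\langle e_i,e_j\rangle=1$ if $j=2d+1-i$, $0$ otherwise; $m^*=2d+1-m$. $I(d)$ is the set of $d$-subsets of $\{1,\dots,2d\}$ containing exactly one of $m,m^*$ for each $m$ and having an even number of elements $>d$; $v\le w$ iff $v_i\le w_i$ for the sorted entries. The orthogonal Grassmannian $OG$ is the $SO(V)$-orbit of $\langle e_1,\dots,e_d\rangle$ among maximal isotropic subspaces, Plücker-embedded with coordinates $p_\theta$. With $B$, $B^-$ the upper, lower triangular elements of $SO(V)$, $e_\theta=\langle e_i:i\in\theta\rangle$, $X^\gamma=\overline{Be_\gamma}$, $X_\alpha=\overline{B^-e_\alpha}$, and $X_\alpha^\gamma=X_\alpha\cap X^\gamma$ (reduced). Coordinates: $\mathfrak R(\beta)=\{(r,c):r\notin\beta,c\in\beta,r<c^*\}$, $P=k[X_{(r,c)}:(r,c)\in\mathfrak R(\beta)]$; the patch $OG\cap\{p_\beta\neq0\}$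 is the affine space with coordinate ring $P$, a point corresponding to the column span of the matrix $M$ (rows $1..2d$, columns $\beta$) with $M_{r,c}=\delta_{rc}$ for $r\in\beta$ and, for $r\notin\beta$, $M_{r,c}=X_{(r,c)}$ if $r<c^*$, $0$ if $r=c^*$, $-X_{(c^*,r^* )}$ if $r>c^*$. For $\theta\in I(d)$ with $\theta\setminus\beta=\{r_1<\dots<r_{2s}\}$, $f_{\theta,\beta}$ is the Pfaffian of the skew-symmetric $2s\times2s$ matrix $N$ with $N_{ij}=X_{(r_i,r_j^* )}$ for $i<j$ ($f_{\beta,\beta}=1$); the $\beta$-degree of $\theta$ is $s$. Standard monomials. A product $f_{\theta_1,\beta}\cdots f_{\theta_r,\beta}$ with $\theta_i\in I(d)$ is a standard monomial if $\theta_1\le\dots\le\theta_r$ and for each $i$ either $\theta_i<\beta$ or $\theta_i>\beta$ (strictly); it is standard on $Y^\gamma_{\alpha,\beta}$ if moreover $\alpha\le\theta_1$ and $\theta_r\le\gamma$. Its degree is the sum of the $\beta$-degrees of the $\theta_i$. *)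

theory Defs
  imports Complex_Main "HOL-Library.Poly_Mapping" "HOL-Computational_Algebra.Polynomial"
begin

type_synonym 'k mpoly = "((nat \<times> nat) \<Rightarrow>\<^sub>0 nat) \<Rightarrow>\<^sub>0 'k"

definition algebraically_closed :: "'k::field itself \<Rightarrow> bool" where
  "algebraically_closed _ \<longleftrightarrow> (\<forall>p :: 'k poly. degree p > 0 \<longrightarrow> (\<exists>x. poly p x = 0))"

definition star :: "nat \<Rightarrow> nat \<Rightarrow> nat" where
  "star d m = 2 * d + 1 - m"

definition Iset :: "nat \<Rightarrow> nat set set" where
  "Iset d = {\<theta>. \<theta> \<subseteq> {1..2*d} \<and> card \<theta> = d
      \<and> (\<forall>m\<in>{1..2*d}. (m \<in> \<theta>) \<noteq> (star d m \<in> \<theta>))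
      \<and> even (card {x\<in>\<theta>. x > d})}"

definition leqI :: "nat set \<Rightarrow> nat set \<Rightarrow> bool" where
  "leqI v w \<longleftrightarrow> list_all2 (\<le>) (sorted_list_of_set v) (sorted_list_of_set w)"

definition lessI :: "nat set \<Rightarrow> nat set \<Rightarrow> bool" where
  "lessI v w \<longleftrightarrow> leqI v w \<and> v \<noteq> w"

text \<open>The index set R(beta) of the coordinates of the affine patch.\<close>
definition Rset :: "nat \<Rightarrow> nat set \<Rightarrow> (nat \<times> nat) set" where
  "Rset d \<beta> = {(r, c). r \<in> {1..2*d} \<and> r \<notin> \<beta> \<and> c \<in> \<beta> \<and> r < star d c}"

definition Var :: "nat \<times> nat \<Rightarrow> 'k::comm_ring_1 mpoly" where
  "Var v = Poly_Mapping.single (Poly_Mapping.single v 1) 1"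

definition Const :: "'k::comm_ring_1 \<Rightarrow> 'k mpoly" where
  "Const c = Poly_Mapping.single 0 c"

definition inP :: "nat \<Rightarrow> nat set \<Rightarrow> 'k::comm_ring_1 mpoly \<Rightarrow> bool" where
  "inP d \<beta> p \<longleftrightarrow> (\<forall>m\<in>Poly_Mapping.keys p. Poly_Mapping.keys m \<subseteq> Rset d \<beta>)"

text \<open>Pfaffian of the skew-symmetric matrix with upper entries N x y (x before y in the list xs),
  by expansion along the first row: Pf = sum_j (-1)^j N_{1j} Pf(minor), using a fuel argument.\<close>
primrec pf_fuel :: "nat \<Rightarrow> ('a \<Rightarrow> 'a \<Rightarrow> 'r::comm_ring_1) \<Rightarrow> 'a list \<Rightarrow> 'r" where
  "pf_fuel 0 N xs = (if xs = [] then 1 else 0)"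
| "pf_fuel (Suc n) N xs = (case xs of [] \<Rightarrow> 1
     | x # ys \<Rightarrow> (\<Sum>j<length ys. (-1) ^ j * N x (ys ! j) * pf_fuel n N (take j ys @ drop (Suc j) ys)))"

definition pfaffian :: "('a \<Rightarrow> 'a \<Rightarrow> 'r::comm_ring_1) \<Rightarrow> 'a list \<Rightarrow> 'r" where
  "pfaffian N xs = pf_fuel (length xs) N xs"

definition fpol :: "nat \<Rightarrow> nat set \<Rightarrow> nat set \<Rightarrow> 'k::comm_ring_1 mpoly" where
  "fpol d \<theta> \<beta> = pfaffian (\<lambda>x y. Var (x, star d y)) (sorted_list_of_set (\<theta> - \<beta>))"

definition smon :: "nat \<Rightarrow> nat set \<Rightarrow> nat set list \<Rightarrow> 'k::comm_ring_1 mpoly" where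
  "smon d \<beta> L = prod_list (map (\<lambda>\<theta>. fpol d \<theta> \<beta>) L)"

definition standard_on :: "nat \<Rightarrow> nat set \<Rightarrow> nat set \<Rightarrow> nat set \<Rightarrow> nat set list \<Rightarrow> bool" where
  "standard_on d \<alpha> \<beta> \<gamma> L \<longleftrightarrow>
     (\<forall>\<theta>\<in>set L. \<theta> \<in> Iset d \<and> (lessI \<theta> \<beta> \<or> lessI \<beta> \<theta>))
     \<and> (\<forall>i. Suc i < length L \<longrightarrow> leqI (L ! i) (L ! Suc i))
     \<and> (L \<noteq> [] \<longrightarrow> leqI \<alpha> (hd L) \<and> leqI (last L) \<gamma>)"

definition Ideal :: "nat \<Rightarrow> nat set \<Rightarrow> nat set \<Rightarrow> nat set \<Rightarrow> 'k::comm_ring_1 mpoly set" where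
  "Ideal d \<alpha> \<beta> \<gamma> = {p. \<exists>S a. finite S
       \<and> S \<subseteq> {\<tau> \<in> Iset d. \<not> leqI \<alpha> \<tau> \<or> \<not> leqI \<tau> \<gamma>}
       \<and> (\<forall>\<tau>\<in>S. inP d \<beta> (a \<tau>))
       \<and> p = (\<Sum>\<tau>\<in>S. a \<tau> * fpol d \<tau> \<beta>)}"

end

theory Submission
  imports Defs
begin

text \<open>
  The Pfaffians \<open>fpol d \<theta> \<beta>\<close> are the coordinates of pure spinors in the chart where the
  \<open>\<beta>\<close>-coordinate is 1. Pure spinors are cut out by Wick's quadratic relations and are stable under the
  one-parameter groups of pairs of Clifford generators. A homogeneous relation that vanishes on the Schubert
  cell of \<open>\<gamma>\<close> also vanishes on the cells below it, and on that cell it can be divided by the \<open>\<gamma>\<close>-coordinate;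
  by induction the standard monomials supported below \<open>\<gamma>\<close> are linearly independent on the cell.

  The products of two Pfaffians of a given weight span a space whose dimension is at most the number of
  standard pairs of that weight (a ballot number), because the pair of spinors is invariant under a torus of
  the orthogonal group of the plane. Hence the standard pairs are a basis, and restriction to
  cells shows that the larger factor of each pair occurring in a product dominates both factors of that product.
  This straightening law rewrites every monomial into standard ones and keeps an element outside
  \<open>[\<alpha>, \<gamma>]\<close> in every term. Padding with copies of \<open>\<beta>\<close>, whose Pfaffian is 1, forces \<open>\<beta>\<close> to remain in
  each chain, so all its members are comparable to \<open>\<beta>\<close>.
\<close>

section \<open>Pfaffians\<close>

text \<open>The chart where the \<beta>-coordinate is nonzero meets only the cells above \<beta>,
  while independence is tested on every cell. A relation between Pfaffians is therefore made
  homogeneous and carried from the chart to all pure spinors with a nonzero even coordinate. This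
  and the passage to smaller cells need no topology: a spinor is joined to the chart, or to the
  bigger cell, by a line \<open>p + t * q\<close> of pure spinors, and a polynomial in
  \<open>t\<close> with infinitely many zeros also vanishes at 0. The lines exist because a product
  of two generators with different indices has square zero, so that its exponential is linear in
  \<open>t\<close>. The straightening relations are never written down. They exist because two
  counts agree: an upper bound from the isotropic vectors \<open>(1, \<iota>)\<close> and
  \<open>(1, - \<iota>)\<close> of the plane, where \<open>2 \<noteq> 0\<close> and a square root of
  -1 enter, and a lower bound from ballot sequences. The order enters only through the locale
  \<open>pfaffian_poset\<close>, in which the choice of the chart has become the labelling
  \<open>r\<close> of the elements by even subsets of \<open>E\<close>.\<close>

fun pder :: "('a \<Rightarrow> 'r::comm_ring_1) \<Rightarrow> ('a list \<Rightarrow> 'r) \<Rightarrow> 'a list \<Rightarrow> 'r" where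
  "pder w H [] = 0"
| "pder w H (y # ys) = w y * H ys - pder w (\<lambda>zs. H (y # zs)) ys"

lemma pder_eq_sum:
  "pder w H ys = (\<Sum>j<length ys. (-1) ^ j * w (ys ! j) * H (take j ys @ drop (Suc j) ys))"
proof (induction ys arbitrary: H)
  case (Cons y ys)
  show ?case
    by (simp only: pder.simps Cons.IH length_Cons sum.lessThan_Suc_shift)
       (simp add: sum_negf mult.assoc)
qed simp

lemma pder_cong:
  assumes "\<And>y. y \<in> set ys \<Longrightarrow> w y = w' y"
    and "\<And>us y vs. ys = us @ y # vs \<Longrightarrow> H (us @ vs) = H' (us @ vs)"
  shows "pder w H ys = pder w' H' ys"
  using assms
proof (induction ys arbitrary: H H')
  case (Cons y ys)
  have "H (y # us @ vs) = H' (y # us @ vs)" if "ys = us @ z # vs" for us z vs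
    using Cons.prems(2)[of "y # us" z vs] that by simp
  then have "pder w (\<lambda>zs. H (y # zs)) ys = pder w' (\<lambda>zs. H' (y # zs)) ys"
    using Cons.prems(1) by (intro Cons.IH) auto
  moreover have "H ys = H' ys" using Cons.prems(2)[of "[]" y ys] by simp
  ultimately show ?case using Cons.prems(1)[of y] by simp
qed simp

lemma pder_eq_0:
  assumes "\<And>us y vs. ys = us @ y # vs \<Longrightarrow> w y = 0 \<or> H (us @ vs) = 0"
  shows "pder w H ys = 0"
  using assms
proof (induction ys arbitrary: H)
  case (Cons y ys)
  have "w z = 0 \<or> H (y # us @ vs) = 0" if "ys = us @ z # vs" for us z vs
    using Cons.prems[of "y # us" z vs] that by simp
  then have "pder w (\<lambda>zs. H (y # zs)) ys = 0" by (intro Cons.IH) auto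
  moreover have "w y * H ys = 0" using Cons.prems[of "[]" y ys] by auto
  ultimately show ?case by simp
qed simp

lemma pder_lin_weight:
  assumes "\<And>y. y \<in> set ys \<Longrightarrow> w y = a * w1 y + b * w2 y"
  shows "pder w H ys = a * pder w1 H ys + b * pder w2 H ys"
  using assms by (induction ys arbitrary: H) (auto simp: algebra_simps)

lemma pder_lin_fun:
  "pder w (\<lambda>zs. a * H1 zs + b * H2 zs) ys = a * pder w H1 ys + b * pder w H2 ys"
  by (induction ys arbitrary: H1 H2) (auto simp: algebra_simps)

lemma pder_diff: "pder w (\<lambda>zs. c * H1 zs - H2 zs) ys = c * pder w H1 ys - pder w H2 ys"
  using pder_lin_fun[of w c H1 "-1" H2 ys] by simp

text \<open>\<open>pder w\<close> is the interior product with the covector \<open>w\<close>,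
  written on words. Deleting two letters in either order gives the same word with opposite
  signs.\<close>

lemma pder_pder: "pder w (pder w H) ys = 0"
  by (induction ys arbitrary: H) (auto simp: pder_diff)

text \<open>A contraction shortens the word by one letter and so anticommutes with the parity
  operator.\<close>

lemma pder_sgn_length:
  "pder w (\<lambda>zs. (-1) ^ length zs * A zs) us = - ((-1) ^ length us * pder w A us)"
proof (induction us arbitrary: A)
  case (Cons u us)
  have "pder w (\<lambda>zs. - ((-1) ^ length zs * A (u # zs))) us
      = - pder w (\<lambda>zs. (-1) ^ length zs * A (u # zs)) us"
    using pder_lin_fun[of w "-1" "\<lambda>zs. (-1) ^ length zs * A (u # zs)" 0 _ us] by simp
  then show ?case using Cons.IH[of "\<lambda>zs. A (u # zs)"] by (simp add: algebra_simps)
qed simp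

lemma pf_fuel_Cons: "pf_fuel (Suc n) N (x # ys) = pder (N x) (pf_fuel n N) ys"
  by (simp add: pder_eq_sum)

lemma pf_fuel_irrelevant:
  "length xs \<le> n \<Longrightarrow> length xs \<le> m \<Longrightarrow> pf_fuel n N xs = pf_fuel m N xs"
proof (induction n arbitrary: m xs)
  case 0
  then show ?case by (cases m) auto
next
  case (Suc n)
  show ?case
  proof (cases xs)
    case Nil
    then show ?thesis by (cases m) auto
  next
    case (Cons x ys)
    then obtain m' where m: "m = Suc m'" using Suc.prems by (cases m) auto
    show ?thesis unfolding Cons m pf_fuel_Cons
      using Suc.prems Cons m by (intro pder_cong Suc.IH) auto
  qed
qed

lemma pfaffian_Nil [simp]: "pfaffian N [] = 1"
  by (simp add: pfaffian_def)

text \<open>Expansion along the first row is contraction of the smaller Pfaffians with that row, so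
  all later sign bookkeeping takes place in \<open>pder\<close>.\<close>

lemma pfaffian_Cons: "pfaffian N (x # ys) = pder (N x) (pfaffian N) ys"
  unfolding pfaffian_def length_Cons pf_fuel_Cons
  by (intro pder_cong pf_fuel_irrelevant) auto

lemma pfaffian_map: "pfaffian N (map h xs) = pfaffian (\<lambda>x y. N (h x) (h y)) xs"
proof (induction xs rule: length_induct)
  case (1 xs)
  have pder_map: "pder w H (map h ys) = pder (w \<circ> h) (H \<circ> map h) ys" for w H ys
    by (induction ys arbitrary: H) (auto simp: o_def)
  show ?case
  proof (cases xs)
    case (Cons x ys)
    then show ?thesis using 1
      by (auto simp: pfaffian_Cons pder_map o_def simp flip: map_append intro!: pder_cong)
  qed simp
qed

text \<open>Deleting letters keeps the order of the others, so the expansion reads only entries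
  above the diagonal. Forms given only on pairs in word order, such as \<open>letter_form\<close>,
  need no skew half.\<close>

lemma pfaffian_cong:
  assumes "\<And>us x vs y. xs = us @ x # vs \<Longrightarrow> y \<in> set vs \<Longrightarrow> N x y = N' x y"
  shows "pfaffian N xs = pfaffian N' xs"
  using assms
proof (induction xs rule: length_induct)
  case (1 xs)
  show ?case
  proof (cases xs)
    case (Cons x ys)
    have "pfaffian N (us @ vs) = pfaffian N' (us @ vs)" if ys: "ys = us @ y # vs" for us y vs
    proof -
      have "N z z' = N' z z'" if "us @ vs = us' @ z # vs'" "z' \<in> set vs'" for us' z vs' z'
      proof -
        have "\<exists>us1 vs1. xs = us1 @ z # vs1 \<and> set vs' \<subseteq> set vs1"
        proof -
          from that(1) consider t where "us @ t = us'" "vs = t @ z # vs'" | t where "us = us' @ t" "t @ vs = z # vs'"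
            unfolding append_eq_append_conv2 by metis
          then show ?thesis
          proof cases
          case (1 t)
          note * = this
          show ?thesis
            by (intro exI[of _ "x # us @ y # t"] exI[of _ vs']) (simp add: * Cons ys)
        next
          case (2 t)
          note * = this
          show ?thesis
          proof (cases t)
            case Nil
            with * show ?thesis
              by (intro exI[of _ "x # us @ [y]"] exI[of _ vs']) (simp add: Cons ys)
          next
            case (Cons z1 t1)
            with * show ?thesis
              by (intro exI[of _ "x # us'"] exI[of _ "t1 @ y # vs"])
                 (auto simp: \<open>xs = x # ys\<close> ys)
          qed
        qed
        qed
        then show ?thesis using 1(2) that(2) by blast
      qed
      then show ?thesis using 1(1) Cons ys by auto
    qed
    then show ?thesis unfolding Cons pfaffian_Cons
      using 1(2)[of "[]" x ys] Cons by (intro pder_cong) auto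
  qed simp
qed

lemma pder_lin_letter:
  assumes "w l = a * w l1 + b * w l2"
    and "\<And>us vs. length us + length vs < length xs + length ys \<Longrightarrow> H (us @ l # vs) = a * H (us @ l1 # vs) + b * H (us @ l2 # vs)"
  shows "pder w H (xs @ l # ys) = a * pder w H (xs @ l1 # ys) + b * pder w H (xs @ l2 # ys)"
  using assms
proof (induction xs arbitrary: H)
  case Nil
  have "pder w (\<lambda>zs. H (l # zs)) ys = pder w (\<lambda>zs. a * H (l1 # zs) + b * H (l2 # zs)) ys"
    using Nil(2)[of "[]"] by (intro pder_cong) auto
  then show ?case using Nil(1) by (simp add: pder_lin_fun algebra_simps)
next
  case (Cons x xs)
  have "pder w (\<lambda>zs. H (x # zs)) (xs @ l # ys)
    = a * pder w (\<lambda>zs. H (x # zs)) (xs @ l1 # ys) + b * pder w (\<lambda>zs. H (x # zs)) (xs @ l2 # ys)"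
    using Cons.prems(1) Cons.prems(2)[of "x # _"] by (intro Cons.IH) auto
  moreover have "H (xs @ l # ys) = a * H (xs @ l1 # ys) + b * H (xs @ l2 # ys)"
    by (rule Cons.prems(2)) simp
  ultimately show ?case by (simp add: algebra_simps)
qed

lemma pfaffian_lin_letter:
  assumes "\<And>y. N l y = a * N l1 y + b * N l2 y" "\<And>y. N y l = a * N y l1 + b * N y l2"
  shows "pfaffian N (xs @ l # ys) = a * pfaffian N (xs @ l1 # ys) + b * pfaffian N (xs @ l2 # ys)"
proof (induction "length xs + length ys" arbitrary: xs ys rule: less_induct)
  case less
  show ?case
  proof (cases xs)
    case Nil
    then show ?thesis by (simp add: pfaffian_Cons pder_lin_weight[where w = "N l"] assms(1))
  next
    case (Cons x xs')
    show ?thesis unfolding Cons append_Cons pfaffian_Cons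
      using Cons by (intro pder_lin_letter less assms) auto
  qed
qed

text \<open>For a repeated letter in front, two successive expansions contract twice with the same
  covector, and \<open>N l l = 0\<close> removes the remaining term. Further back, deleting one copy
  or the other leaves the same word with opposite signs.\<close>

lemma pfaffian_alternating:
  assumes "N l l = 0"
  shows "pfaffian N (xs @ l # l # ys) = 0"
proof (induction "length xs + length ys" arbitrary: xs ys rule: less_induct)
  case less
  have aux: "pder w H (us @ l # l # vs) = 0"
    if "\<And>us' vs'. length us' + length vs' < length us + length vs \<Longrightarrow> H (us' @ l # l # vs') = 0" for w H us vs
    using that
  proof (induction us arbitrary: H)
    case Nil
    have "pder w (\<lambda>zs. H (l # l # zs)) vs = 0"
      using Nil[of "[]"] by (intro pder_eq_0) auto
    then show ?case by simp
  next
    case (Cons u us)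
    have "pder w (\<lambda>zs. H (u # zs)) (us @ l # l # vs) = 0"
      using Cons.prems[of "u # _"] by (intro Cons.IH) auto
    moreover have "H (us @ l # l # vs) = 0" by (rule Cons.prems) simp
    ultimately show ?case by simp
  qed
  show ?case
  proof (cases xs)
    case Nil
    have "pder (N l) (\<lambda>zs. pfaffian N (l # zs)) ys = 0"
      unfolding pfaffian_Cons using pder_pder by metis
    then show ?thesis by (simp add: Nil pfaffian_Cons[of N l "l # ys"] assms)
  next
    case (Cons x xs')
    show ?thesis unfolding Cons append_Cons pfaffian_Cons
      using Cons by (intro aux less) auto
  qed
qed

text \<open>Sign of the unshuffle that brings the letters satisfying \<open>Q\<close> to the front:
  every other letter passes the \<open>Q\<close>-letters behind it.\<close>

fun shuffle_sgn :: "('a \<Rightarrow> bool) \<Rightarrow> 'a list \<Rightarrow> 'r::comm_ring_1" where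
  "shuffle_sgn Q [] = 1"
| "shuffle_sgn Q (x # xs) = (if Q x then 1 else (-1) ^ length (filter Q xs)) * shuffle_sgn Q xs"

lemma shuffle_sgn_cases: "shuffle_sgn Q xs = (1::'r::comm_ring_1) \<or> shuffle_sgn Q xs = (-1::'r)"
proof (induction xs)
  case (Cons x xs)
  then show ?case
    by (cases "even (length (filter Q xs))") auto
qed simp

text \<open>Together with \<open>pder_split2\<close> this is the Leibniz rule for contracting a
  product: a covector supported on one kind of letter acts on one factor only, and to reach the
  second factor it passes the letters of the first at the cost of a sign.\<close>

lemma pder_split1:
  assumes "\<And>y. y \<in> set ys \<Longrightarrow> \<not> Q y \<Longrightarrow> w y = 0"
  shows "pder w (\<lambda>zs. shuffle_sgn Q zs * A (filter Q zs) * B (filter (\<lambda>x. \<not> Q x) zs)) ys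
     = shuffle_sgn Q ys * pder w A (filter Q ys) * B (filter (\<lambda>x. \<not> Q x) ys)"
  using assms
proof (induction ys arbitrary: A B)
  case (Cons y ys)
  show ?case
  proof (cases "Q y")
    case True
    then show ?thesis using Cons.IH[of "\<lambda>zs. A (y # zs)" B] Cons.prems
      by (simp add: algebra_simps)
  next
    case False
    then have wy: "w y = 0" using Cons.prems by auto
    have "pder w (\<lambda>zs. (-1) ^ length (filter Q zs) * shuffle_sgn Q zs * A (filter Q zs) * B (y # filter (\<lambda>x. \<not> Q x) zs)) ys
      = pder w (\<lambda>zs. shuffle_sgn Q zs * ((-1) ^ length (filter Q zs) * A (filter Q zs)) * B (y # filter (\<lambda>x. \<not> Q x) zs)) ys"
      by (intro pder_cong) (auto simp: algebra_simps)
    also have "\<dots> = - (shuffle_sgn Q ys * ((-1) ^ length (filter Q ys) * pder w A (filter Q ys)) * B (y # filter (\<lambda>x. \<not> Q x) ys))"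
      using Cons.IH[of "\<lambda>zs. (-1) ^ length zs * A zs" "\<lambda>zs. B (y # zs)"] Cons.prems
      by (simp add: pder_sgn_length)
    finally show ?thesis using False wy by (simp add: algebra_simps)
  qed
qed simp

lemma pder_split2:
  assumes "\<And>y. y \<in> set ys \<Longrightarrow> Q y \<Longrightarrow> w y = 0"
  shows "pder w (\<lambda>zs. shuffle_sgn Q zs * A (filter Q zs) * B (filter (\<lambda>x. \<not> Q x) zs)) ys
     = (-1) ^ length (filter Q ys) * shuffle_sgn Q ys * A (filter Q ys) * pder w B (filter (\<lambda>x. \<not> Q x) ys)"
  using assms
proof (induction ys arbitrary: A B)
  case (Cons y ys)
  show ?case
  proof (cases "Q y")
    case True
    then have wy: "w y = 0" using Cons.prems by auto
    then show ?thesis using True Cons.IH[of "\<lambda>zs. A (y # zs)" B] Cons.prems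
      by (simp add: algebra_simps)
  next
    case False
    have "pder w (\<lambda>zs. (-1) ^ length (filter Q zs) * shuffle_sgn Q zs * A (filter Q zs) * B (y # filter (\<lambda>x. \<not> Q x) zs)) ys
      = pder w (\<lambda>zs. shuffle_sgn Q zs * ((-1) ^ length (filter Q zs) * A (filter Q zs)) * B (y # filter (\<lambda>x. \<not> Q x) zs)) ys"
      by (intro pder_cong) (auto simp: algebra_simps)
    also have "\<dots> = (-1) ^ length (filter Q ys) * shuffle_sgn Q ys * ((-1) ^ length (filter Q ys) * A (filter Q ys)) * pder w (\<lambda>zs. B (y # zs)) (filter (\<lambda>x. \<not> Q x) ys)"
      using Cons.IH[of "\<lambda>zs. (-1) ^ length zs * A zs" "\<lambda>zs. B (y # zs)"] Cons.prems
      by simp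
    finally show ?thesis using False
      by (simp add: algebra_simps)
  qed
qed simp

text \<open>The matrix is block diagonal after the unshuffle. Its first row lives in one block, so
  each expansion step is a contraction of one factor.\<close>

lemma pfaffian_split:
  assumes "\<And>x y. x \<in> set xs \<Longrightarrow> y \<in> set xs \<Longrightarrow> Q x \<noteq> Q y \<Longrightarrow> N x y = 0"
  shows "pfaffian N xs = shuffle_sgn Q xs * pfaffian N (filter Q xs) * pfaffian N (filter (\<lambda>x. \<not> Q x) xs)"
  using assms
proof (induction xs rule: length_induct)
  case (1 xs)
  show ?case
  proof (cases xs)
    case (Cons x ys)
    have "pfaffian N xs = pder (N x) (\<lambda>zs. shuffle_sgn Q zs * pfaffian N (filter Q zs) * pfaffian N (filter (\<lambda>x. \<not> Q x) zs)) ys"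
      unfolding Cons pfaffian_Cons using 1 Cons by (intro pder_cong) auto
    then show ?thesis using 1(2) Cons
      by (cases "Q x") (auto simp: pder_split1 pder_split2 pfaffian_Cons)
  qed simp
qed

text \<open>Only letters of different kinds can be matched, so an expansion step with a nonzero
  entry removes one of each kind and preserves the imbalance, which the empty word does not
  have.\<close>

lemma pfaffian_unbalanced:
  assumes "\<And>x y. x \<in> set xs \<Longrightarrow> y \<in> set xs \<Longrightarrow> Q x = Q y \<Longrightarrow> N x y = 0"
    and "length (filter Q xs) \<noteq> length (filter (\<lambda>x. \<not> Q x) xs)"
  shows "pfaffian N xs = 0"
  using assms
proof (induction xs rule: length_induct)
  case (1 xs)
  show ?case
  proof (cases xs)
    case Nil
    then show ?thesis using 1 by simp
  next
    case (Cons x ys)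
    have "N x y = 0 \<or> pfaffian N (us @ vs) = 0" if ys: "ys = us @ y # vs" for us y vs
    proof (cases "Q x = Q y")
      case True
      then show ?thesis using 1(2)[of x y] Cons ys by auto
    next
      case False
      have "length (us @ vs) < length xs" by (simp add: Cons ys)
      moreover have "length (filter Q (us @ vs)) \<noteq> length (filter (\<lambda>x. \<not> Q x) (us @ vs))"
        using False 1(3) by (auto simp: Cons ys split: if_splits)
      ultimately have "pfaffian N (us @ vs) = 0"
        using 1(1)[rule_format, of "us @ vs"] 1(2) by (simp add: Cons ys)
      then show ?thesis ..
    qed
    then show ?thesis unfolding Cons pfaffian_Cons by (intro pder_eq_0) auto
  qed
qed

section \<open>Pure spinors\<close>

definition toggle :: "nat \<Rightarrow> nat set \<Rightarrow> nat set" where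
  "toggle a A = (if a \<in> A then A - {a} else insert a A)"

definition pos_sgn :: "nat \<Rightarrow> nat set \<Rightarrow> 'k::comm_ring_1" where
  "pos_sgn a A = (-1) ^ card {x \<in> A. x < a}"

text \<open>\<open>cliff a True\<close> and \<open>cliff a False\<close> are the creation and annihilation operators of the Clifford
  algebra acting on the exterior algebra, an element of which is given by its coefficients.\<close>
definition cliff :: "nat \<Rightarrow> bool \<Rightarrow> (nat set \<Rightarrow> 'k::comm_ring_1) \<Rightarrow> nat set \<Rightarrow> 'k" where
  "cliff a s q A = (if (a \<in> A) = s then pos_sgn a A * q (toggle a A) else 0)"

text \<open>Coefficient at \<open>A\<close>, \<open>B\<close> of the invariant tensor of the
  quadratic form, acting on \<open>p\<close> tensor \<open>q\<close> in the dual bases of creation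
  and annihilation operators. Its vanishing on \<open>p\<close> tensor \<open>p\<close> is Cartan's
  criterion for pure spinors. The zero vector satisfies it; nonvanishing is demanded separately
  where it matters.\<close>

definition wick_form :: "nat set \<Rightarrow> (nat set \<Rightarrow> 'k::comm_ring_1) \<Rightarrow> (nat set \<Rightarrow> 'k) \<Rightarrow> nat set \<Rightarrow> nat set \<Rightarrow> 'k" where
  "wick_form E p q A B =
     (\<Sum>i\<in>E. cliff i True p A * cliff i False q B + cliff i False p A * cliff i True q B)"

definition pure_spinor :: "nat set \<Rightarrow> (nat set \<Rightarrow> 'k::comm_ring_1) \<Rightarrow> bool" where
  "pure_spinor E p \<longleftrightarrow> (\<forall>A B. wick_form E p p A B = 0)"

lemma mem_toggle: "x \<in> toggle a A \<longleftrightarrow> (if x = a then a \<notin> A else x \<in> A)"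
  by (auto simp: toggle_def)

lemma toggle_toggle [simp]: "toggle a (toggle a A) = A"
  by (auto simp: toggle_def)

lemma toggle_commute: "toggle a (toggle b A) = toggle b (toggle a A)"
  by (auto simp: set_eq_iff mem_toggle)

lemma pos_sgn_insert: "a \<notin> A \<Longrightarrow> pos_sgn b (insert a A) = (if a < b then - pos_sgn b A else pos_sgn b A)"
proof -
  assume a: "a \<notin> A"
  have fin: "finite {x \<in> A. x < b}" by (rule finite_subset[of _ "{..<b}"]) auto
  have "{x \<in> insert a A. x < b} = (if a < b then insert a {x \<in> A. x < b} else {x \<in> A. x < b})" by auto
  then show ?thesis using a fin by (simp add: pos_sgn_def)
qed

lemma pos_sgn_toggle: "pos_sgn b (toggle a A) = (if a < b then - pos_sgn b A else pos_sgn b A)"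
proof (cases "a \<in> A")
  case True
  then have "pos_sgn b A = (if a < b then - pos_sgn b (A - {a}) else pos_sgn b (A - {a}) :: 'a)"
    using pos_sgn_insert[of a "A - {a}" b] by (simp add: insert_absorb)
  then show ?thesis using True by (auto simp: toggle_def)
qed (simp add: pos_sgn_insert toggle_def)

lemma pos_sgn_sq [simp]: "pos_sgn a A * pos_sgn a A = 1"
  by (simp add: pos_sgn_def flip: power_add)

lemma pos_sgn_least:
  assumes "\<And>x. x \<in> A \<Longrightarrow> a \<le> x" shows "pos_sgn a A = 1"
proof -
  have e: "{x \<in> A. x < a} = {}" using assms by force
  show ?thesis unfolding pos_sgn_def e by simp
qed

lemma cliff_anticommute:
  assumes "a \<noteq> b"
  shows "cliff a s (cliff b s' q) A = - cliff b s' (cliff a s q) A"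
  using assms by (auto simp: cliff_def mem_toggle pos_sgn_toggle toggle_commute[of b a])

lemma cliff_square: "cliff a s (cliff a s q) A = 0"
  by (auto simp: cliff_def mem_toggle)

lemma cliff_dual: "cliff a s (cliff a (\<not> s) q) A + cliff a (\<not> s) (cliff a s q) A = q A"
  by (auto simp: cliff_def mem_toggle pos_sgn_toggle simp flip: mult.assoc)

lemma cliff_add_scaled: "cliff a s (\<lambda>A. p A + t * q A) A = cliff a s p A + t * cliff a s q A"
  by (simp add: cliff_def algebra_simps)

lemma cliff_uminus: "cliff a s (\<lambda>A. - q A) A = - cliff a s q A"
  by (simp add: cliff_def)

definition cliff2_coeff :: "nat \<Rightarrow> bool \<Rightarrow> nat \<Rightarrow> bool \<Rightarrow> nat set \<Rightarrow> 'k::comm_ring_1" where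
  "cliff2_coeff a s b s' A = (if (a \<in> A) = s \<and> (b \<in> A) = s' then pos_sgn a A * pos_sgn b (toggle a A) else 0)"

lemma cliff2_eq:
  assumes "a \<noteq> b"
  shows "cliff a s (cliff b s' q) A = cliff2_coeff a s b s' A * q (toggle b (toggle a A))"
  using assms by (simp add: cliff_def cliff2_coeff_def mem_toggle)

lemma cliff2_coeff_unit:
  assumes "(a \<in> A) = s" "(b \<in> A) = s'"
  shows "cliff2_coeff a s b s' A * cliff2_coeff a s b s' A = (1::'k::comm_ring_1)"
proof -
  have "cliff2_coeff a s b s' A * cliff2_coeff a s b s' A
     = (pos_sgn a A * pos_sgn a A) * (pos_sgn b (toggle a A) * pos_sgn b (toggle a A)) "
    using assms by (simp add: cliff2_coeff_def algebra_simps)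
  then show ?thesis by simp
qed

text \<open>Quadratic elements act on the generators by commutators, as the orthogonal Lie algebra
  acts on its vector representation. Only the generators dual to the two factors have a nonzero
  commutator.\<close>

lemma cliff_cliff2:
  assumes "a \<noteq> b"
  shows "cliff i u (cliff a s (cliff b s' q)) A = cliff a s (cliff b s' (cliff i u q)) A
     + (if i = a \<and> u \<noteq> s then cliff b s' q A else 0) - (if i = b \<and> u \<noteq> s' then cliff a s q A else 0)"
proof -
  have anti: "cliff x y (cliff z w q') = (\<lambda>A. - cliff z w (cliff x y q') A)" if "x \<noteq> z" for x y z w and q' :: "nat set \<Rightarrow> 'a"
    by (rule ext) (rule cliff_anticommute[OF that])
  have sq: "cliff x y (cliff x y q') = (\<lambda>A. 0)" for x y and q' :: "nat set \<Rightarrow> 'a"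
    by (rule ext) (rule cliff_square)
  have zero: "cliff x y (\<lambda>A. 0) A = (0::'a)" for x y A by (simp add: cliff_def)
  consider "i \<noteq> a" "i \<noteq> b" | "i = a" | "i = b" by blast
  then show ?thesis
  proof cases
    case 1
    have "cliff i u (cliff a s (cliff b s' q)) A = - cliff a s (cliff i u (cliff b s' q)) A"
      using 1 by (simp add: anti[of i a])
    also have "\<dots> = cliff a s (cliff b s' (cliff i u q)) A"
      using 1 by (simp add: anti[of i b] cliff_uminus)
    finally show ?thesis using 1 by simp
  next
    case 2
    have e: "cliff a s (cliff b s' (cliff a u q)) A = - cliff a s (cliff a u (cliff b s' q)) A"
      using assms by (simp add: anti[of b a] cliff_uminus)
    show ?thesis
    proof (cases "u = s")
      case True
      then show ?thesis using 2 e assms by (simp add: cliff_square)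
    next
      case False
      then have "u = (\<not> s)" by auto
      then show ?thesis using 2 e assms cliff_dual[of a s "cliff b s' q" A] by (simp add: algebra_simps)
    qed
  next
    case 3
    have e: "cliff b u (cliff a s (cliff b s' q)) A = - cliff a s (cliff b u (cliff b s' q)) A"
      using assms by (simp add: anti[of b a])
    show ?thesis
    proof (cases "u = s'")
      case True
      then show ?thesis using 3 e assms by (simp add: sq zero)
    next
      case False
      then have u: "u = (\<not> s')" by auto
      have "cliff a s (\<lambda>A. cliff b (\<not> s') (cliff b s' q) A + 1 * cliff b s' (cliff b (\<not> s') q) A) A = cliff a s q A"
        using cliff_dual[of b "\<not> s'" q] by simp
      then show ?thesis using 3 e u assms unfolding cliff_add_scaled by (simp add: algebra_simps)
    qed
  qed
qed

lemma wick_form_commute: "wick_form E p q A B = wick_form E q p B A"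
  unfolding wick_form_def by (intro sum.cong refl) (simp add: algebra_simps)

text \<open>Moving the quadratic element out of the first argument leaves its commutators with the
  generators, which are nonzero only for \<open>i = a\<close> and \<open>i = b\<close>.\<close>

lemma wick_form_cliff2:
  assumes "finite E" "a \<in> E" "b \<in> E" "a \<noteq> b"
  shows "wick_form E (cliff a s (cliff b s' p)) q A B =
     cliff2_coeff a s b s' A * wick_form E p q (toggle b (toggle a A)) B
     + cliff b s' p A * cliff a s q B - cliff a s p A * cliff b s' q B"
proof -
  let ?x = "cliff a s" and ?y = "cliff b s'" and ?k = "cliff2_coeff a s b s' A" and ?A = "toggle b (toggle a A)"
  have "wick_form E (?x (?y p)) q A B = (\<Sum>i\<in>E. ?k * (cliff i True p ?A * cliff i False q B + cliff i False p ?A * cliff i True q B)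
      + (if i = a then ?y p A * ?x q B else 0) - (if i = b then ?x p A * ?y q B else 0))"
    unfolding wick_form_def
  proof (intro sum.cong refl)
    fix i
    show "cliff i True (?x (?y p)) A * cliff i False q B + cliff i False (?x (?y p)) A * cliff i True q B =
      ?k * (cliff i True p ?A * cliff i False q B + cliff i False p ?A * cliff i True q B)
      + (if i = a then ?y p A * ?x q B else 0) - (if i = b then ?x p A * ?y q B else 0)"
      unfolding cliff_cliff2[OF assms(4)] cliff2_eq[OF assms(4)]
      by (cases s; cases s') (auto simp: algebra_simps)
  qed
  also have "\<dots> = ?k * wick_form E p q ?A B + ?y p A * ?x q B - ?x p A * ?y q B"
    using assms by (simp add: sum.distrib sum_subtractf wick_form_def flip: sum_distrib_left)
  finally show ?thesis .
qed

lemma wick_form_add_scaled: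
  "wick_form E (\<lambda>A. p A + t * q A) r A B = wick_form E p r A B + t * wick_form E q r A B"
  unfolding wick_form_def cliff_add_scaled sum_distrib_left sum.distrib[symmetric]
  by (intro sum.cong refl) (simp add: algebra_simps)

text \<open>As a and b differ, the quadratic element F has square zero and \<open>1 + t F\<close> is
  its exponential, an element of the spin group. In the expansion in \<open>t\<close> the linear
  terms cancel by skewness in \<open>A\<close> and \<open>B\<close>; the quadratic term vanishes
  since both factors of F annihilate its image.\<close>

lemma pure_spinor_cliff2:
  assumes "finite E" "a \<in> E" "b \<in> E" "a \<noteq> b" "pure_spinor E p"
  shows "pure_spinor E (\<lambda>A. p A + t * cliff a s (cliff b s' p) A)"
  unfolding pure_spinor_def
proof (intro allI)
  fix A B
  let ?x = "cliff a s" and ?y = "cliff b s'"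
  let ?Fp = "?x (?y p)"
  note wf = wick_form_cliff2[OF assms(1-4), of s s']
  have pp: "wick_form E p p A B = 0" for A B using assms(5) by (simp add: pure_spinor_def)
  have Fp: "wick_form E ?Fp p A B = ?y p A * ?x p B - ?x p A * ?y p B" for A B
    by (simp add: wf pp)
  have x0: "?x ?Fp A = 0" for A by (rule cliff_square)
  have "?Fp = (\<lambda>A. - ?y (?x p) A)" by (rule ext) (rule cliff_anticommute[OF assms(4)])
  then have y0: "?y ?Fp A = 0" for A by (simp add: cliff_uminus cliff_square)
  \<comment> \<open>Where the coefficient is nonzero, toggling has reversed the memberships of a and
    b, so neither generator contributes at the toggled set.\<close>
  have z1: "cliff2_coeff a s b s' A * ?y p (toggle b (toggle a A)) = 0" for A :: "nat set"
    using assms(4) by (simp add: cliff_def cliff2_coeff_def mem_toggle)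
  have z2: "cliff2_coeff a s b s' A * ?x p (toggle b (toggle a A)) = 0" for A :: "nat set"
    using assms(4) by (simp add: cliff_def cliff2_coeff_def mem_toggle)
  have FF: "wick_form E ?Fp ?Fp A B = 0" for A B
  proof -
    have "wick_form E ?Fp ?Fp A B = cliff2_coeff a s b s' A * wick_form E p ?Fp (toggle b (toggle a A)) B"
      by (simp add: wf[of p ?Fp] x0 y0)
    also have "\<dots> = 0"
      unfolding wick_form_commute[of E p ?Fp] Fp using z1[of A] z2[of A] by (simp add: algebra_simps)
    finally show ?thesis .
  qed
  have "wick_form E (\<lambda>A. p A + t * ?Fp A) (\<lambda>A. p A + t * ?Fp A) A B =
     wick_form E p p A B + t * wick_form E ?Fp p B A + t * (wick_form E ?Fp p A B + t * wick_form E ?Fp ?Fp A B)"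
  proof -
    have "wick_form E q (\<lambda>A. p A + t * ?Fp A) A B = wick_form E p q B A + t * wick_form E ?Fp q B A" for q
      by (subst wick_form_commute) (rule wick_form_add_scaled)
    from this[of p] this[of ?Fp] show ?thesis
      unfolding wick_form_add_scaled[of E p t ?Fp "\<lambda>A. p A + t * ?Fp A"]
      by (simp add: FF pp wick_form_commute[of E p ?Fp B A])
  qed
  also have "\<dots> = 0" by (simp add: pp FF Fp algebra_simps)
  finally show "wick_form E (\<lambda>A. p A + t * ?Fp A) (\<lambda>A. p A + t * ?Fp A) A B = 0" .
qed

lemma pure_spinor_scale:
  assumes "pure_spinor E p" shows "pure_spinor E (\<lambda>A. c * p A)"
proof -
  have "wick_form E (\<lambda>A. c * p A) (\<lambda>A. c * p A) A B = c * c * wick_form E p p A B" for A B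
    unfolding wick_form_def sum_distrib_left by (intro sum.cong refl) (simp add: cliff_def algebra_simps)
  then show ?thesis using assms by (simp add: pure_spinor_def)
qed

text \<open>Both generators of an index would have to be applicable to the same set
  \<open>S\<close>, one requiring the index to be in \<open>S\<close> and the other requiring it to
  be outside.\<close>

lemma pure_spinor_delta: "pure_spinor E (\<lambda>A. if A = S then 1 else 0)"
proof -
  have "cliff i u (\<lambda>A. if A = S then 1 else 0) A * cliff i (\<not> u) (\<lambda>A. if A = S then 1 else 0) B = (0::'a)" for i u A B
    using mem_toggle[of i i A] mem_toggle[of i i B] by (auto simp: cliff_def)
  from this[of _ True] this[of _ False] show ?thesis
    by (simp add: pure_spinor_def wick_form_def)
qed

lemma pder_sorted:
  assumes "sorted_wrt (<) ys"
  shows "pder w H ys = (\<Sum>i\<in>set ys. pos_sgn i (set ys) * w i * H (remove1 i ys))"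
  using assms
proof (induction ys arbitrary: H)
  case (Cons y ys)
  have y: "y \<notin> set ys" using Cons.prems by auto
  have [simp]: "pos_sgn y (insert y (set ys)) = 1"
    using Cons.prems by (intro pos_sgn_least) auto
  have "(\<Sum>i\<in>set ys. pos_sgn i (insert y (set ys)) * w i * H (remove1 i (y # ys)))
     = (\<Sum>i\<in>set ys. - (pos_sgn i (set ys) * w i * H (y # remove1 i ys)))"
    using Cons.prems y by (intro sum.cong refl) (auto simp: pos_sgn_insert)
  then show ?case using y Cons by (simp add: sum_negf)
qed simp

text \<open>The Wick relation at \<open>A = S - {Min S}\<close> and \<open>B = {Min S}\<close> is
  the expansion of a Pfaffian along its first row; \<open>p {} = 1\<close> makes \<open>p S\<close>
  its leading term. A normalized pure spinor is thus determined by its coordinates at two-element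
  sets.\<close>

lemma pure_spinor_pfaffian:
  assumes "finite E" "pure_spinor E p" "p {} = 1" "S \<subseteq> E"
  shows "p S = pfaffian (\<lambda>x y. p {x, y}) (sorted_list_of_set S)"
  using assms(4)
proof (induction "card S" arbitrary: S rule: less_induct)
  case less
  have fin: "finite S" using less.prems assms(1) finite_subset by blast
  show ?case
  proof (cases "S = {}")
    case True
    then show ?thesis using assms by simp
  next
    case False
    define x where "x = Min S"
    define A where "A = S - {x}"
    have x: "x \<in> S" using False fin by (simp add: x_def)
    have xA: "x < i" if "i \<in> A" for i using that fin by (simp add: A_def x_def Min_less_iff less_le)
    have S: "S = insert x A" using x by (auto simp: A_def)
    have finA: "finite A" using fin by (simp add: A_def)
    have "x \<notin> A" by (simp add: A_def)
    have "0 = wick_form E p p A {x}" using assms(2) by (simp add: pure_spinor_def)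
    also have "\<dots> = (\<Sum>i\<in>E. if i = x then p S else if i \<in> A then - (pos_sgn i A * p (A - {i}) * p {x, i}) else 0)"
      unfolding wick_form_def
    proof (intro sum.cong refl)
      fix i
      have 1: "pos_sgn x A = (1::'a)" using xA by (intro pos_sgn_least less_imp_le)
      have 2: "pos_sgn x {x} = (1::'a)" by (intro pos_sgn_least) auto
      have 3: "i \<in> A \<Longrightarrow> pos_sgn i {x} = (-1::'a)"
        using xA[of i] pos_sgn_insert[of x "{}" i] by (simp add: pos_sgn_def)
      show "cliff i True p A * cliff i False p {x} + cliff i False p A * cliff i True p {x} =
        (if i = x then p S else if i \<in> A then - (pos_sgn i A * p (A - {i}) * p {x, i}) else 0)"
        using \<open>x \<notin> A\<close> 1 2 3 assms(3) by (auto simp: cliff_def toggle_def S insert_commute)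
    qed
    also have "\<dots> = p S + (\<Sum>i\<in>E - {x}. if i \<in> A then - (pos_sgn i A * p (A - {i}) * p {x, i}) else 0)"
      using x less.prems assms(1) by (subst sum.remove[of E x]) auto
    also have "(\<Sum>i\<in>E - {x}. if i \<in> A then - (pos_sgn i A * p (A - {i}) * p {x, i}) else 0)
       = (\<Sum>i\<in>A. - (pos_sgn i A * p (A - {i}) * p {x, i}))"
    proof -
      have "A = (E - {x}) \<inter> {i. i \<in> A}" using less.prems by (auto simp: A_def)
      then show ?thesis using assms(1) by (simp add: sum.If_cases) 
    qed
    finally have pS: "p S = (\<Sum>i\<in>A. pos_sgn i A * p (A - {i}) * p {x, i})" by (simp add: sum_negf)
    have "sorted_list_of_set S = x # sorted_list_of_set A"
      using fin False by (simp add: x_def A_def sorted_list_of_set_nonempty)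
    then have "pfaffian (\<lambda>x y. p {x, y}) (sorted_list_of_set S)
      = pder (\<lambda>y. p {x, y}) (pfaffian (\<lambda>x y. p {x, y})) (sorted_list_of_set A)"
      by (simp add: pfaffian_Cons)
    also have "\<dots> = (\<Sum>i\<in>A. pos_sgn i A * p {x, i} * pfaffian (\<lambda>x y. p {x, y}) (sorted_list_of_set (A - {i})))"
      using finA by (simp add: pder_sorted sorted_list_of_set_remove)
    also have "\<dots> = (\<Sum>i\<in>A. pos_sgn i A * p (A - {i}) * p {x, i})"
    proof (intro sum.cong refl)
      fix i assume "i \<in> A"
      then have "card (A - {i}) < card S" using finA \<open>x \<notin> A\<close> unfolding S
        by (simp add: card_gt_0_iff less_SucI)
      then have "p (A - {i}) = pfaffian (\<lambda>x y. p {x, y}) (sorted_list_of_set (A - {i}))"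
        using less.prems S by (intro less.hyps) auto
      then show "pos_sgn i A * p {x, i} * pfaffian (\<lambda>x y. p {x, y}) (sorted_list_of_set (A - {i}))
         = pos_sgn i A * p (A - {i}) * p {x, i}" by (simp add: algebra_simps)
    qed
    finally show ?thesis using pS by simp
  qed
qed

section \<open>Polynomial relations carried along lines of spinors\<close>

definition chain_form :: "('i list \<Rightarrow> 'k::comm_ring_1) \<Rightarrow> 'i list set \<Rightarrow> ('i \<Rightarrow> 'k) \<Rightarrow> 'k" where
  "chain_form c S p = (\<Sum>L\<in>S. c L * prod_list (map p L))"

text \<open>Takes the place of a closure argument: along the line the form is a polynomial in
  \<open>t\<close> with infinitely many zeros, hence zero, and its value at \<open>t = 0\<close> is
  the one wanted.\<close>

lemma chain_form_curve:
  fixes p q :: "'i \<Rightarrow> 'k::field"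
  assumes "infinite (UNIV :: 'k set)" "finite T"
    and "\<And>t. t \<notin> T \<Longrightarrow> chain_form c S (\<lambda>i. p i + t * q i) = 0"
  shows "chain_form c S p = 0"
proof -
  define P where "P = (\<Sum>L\<in>S. smult (c L) (prod_list (map (\<lambda>i. [:p i, q i:]) L)))"
  have prod: "poly (prod_list (map g L)) t = prod_list (map (\<lambda>i. poly (g i) t) L)" for g :: "'i \<Rightarrow> 'k poly" and t L
    by (induction L) auto
  have P: "poly P t = chain_form c S (\<lambda>i. p i + t * q i)" for t
    by (simp add: P_def chain_form_def poly_sum prod)
  have "P = 0"
  proof (rule ccontr)
    assume "P \<noteq> 0"
    then have "finite {t. poly P t = 0}" by (rule poly_roots_finite)
    moreover have "UNIV = T \<union> {t. poly P t = 0}" using assms(3) by (auto simp: P)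
    ultimately show False using assms(1,2) by (metis finite_Un)
  qed
  then show ?thesis using P[of 0] by simp
qed

text \<open>Over a finite field the product of all \<open>X - a\<close>, plus 1, would be a
  nonconstant polynomial without roots.\<close>

lemma algebraically_closed_infinite:
  assumes "algebraically_closed TYPE('k::field)"
  shows "infinite (UNIV :: 'k set)"
proof
  assume fin: "finite (UNIV :: 'k set)"
  define P where "P = (\<Prod>a\<in>UNIV. [:- a, 1:]) + (1 :: 'k poly)"
  have "poly P x = 1" for x
  proof -
    have "poly (\<Prod>a\<in>UNIV. [:- a, 1:]) x = 0"
      using fin by (auto simp: poly_prod prod_zero_iff)
    then show ?thesis by (simp add: P_def)
  qed
  moreover have "degree P > 0"
  proof (rule ccontr)
    assume "\<not> degree P > 0"
    then obtain c where "P = [:c:]" by (metis degree_eq_zeroE gr0I)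
    then have "(\<Prod>a\<in>UNIV. [:- a, 1:]) = [:c - 1:]" by (simp add: P_def eq_diff_eq one_pCons flip: eq_diff_eq)
    moreover have "degree (\<Prod>a\<in>(UNIV :: 'k set). [:- a, 1:]) = card (UNIV :: 'k set)"
      by (subst degree_prod_eq_sum_degree) auto
    ultimately have "card (UNIV :: 'k set) = 0" by simp
    then show False using fin by simp
  qed
  ultimately show False using assms unfolding algebraically_closed_def by (metis zero_neq_one)
qed

text \<open>The chart \<open>p {} \<noteq> 0\<close> is reached by shrinking the set
  \<open>R\<close> of a nonzero coordinate by two elements at a time: annihilating a pair of
  \<open>R\<close> feeds \<open>p R\<close> into the coordinate of the remaining set. Evenness of
  \<open>card R\<close> lets this end at the empty set.\<close>

lemma pure_spinor_dense:
  fixes c :: "'i list \<Rightarrow> 'k::field" and r :: "'i \<Rightarrow> nat set"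
  assumes inf: "infinite (UNIV :: 'k set)" and "finite E"
    and base: "\<And>p. pure_spinor E p \<Longrightarrow> p {} \<noteq> 0 \<Longrightarrow> chain_form c S (p \<circ> r) = 0"
    and "R \<subseteq> E" "even (card R)" "pure_spinor E p" "p R \<noteq> 0"
  shows "chain_form c S (p \<circ> r) = 0"
  using assms(4-)
proof (induction "card R" arbitrary: R p rule: less_induct)
  case less
  show ?case
  proof (cases "R = {}")
    case True
    then show ?thesis using base[of p] less.prems by simp
  next
    case False
    have finR: "finite R" using less.prems assms(2) finite_subset by blast
    from False obtain a where a: "a \<in> R" by blast
    have "R - {a} \<noteq> {}"
    proof
      assume "R - {a} = {}"
      then have "R = {a}" using a by auto
      then show False using less.prems by simp
    qed
    then obtain b where b: "b \<in> R" "b \<noteq> a" by blast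
    define R' where "R' = R - {a} - {b}"
    have tog: "toggle b (toggle a R') = R" using a b by (auto simp: toggle_def R'_def)
    have "R = insert a (insert b R')" "a \<notin> insert b R'" "b \<notin> R'" "finite R'"
      using a b finR by (auto simp: R'_def)
    then have card: "card R = Suc (Suc (card R'))" by simp
    let ?p = "\<lambda>t A. p A + t * cliff a False (cliff b False p) A"
    define k where "k = (cliff2_coeff a False b False R' :: 'k)"
    have "k * k = 1" unfolding k_def by (rule cliff2_coeff_unit) (auto simp: R'_def)
    then have k: "k \<noteq> 0" by auto
    have p': "?p t R' = p R' + t * k * p R" for t
      using cliff2_eq[of a b False False p R'] b tog by (simp add: k_def)
    \<comment> \<open>The excluded \<open>t\<close> is the only one for which the coordinate
      \<open>R'\<close> of the moved spinor vanishes.\<close>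
    have "chain_form c S (\<lambda>i. p (r i) + t * cliff a False (cliff b False p) (r i)) = 0"
      if "t \<notin> {- p R' / (k * p R)}" for t
    proof -
      have "?p t R' \<noteq> 0"
      proof
        assume "?p t R' = 0"
        then have "t * (k * p R) + p R' = 0" unfolding p' by (simp add: ac_simps)
        then have "t * (k * p R) = - p R'" by (simp only: eq_neg_iff_add_eq_0)
        then have "t = - p R' / (k * p R)" using k less.prems(4) by (simp only: eq_divide_eq) simp
        then show False using that by simp
      qed
      moreover have "pure_spinor E (?p t)"
        using less.prems a b assms(2) by (intro pure_spinor_cliff2) auto
      moreover have "R' \<subseteq> E" "even (card R')" "card R' < card R" using less.prems card by (auto simp: R'_def)
      ultimately have "chain_form c S (?p t \<circ> r) = 0"
        by (intro less.hyps[of R'])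
      then show ?thesis by (simp add: o_def)
    qed
    then have "chain_form c S (\<lambda>i. p (r i)) = 0"
      by (rule chain_form_curve[OF inf finite.insertI[OF finite.emptyI]])
    then show ?thesis by (simp add: o_def)
  qed
qed

section \<open>Products of two Pfaffians\<close>

definition monom_eval :: "(nat \<times> nat \<Rightarrow> 'k::comm_ring_1) \<Rightarrow> (nat \<times> nat \<Rightarrow>\<^sub>0 nat) \<Rightarrow> 'k" where
  "monom_eval x m = (\<Prod>v\<in>Poly_Mapping.keys m. x v ^ Poly_Mapping.lookup m v)"

definition mpoly_eval :: "(nat \<times> nat \<Rightarrow> 'k::comm_ring_1) \<Rightarrow> 'k mpoly \<Rightarrow> 'k" where
  "mpoly_eval x p = (\<Sum>m\<in>Poly_Mapping.keys p. Poly_Mapping.lookup p m * monom_eval x m)"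

lemma poly_mapping_eq_sum_single:
  "p = (\<Sum>m\<in>Poly_Mapping.keys p. Poly_Mapping.single m (Poly_Mapping.lookup p m))"
  by (rule poly_mapping_eqI)
     (simp add: lookup_sum lookup_single when_def in_keys_iff)

lemma poly_mapping_single_induct:
  fixes p :: "'a \<Rightarrow>\<^sub>0 'b::comm_monoid_add"
  assumes "P 0" "\<And>p q. P p \<Longrightarrow> P q \<Longrightarrow> P (p + q)" "\<And>m c. P (Poly_Mapping.single m c)"
  shows "P p"
proof -
  have "P (\<Sum>m\<in>M. Poly_Mapping.single m (Poly_Mapping.lookup p m))" if "finite M" for M
    using that assms by (induction M rule: finite_induct) auto
  then show ?thesis by (subst poly_mapping_eq_sum_single) auto
qed

lemma monom_eval_add: "monom_eval x (m + n) = monom_eval x m * monom_eval x n"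
proof -
  let ?K = "Poly_Mapping.keys m \<union> Poly_Mapping.keys n"
  have ext: "monom_eval x q = (\<Prod>v\<in>?K. x v ^ Poly_Mapping.lookup q v)" if "Poly_Mapping.keys q \<subseteq> ?K" for q
    unfolding monom_eval_def using that by (intro prod.mono_neutral_left) (auto simp: in_keys_iff)
  have "Poly_Mapping.keys (m + n) \<subseteq> ?K" by (rule keys_add)
  then show ?thesis by (simp add: ext prod.distrib lookup_add power_add)
qed

lemma mpoly_eval_0 [simp]: "mpoly_eval x 0 = 0"
  by (simp add: mpoly_eval_def)

lemma mpoly_eval_add: "mpoly_eval x (p + q) = mpoly_eval x p + mpoly_eval x q"
  unfolding mpoly_eval_def by (rule setsum_keys_plus_distrib) (auto simp: algebra_simps)

lemma mpoly_eval_single: "mpoly_eval x (Poly_Mapping.single m c) = c * monom_eval x m"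
  by (simp add: mpoly_eval_def)

lemma mpoly_eval_mult: "mpoly_eval x (p * q) = mpoly_eval x p * mpoly_eval x q"
proof (induction p rule: poly_mapping_single_induct)
  case (3 m c)
  show ?case
    by (induction q rule: poly_mapping_single_induct)
       (auto simp: algebra_simps mpoly_eval_add mult_single mpoly_eval_single monom_eval_add)
qed (auto simp: algebra_simps mpoly_eval_add)

lemma mpoly_eval_Const [simp]: "mpoly_eval x (Const c) = c"
  by (simp add: Const_def mpoly_eval_single monom_eval_def)

lemma mpoly_eval_1 [simp]: "mpoly_eval x 1 = 1"
  using mpoly_eval_Const[of x 1] by (simp add: Const_def)

lemma mpoly_eval_Var [simp]: "mpoly_eval x (Var v) = x v"
  by (simp add: Var_def mpoly_eval_single monom_eval_def)

lemma mpoly_eval_diff: "mpoly_eval x (p - q) = mpoly_eval x p - mpoly_eval x q"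
  using mpoly_eval_add[of x "p - q" q] by (simp add: algebra_simps)

lemma mpoly_eval_sum: "mpoly_eval x (\<Sum>i\<in>S. p i) = (\<Sum>i\<in>S. mpoly_eval x (p i))"
  by (induction S rule: infinite_finite_induct) (auto simp: mpoly_eval_add)

lemma mpoly_eval_pder:
  "mpoly_eval x (pder w H zs) = pder (\<lambda>i. mpoly_eval x (w i)) (\<lambda>zs. mpoly_eval x (H zs)) zs"
  by (induction zs arbitrary: H) (auto simp: mpoly_eval_diff mpoly_eval_mult)

lemma mpoly_eval_pfaffian: "mpoly_eval x (pfaffian N ys) = pfaffian (\<lambda>i j. mpoly_eval x (N i j)) ys"
proof (induction ys rule: length_induct)
  case (1 ys)
  show ?case
  proof (cases ys)
    case (Cons y zs)
    then show ?thesis using 1 by (auto simp: pfaffian_Cons mpoly_eval_pder intro!: pder_cong)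
  qed simp
qed

lemma Const_0 [simp]: "Const 0 = 0" by (simp add: Const_def)
lemma Const_1 [simp]: "Const 1 = 1" by (simp add: Const_def)
lemma Const_add: "Const (a + b) = Const a + Const b" by (simp add: Const_def single_add)
lemma Const_mult: "Const (a * b) = Const a * Const b" by (simp add: Const_def mult_single)
lemma Const_uminus: "Const (- a) = - Const a" by (simp add: Const_def single_uminus)
lemma Const_power: "Const (a ^ n) = Const a ^ n" by (induction n) (auto simp: Const_mult)

interpretation mpv: vector_space "\<lambda>(c::'k::field) (p :: 'k mpoly). Const c * p"
  by unfold_locales (auto simp: algebra_simps Const_add Const_mult)

declare mpv.scale_scale [simp del]

text \<open>The letter \<open>(i, a, b)\<close> stands for \<open>a e_i + b f_i\<close> in two orthogonal copies of the index space.\<close>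
type_synonym 'k letter = "nat \<times> 'k \<times> 'k"

text \<open>\<open>v\<close> tensored with the standard symmetric form of the plane, hence invariant
  under the orthogonal group of the plane. Letters with the same index pair to zero, which makes the
  Pfaffian alternating in them.\<close>

definition letter_form :: "(nat \<Rightarrow> nat \<Rightarrow> 'k::field mpoly) \<Rightarrow> 'k letter \<Rightarrow> 'k letter \<Rightarrow> 'k mpoly" where
  "letter_form v x y = (if fst x < fst y
     then Const (fst (snd x) * fst (snd y) + snd (snd x) * snd (snd y)) * v (fst x) (fst y) else 0)"

lemma letter_form_lin:
  "pfaffian (letter_form v) (xs @ (i, s * a1 + t * a2, s * b1 + t * b2) # ys) =
     Const s * pfaffian (letter_form v) (xs @ (i, a1, b1) # ys)
     + Const t * pfaffian (letter_form v) (xs @ (i, a2, b2) # ys)"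
  by (rule pfaffian_lin_letter) (auto simp: letter_form_def Const_add Const_mult algebra_simps)

text \<open>In two adjacent letters of the same index the Pfaffian is bilinear and alternating,
  hence proportional to their determinant.\<close>

lemma letter_form_det:
  "pfaffian (letter_form v) (xs @ (i, a, b) # (i, a', b') # ys) =
     Const (a * b' - b * a') * pfaffian (letter_form v) (xs @ (i, 1, 0) # (i, 0, 1) # ys)"
proof -
  let ?P = "\<lambda>l1 l2. pfaffian (letter_form v) (xs @ (i, l1) # (i, l2) # ys)"
  have lin1: "?P (a, b) l = Const a * ?P (1, 0) l + Const b * ?P (0, 1) l" for a b l
    using letter_form_lin[of v xs i a 1 b 0 0 1 "(i, l) # ys"] by simp
  have lin2: "?P l (a, b) = Const a * ?P l (1, 0) + Const b * ?P l (0, 1)" for a b l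
    using letter_form_lin[of v "xs @ [(i, l)]" i a 1 b 0 0 1 ys] by simp
  have alt: "?P l l = 0" for l
    by (rule pfaffian_alternating) (simp add: letter_form_def)
  \<comment> \<open>Polarization: the alternating property at the sum of the two basis letters
    yields skewness.\<close>
  have "?P (1, 1) (1, 1) = (?P (1, 0) (1, 0) + ?P (1, 0) (0, 1)) + (?P (0, 1) (1, 0) + ?P (0, 1) (0, 1))"
    unfolding lin1[of 1 1] lin2[of _ 1 1] by (simp only: Const_1 mult_1 add_ac)
  then have "?P (1, 0) (0, 1) + ?P (0, 1) (1, 0) = 0"
    unfolding alt by (simp only: add_0 add_0_right)
  then have skew: "?P (0, 1) (1, 0) = - ?P (1, 0) (0, 1)" by (rule minus_unique[symmetric])
  have "?P (a, b) (a', b') = Const a * (Const b' * ?P (1, 0) (0, 1)) + Const b * (Const a' * ?P (0, 1) (1, 0))"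
    unfolding lin1[of a b] lin2[of _ a' b'] alt
    by (simp only: mult_zero_right add_0 mult_zero_left add_0_right add_ac mult_ac)
  moreover have "Const (a * b' - b * a') = Const a * Const b' - Const b * Const a'"
    using Const_add[of "a * b'" "- (b * a')"] by (simp add: Const_uminus Const_mult)
  ultimately show ?thesis unfolding skew
    by (simp only: distrib_right mult.assoc mult_minus_right mult_minus_left diff_conv_add_uminus)
qed

text \<open>An index of \<open>C\<close>, shared by both factors of a product, carries two letters;
  every other index carries one free letter.\<close>

definition letters :: "nat set \<Rightarrow> 'k \<times> 'k \<Rightarrow> 'k \<times> 'k \<Rightarrow> (nat \<Rightarrow> 'k \<times> 'k) \<Rightarrow> nat list \<Rightarrow> 'k letter list" where
  "letters C l1 l2 lam is = concat (map (\<lambda>i. if i \<in> C then [(i, l1), (i, l2)] else [(i, lam i)]) is)"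

lemma letters_simps [simp]:
  "letters C l1 l2 lam [] = []"
  "i \<in> C \<Longrightarrow> letters C l1 l2 lam (i # is) = (i, l1) # (i, l2) # letters C l1 l2 lam is"
  "i \<notin> C \<Longrightarrow> letters C l1 l2 lam (i # is) = (i, lam i) # letters C l1 l2 lam is"
  by (auto simp: letters_def)

lemma snd_letters: "x \<in> set (letters C l1 l2 lam is) \<Longrightarrow> snd x \<in> {l1, l2} \<union> range lam"
proof (induction "is")
  case (Cons i "is")
  then show ?case by (cases "i \<in> C") auto
qed simp

lemma letters_cong:
  "(\<And>i. i \<in> set is \<Longrightarrow> i \<notin> C \<Longrightarrow> lam i = lam' i) \<Longrightarrow> letters C l1 l2 lam is = letters C l1 l2 lam' is"
  unfolding letters_def by (intro arg_cong[where f = concat] map_cong) auto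

lemma pfaffian_letters_det:
  "pfaffian (letter_form v) (us @ letters C (a, b) (a', b') lam is) =
     Const (a * b' - b * a') ^ length (filter (\<lambda>i. i \<in> C) is)
     * pfaffian (letter_form v) (us @ letters C (1, 0) (0, 1) lam is)"
proof (induction "is" arbitrary: us)
  case (Cons i "is")
  show ?case
  proof (cases "i \<in> C")
    case True
    have "pfaffian (letter_form v) (us @ letters C (a, b) (a', b') lam (i # is)) =
      Const (a * b' - b * a') * pfaffian (letter_form v) ((us @ [(i, 1, 0), (i, 0, 1)]) @ letters C (a, b) (a', b') lam is)"
      using True letter_form_det[of v us i a b a' b'] by simp
    then show ?thesis using True unfolding Cons.IH by (simp add: algebra_simps)
  next
    case False
    then show ?thesis using Cons.IH[of "us @ [(i, lam i)]"] by simp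
  qed
qed simp

text \<open>The free letters are expanded one after another in the isotropic basis of the plane; the
  prefix \<open>us\<close> holds the letters already treated.\<close>

lemma pfaffian_letters_span:
  fixes \<iota> :: "'k::field"
  assumes "distinct is" "\<iota> \<noteq> 0" "(2::'k) \<noteq> 0"
  shows "pfaffian (letter_form v) (us @ letters C l1 l2 lam is) \<in>
    mpv.span {pfaffian (letter_form v) (us @ letters C l1 l2 lam' is) | lam'. \<forall>i. lam' i \<in> {(1, \<iota>), (1, - \<iota>)}}"
  using assms(1)
proof (induction "is" arbitrary: us)
  case Nil
  show ?case by (rule mpv.span_base) (auto intro!: exI[of _ "\<lambda>_. (1, \<iota>)"])
next
  case (Cons i "is")
  let ?P = "pfaffian (letter_form v)"
  let ?T = "\<lambda>us is. {?P (us @ letters C l1 l2 lam' is) | lam'. \<forall>i. lam' i \<in> {(1, \<iota>), (1, - \<iota>)}}"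
  show ?case
  proof (cases "i \<in> C")
    case True
    then show ?thesis using Cons.IH[of "us @ [(i, l1), (i, l2)]"] Cons.prems by simp
  next
    case False
    have sub: "?T (us @ [(i, m)]) is \<subseteq> ?T us (i # is)" if "m \<in> {(1, \<iota>), (1, - \<iota>)}" for m
    proof clarify
      fix lam' :: "nat \<Rightarrow> 'k \<times> 'k" assume l: "\<forall>i. lam' i \<in> {(1, \<iota>), (1, - \<iota>)}"
      have "letters C l1 l2 (lam'(i := m)) is = letters C l1 l2 lam' is"
        using Cons.prems by (intro letters_cong) auto
      then show "\<exists>lam''. ?P ((us @ [(i, m)]) @ letters C l1 l2 lam' is) = ?P (us @ letters C l1 l2 lam'' (i # is))
         \<and> (\<forall>i. lam'' i \<in> {(1, \<iota>), (1, - \<iota>)})"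
        using l that False by (intro exI[of _ "lam'(i := m)"]) auto
    qed
    have inS: "?P ((us @ [(i, m)]) @ letters C l1 l2 lam is) \<in> mpv.span (?T us (i # is))"
      if "m \<in> {(1, \<iota>), (1, - \<iota>)}" for m
      using Cons.IH[of "us @ [(i, m)]"] Cons.prems mpv.span_mono[OF sub[OF that]] by auto
    obtain a b where lam: "lam i = (a, b)" by (cases "lam i")
    \<comment> \<open>Coordinates of \<open>(a, b)\<close> in the basis \<open>(1, \<iota>)\<close>,
      \<open>(1, - \<iota>)\<close>.\<close>
    define s t where "s = (a + b / \<iota>) / 2" and "t = (a - b / \<iota>) / 2"
    have "s + t = (2 * a) / 2" "s - t = (2 * (b / \<iota>)) / 2"
      unfolding s_def t_def add_divide_distrib[symmetric] diff_divide_distrib[symmetric] by simp_all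
    then have "s + t = a" "(s - t) * \<iota> = b" using assms(2,3) by simp_all
    then have ab: "a = s * 1 + t * 1" "b = s * \<iota> + t * (- \<iota>)" by (auto simp: algebra_simps)
    have "?P (us @ letters C l1 l2 lam (i # is)) =
      Const s * ?P ((us @ [(i, 1, \<iota>)]) @ letters C l1 l2 lam is) + Const t * ?P ((us @ [(i, 1, - \<iota>)]) @ letters C l1 l2 lam is)"
      using letter_form_lin[of v us i s 1 t 1 \<iota> "- \<iota>" "letters C l1 l2 lam is", folded ab] False lam
      by simp
    then show ?thesis
      using mpv.span_add[OF mpv.span_scale[OF inS] mpv.span_scale[OF inS]] by auto
  qed
qed

definition pf :: "(nat \<Rightarrow> nat \<Rightarrow> 'k::comm_ring_1 mpoly) \<Rightarrow> nat set \<Rightarrow> 'k mpoly" where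
  "pf v S = pfaffian v (sorted_list_of_set S)"

lemma pfaffian_letter_const:
  assumes "sorted_wrt (<) ys" "fst l * fst l + snd l * snd l = 1"
  shows "pfaffian (letter_form v) (map (\<lambda>i. (i, l)) ys) = pfaffian v ys"
  unfolding pfaffian_map
proof (rule pfaffian_cong)
  fix us x vs y assume "ys = us @ x # vs" "y \<in> set vs"
  then have "x < y" using assms(1) by (auto simp: sorted_wrt_append)
  then show "letter_form v (x, l) (y, l) = v x y" using assms(2) by (simp add: letter_form_def)
qed

lemma filter_sorted_list_of_set:
  "finite A \<Longrightarrow> filter P (sorted_list_of_set A) = sorted_list_of_set {x \<in> A. P x}"
  by (rule sorted_distinct_set_unique) (auto intro: sorted_wrt_filter)

lemma shuffle_sgn_sq: "shuffle_sgn Q xs * shuffle_sgn Q xs = (1::'b::comm_ring_1)"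
proof -
  from shuffle_sgn_cases[of Q xs] have "shuffle_sgn Q xs \<in> {1, -1::'b}" by simp
  then show ?thesis by auto
qed

text \<open>The two coordinate directions of the plane are orthogonal, so the doubled word splits
  into the letters of one factor and those of the other. The sign is that of the unshuffle.\<close>

lemma pf_mult_letters:
  assumes "finite C" "finite D" "C \<inter> D = {}" "S \<subseteq> D"
  shows "\<exists>s\<in>{1, -1}. pf v (C \<union> S) * pf v (C \<union> (D - S)) =
    s * pfaffian (letter_form v) (letters C (1, 0) (0, 1) (\<lambda>i. if i \<in> S then (1, 0) else (0, 1)) (sorted_list_of_set (C \<union> D)))"
proof -
  let ?L = "letters C (1, 0) (0, 1) (\<lambda>i. if i \<in> S then (1, 0) else (0, 1::'a))"
  let ?is = "sorted_list_of_set (C \<union> D)"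
  let ?Q = "\<lambda>x::'a letter. snd x = (1, 0)"
  have snd_L: "snd x \<in> {(1, 0), (0, 1)}" if "x \<in> set (?L ?is)" for x
    using snd_letters[OF that] by auto
  have f1: "filter ?Q (?L js) = map (\<lambda>i. (i, 1, 0)) (filter (\<lambda>i. i \<in> C \<or> i \<in> S) js)" for js
  proof (induction js)
    case (Cons j js)
    then show ?case by (cases "j \<in> C"; cases "j \<in> S") simp_all
  qed simp
  have f2: "filter (\<lambda>x. \<not> ?Q x) (?L js) = map (\<lambda>i. (i, 0, 1)) (filter (\<lambda>i. i \<in> C \<or> i \<notin> S) js)" for js
  proof (induction js)
    case (Cons j js)
    then show ?case by (cases "j \<in> C"; cases "j \<in> S") simp_all
  qed simp
  have sp: "pfaffian (letter_form v) (?L ?is) = shuffle_sgn ?Q (?L ?is) * pfaffian (letter_form v) (filter ?Q (?L ?is))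
       * pfaffian (letter_form v) (filter (\<lambda>x. \<not> ?Q x) (?L ?is))"
  proof (rule pfaffian_split)
    fix x y assume "x \<in> set (?L ?is)" "y \<in> set (?L ?is)" "?Q x \<noteq> ?Q y"
    with snd_L[of x] snd_L[of y] show "letter_form v x y = 0" by (auto simp: letter_form_def)
  qed
  have s1: "filter (\<lambda>i. i \<in> C \<or> i \<in> S) ?is = sorted_list_of_set (C \<union> S)"
    using assms by (subst filter_sorted_list_of_set) (auto intro!: arg_cong[where f = sorted_list_of_set])
  have s2: "filter (\<lambda>i. i \<in> C \<or> i \<notin> S) ?is = sorted_list_of_set (C \<union> (D - S))"
    using assms by (subst filter_sorted_list_of_set) (auto intro!: arg_cong[where f = sorted_list_of_set])
  have "pfaffian (letter_form v) (?L ?is) = shuffle_sgn ?Q (?L ?is) * (pf v (C \<union> S) * pf v (C \<union> (D - S)))"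
    unfolding sp f1 f2 s1 s2 pf_def by (simp add: pfaffian_letter_const)
  moreover have "shuffle_sgn ?Q (?L ?is) \<in> {1, -1 :: 'a mpoly}" using shuffle_sgn_cases[of ?Q "?L ?is", where ?'r = "'a mpoly"] by simp
  ultimately show ?thesis
    by (intro bexI[of _ "shuffle_sgn ?Q (?L ?is)"]) (simp_all add: mult.assoc[symmetric] shuffle_sgn_sq)
qed

text \<open>In the isotropic letters \<open>e + \<iota> f\<close> and \<open>e - \<iota> f\<close> a Pfaffian vanishes unless both
  kinds occur equally often, and exchanging them only changes the sign. This bounds the dimension of
  the space of products of a given weight by the number of standard products.\<close>
lemma pf_products_span:
  fixes v :: "nat \<Rightarrow> nat \<Rightarrow> 'k::field mpoly" and \<iota> :: 'k
  assumes "\<iota> * \<iota> = -1" "(2::'k) \<noteq> 0" "finite C" "finite D" "C \<inter> D = {}" "D \<noteq> {}"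
  shows "\<exists>T. finite T \<and> card T \<le> (card D - 1) choose (card D div 2 - 1)
     \<and> (\<forall>S\<subseteq>D. pf v (C \<union> S) * pf v (C \<union> (D - S)) \<in> mpv.span T)"
proof -
  let ?P = "pfaffian (letter_form v)"
  let ?is = "sorted_list_of_set (C \<union> D)"
  have \<iota>0: "\<iota> \<noteq> 0" using assms(1) by auto
  have neq: "\<iota> \<noteq> - \<iota>"
  proof
    assume "\<iota> = - \<iota>"
    then have "2 * \<iota> = 0" by (simp only: mult_2 eq_neg_iff_add_eq_0)
    then show False using \<iota>0 assms(2) by simp
  qed
  define lam where "lam A i = (if i \<in> A then (1::'k, \<iota>) else (1, - \<iota>))" for A and i :: nat
  define Y where "Y A = ?P (letters C (1, \<iota>) (1, - \<iota>) (lam A) ?is)" for A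
  \<comment> \<open>\<open>Y A\<close> and \<open>Y (D - A)\<close> will agree up to sign, so of
    each balanced complementary pair only the set containing \<open>Min D\<close> is kept. The
    choice of its other elements gives the binomial coefficient.\<close>
  define W where "W = {A. A \<subseteq> D \<and> 2 * card A = card D \<and> Min D \<in> A}"
  have finW: "finite W" using assms(4) by (auto simp: W_def)
  have cardW: "card W \<le> (card D - 1) choose (card D div 2 - 1)"
  proof -
    have "card W \<le> card {B. B \<subseteq> D - {Min D} \<and> card B = card D div 2 - 1}"
    proof (rule card_inj_on_le)
      show "inj_on (\<lambda>A. A - {Min D}) W" by (rule inj_onI) (auto simp: W_def)
      show "(\<lambda>A. A - {Min D}) ` W \<subseteq> {B. B \<subseteq> D - {Min D} \<and> card B = card D div 2 - 1}"
        using assms(4) finite_subset by (auto simp: W_def)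
    qed (use assms(4) in auto)
    also have "\<dots> = (card D - 1) choose (card D div 2 - 1)"
      using assms(4,6) by (subst n_subsets) auto
    finally show ?thesis .
  qed
  \<comment> \<open>Isotropic letters of the same type pair to zero, so both types must occur
    equally often. An index of \<open>C\<close> contributes one of each, so the balance is decided
    in \<open>D\<close>.\<close>
  have Y0: "Y A = 0" if A: "A \<subseteq> D" "2 * card A \<noteq> card D" for A
    unfolding Y_def
  proof (rule pfaffian_unbalanced[where Q = "\<lambda>x. snd x = (1, \<iota>)"])
    fix x y assume "x \<in> set (letters C (1, \<iota>) (1, - \<iota>) (lam A) ?is)" "y \<in> set (letters C (1, \<iota>) (1, - \<iota>) (lam A) ?is)"
    from this[THEN snd_letters] have "snd x \<in> {(1, \<iota>), (1, - \<iota>)}" "snd y \<in> {(1, \<iota>), (1, - \<iota>)}"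
      by (auto simp: lam_def)
    moreover assume "(snd x = (1, \<iota>)) = (snd y = (1, \<iota>))"
    ultimately show "letter_form v x y = 0" using neq assms(1) by (auto simp: letter_form_def)
  next
    have len: "length (filter Q is) = card {i \<in> set is. Q i}" if "distinct is" for Q and "is" :: "nat list"
      using that by (metis distinct_card distinct_filter set_filter)
    have l1: "length (filter (\<lambda>x. snd x = (1, \<iota>)) (letters C (1, \<iota>) (1, - \<iota>) (lam A) is))
        = length (filter (\<lambda>i. i \<in> C \<or> i \<in> A) is)" for "is"
    proof (induction "is")
      case (Cons j js)
      then show ?case using neq by (cases "j \<in> C"; cases "j \<in> A") (simp_all add: lam_def)
    qed simp
    have l2: "length (filter (\<lambda>x. snd x \<noteq> (1, \<iota>)) (letters C (1, \<iota>) (1, - \<iota>) (lam A) is))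
        = length (filter (\<lambda>i. i \<in> C \<or> i \<notin> A) is)" for "is"
    proof (induction "is")
      case (Cons j js)
      then show ?case using neq by (cases "j \<in> C"; cases "j \<in> A") (simp_all add: lam_def)
    qed simp
    have e1: "{i \<in> set ?is. i \<in> C \<or> i \<in> A} = C \<union> A" and e2: "{i \<in> set ?is. i \<in> C \<or> i \<notin> A} = C \<union> (D - A)"
      using A assms(3-5) by auto
    have finA: "finite A" using A assms(4) finite_subset by blast
    have "card (C \<union> A) = card C + card A" "card (C \<union> (D - A)) = card C + (card D - card A)"
      using A finA assms(3-5) by (subst card_Un_disjoint; auto simp: card_Diff_subset)+
    moreover have "card A \<le> card D" using A assms(4) by (simp add: card_mono)
    ultimately show "length (filter (\<lambda>x. snd x = (1, \<iota>)) (letters C (1, \<iota>) (1, - \<iota>) (lam A) ?is))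
      \<noteq> length (filter (\<lambda>x. snd x \<noteq> (1, \<iota>)) (letters C (1, \<iota>) (1, - \<iota>) (lam A) ?is))"
      unfolding l1 l2 using A(2) by (simp add: len e1 e2)
  qed
  let ?c = "length (filter (\<lambda>i. i \<in> C) ?is)"
  have Ydet: "Y A = Const (- 2 * \<iota>) ^ ?c * ?P (letters C (1, 0) (0, 1) (lam A) ?is)" for A
    using pfaffian_letters_det[of v "[]" C 1 \<iota> 1 "- \<iota>" "lam A" ?is] by (simp add: Y_def)
  have Ycompl: "Y (D - A) = (- 1) ^ ?c * Y A" if "A \<subseteq> D" for A
  proof -
    \<comment> \<open>A reflection of the plane: it preserves the form and exchanges the isotropic
      letters. At each index of \<open>C\<close> the two letters appear in reverse order, whence the
      power of -1.\<close>
    define sw where "sw = (\<lambda>(i::nat, a::'k, b::'k). (i, a, - b))"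
    have "?P (map sw xs) = ?P xs" for xs
      unfolding pfaffian_map by (rule arg_cong[where f = "\<lambda>N. pfaffian N xs"]) (auto simp: letter_form_def sw_def fun_eq_iff)
    then have "Y A = ?P (map sw (letters C (1, \<iota>) (1, - \<iota>) (lam A) ?is))" by (simp add: Y_def)
    also have "map sw (letters C (1, \<iota>) (1, - \<iota>) (lam A) ?is) = letters C (1, - \<iota>) (1, \<iota>) (snd \<circ> sw \<circ> (\<lambda>i. (i, lam A i))) ?is"
      by (auto simp: letters_def map_concat sw_def case_prod_unfold intro!: arg_cong[where f = concat])
    also have "\<dots> = letters C (1, - \<iota>) (1, \<iota>) (lam (D - A)) ?is"
      using assms(3,4) by (intro letters_cong) (auto simp: lam_def sw_def)
    finally have "Y A = Const (2 * \<iota>) ^ ?c * ?P (letters C (1, 0) (0, 1) (lam (D - A)) ?is)"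
      using pfaffian_letters_det[of v "[]" C 1 "- \<iota>" 1 \<iota> "lam (D - A)" ?is] by simp
    then show ?thesis unfolding Ydet[of "D - A"]
      by (simp add: Const_uminus flip: mult.assoc power_mult_distrib)
  qed
  have YW: "Y A \<in> mpv.span (Y ` W)" if A: "A \<subseteq> D" for A
  proof (cases "2 * card A = card D")
    case False
    then show ?thesis using Y0[OF A] mpv.span_zero by simp
  next
    case True
    have finA: "finite A" using A assms(4) finite_subset by blast
    show ?thesis
    proof (cases "Min D \<in> A")
      case True
      then show ?thesis using A \<open>2 * card A = card D\<close> by (auto intro!: mpv.span_base simp: W_def)
    next
      case False
      have "2 * card (D - A) = card D"
        using A finA True by (simp add: card_Diff_subset)
      then have "D - A \<in> W" using False assms(4,6) by (auto simp: W_def)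
      then have "Y (D - A) \<in> mpv.span (Y ` W)" by (auto intro: mpv.span_base)
      then have "Const ((- 1) ^ ?c) * Y (D - A) \<in> mpv.span (Y ` W)" by (rule mpv.span_scale)
      moreover have "Const ((- 1) ^ ?c) * Y (D - A) = Y A"
        unfolding Ycompl[OF A] by (simp add: Const_power Const_uminus flip: mult.assoc power_add)
      ultimately show ?thesis by simp
    qed
  qed
  have span: "pf v (C \<union> S) * pf v (C \<union> (D - S)) \<in> mpv.span (Y ` W)" if S: "S \<subseteq> D" for S
  proof -
    define l where "l = (\<lambda>i. if i \<in> S then (1::'k, 0::'k) else (0, 1))"
    obtain s where s: "s \<in> {1, -1}" "pf v (C \<union> S) * pf v (C \<union> (D - S)) = s * ?P (letters C (1, 0) (0, 1) l ?is)"
      using pf_mult_letters[OF assms(3-5) S, of v] unfolding l_def by blast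
    have "{?P ([] @ letters C (1, \<iota>) (1, - \<iota>) lam' ?is) | lam'. \<forall>i. lam' i \<in> {(1, \<iota>), (1, - \<iota>)}} \<subseteq> mpv.span (Y ` W)"
    proof clarify
      fix lam' :: "nat \<Rightarrow> 'k \<times> 'k" assume l': "\<forall>i. lam' i \<in> {(1, \<iota>), (1, - \<iota>)}"
      have "letters C (1, \<iota>) (1, - \<iota>) lam' ?is = letters C (1, \<iota>) (1, - \<iota>) (lam {i \<in> D. lam' i = (1, \<iota>)}) ?is"
        using l' assms(3,4) by (intro letters_cong) (auto simp: lam_def)
      then have "?P ([] @ letters C (1, \<iota>) (1, - \<iota>) lam' ?is) = Y {i \<in> D. lam' i = (1, \<iota>)}"
        by (simp add: Y_def)
      then show "?P ([] @ letters C (1, \<iota>) (1, - \<iota>) lam' ?is) \<in> mpv.span (Y ` W)"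
        using YW[of "{i \<in> D. lam' i = (1, \<iota>)}"] by auto
    qed
    then have "mpv.span {?P ([] @ letters C (1, \<iota>) (1, - \<iota>) lam' ?is) | lam'. \<forall>i. lam' i \<in> {(1, \<iota>), (1, - \<iota>)}} \<subseteq> mpv.span (Y ` W)"
      by (rule mpv.span_minimal) (rule mpv.subspace_span)
    then have "?P ([] @ letters C (1, \<iota>) (1, - \<iota>) l ?is) \<in> mpv.span (Y ` W)"
      using pfaffian_letters_span[of ?is \<iota> v "[]" C "(1, \<iota>)" "(1, - \<iota>)" l] \<iota>0 assms(2) by auto
    then have "Const (- 2 * \<iota>) ^ ?c * ?P (letters C (1, 0) (0, 1) l ?is) \<in> mpv.span (Y ` W)"
      using pfaffian_letters_det[of v "[]" C 1 \<iota> 1 "- \<iota>" l ?is] by simp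
    \<comment> \<open>The determinant \<open>- 2 * \<iota>\<close> of the change of basis is
      invertible and is divided out once for each index of \<open>C\<close>.\<close>
    then have "Const (inverse (- 2 * \<iota>) ^ ?c) * (Const (- 2 * \<iota>) ^ ?c * ?P (letters C (1, 0) (0, 1) l ?is)) \<in> mpv.span (Y ` W)"
      by (rule mpv.span_scale)
    moreover have "Const (inverse (- 2 * \<iota>) ^ ?c) * Const (- 2 * \<iota>) ^ ?c = 1"
    proof -
      have "inverse (- 2 * \<iota>) * (- 2 * \<iota>) = 1" using \<iota>0 assms(2) by (intro left_inverse) simp
      then show ?thesis
        by (simp only: Const_power[symmetric] Const_mult[symmetric] power_mult_distrib[symmetric] power_one Const_1)
    qed
    ultimately have "?P (letters C (1, 0) (0, 1) l ?is) \<in> mpv.span (Y ` W)" by (simp flip: mult.assoc)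
    then show ?thesis using s mpv.span_neg by auto
  qed
  show ?thesis
  proof (intro exI[of _ "Y ` W"] conjI allI impI)
    show "finite (Y ` W)" using finW by simp
    show "card (Y ` W) \<le> (card D - 1) choose (card D div 2 - 1)"
      using card_image_le[OF finW, of Y] cardW by linarith
  qed (rule span)
qed

section \<open>Linear independence on cells\<close>

lemma not_sorted_wrtD:
  "\<not> sorted_wrt P xs \<Longrightarrow> \<exists>us x vs y ws. xs = us @ x # vs @ y # ws \<and> \<not> P x y"
proof (induction xs)
  case (Cons x xs)
  show ?case
  proof (cases "sorted_wrt P xs")
    case True
    then obtain y where "y \<in> set xs" "\<not> P x y" using Cons.prems by auto
    moreover from this obtain vs ws where "xs = vs @ y # ws" by (meson split_list)
    ultimately show ?thesis
      by (intro exI[of _ "[]"] exI[of _ x] exI[of _ vs] exI[of _ y] exI[of _ ws]) simp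
  next
    case False
    then obtain us z vs y ws where "xs = us @ z # vs @ y # ws" "\<not> P z y" using Cons.IH by blast
    then show ?thesis
      by (intro exI[of _ "x # us"] exI[of _ z] exI[of _ vs] exI[of _ y] exI[of _ ws]) simp
  qed
qed simp

text \<open>\<open>E\<close> is the complement of the base point and \<open>r\<close> labels an
  element by its part in \<open>E\<close>. In \<open>cover\<close>, a pair of generators leads one
  step upwards from x; the last clause ensures that it sends spinors supported below x to spinors
  supported below z. Pairs with equal intersection and union of labels have equal torus weight.
  \<open>weight_le\<close> and \<open>weight_ht\<close> say how the order and the height depend on
  that weight, and \<open>pair_count\<close> matches the bound of
  \<open>pf_products_span\<close>.\<close>

locale pfaffian_poset =
  fixes d :: nat and E :: "nat set" and X :: "'i set" and r :: "'i \<Rightarrow> nat set"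
    and le :: "'i \<Rightarrow> 'i \<Rightarrow> bool" and ht :: "'i \<Rightarrow> nat"
  assumes E_subset: "E \<subseteq> {1..2 * d}"
    and r_bij: "bij_betw r X {S. S \<subseteq> E \<and> even (card S)}"
    and le_refl: "x \<in> X \<Longrightarrow> le x x"
    and le_trans: "x \<in> X \<Longrightarrow> y \<in> X \<Longrightarrow> z \<in> X \<Longrightarrow> le x y \<Longrightarrow> le y z \<Longrightarrow> le x z"
    and le_antisym: "x \<in> X \<Longrightarrow> y \<in> X \<Longrightarrow> le x y \<Longrightarrow> le y x \<Longrightarrow> x = y"
    and ht_mono: "x \<in> X \<Longrightarrow> y \<in> X \<Longrightarrow> le x y \<Longrightarrow> x \<noteq> y \<Longrightarrow> ht x < ht y"
    and cover: "x \<in> X \<Longrightarrow> y \<in> X \<Longrightarrow> le x y \<Longrightarrow> x \<noteq> y \<Longrightarrow>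
      \<exists>a b z. a \<in> E \<and> b \<in> E \<and> a \<noteq> b \<and> z \<in> X \<and> z \<noteq> x \<and> le x z \<and> le z y
        \<and> r x = toggle b (toggle a (r z))
        \<and> (\<forall>t\<in>X. \<forall>t'\<in>X. r t' = toggle b (toggle a (r t)) \<longrightarrow> (a \<in> r t) = (a \<in> r z)
             \<longrightarrow> (b \<in> r t) = (b \<in> r z) \<longrightarrow> le t' x \<longrightarrow> le t z)"
    and weight_le: "x \<in> X \<Longrightarrow> y \<in> X \<Longrightarrow> m \<in> X \<Longrightarrow> n \<in> X \<Longrightarrow> r m \<inter> r n = r x \<inter> r y \<Longrightarrow>
      r m \<union> r n = r x \<union> r y \<Longrightarrow> le x n \<Longrightarrow> le y n \<Longrightarrow> le m x \<and> le m y"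
    and weight_ht: "x \<in> X \<Longrightarrow> y \<in> X \<Longrightarrow> m \<in> X \<Longrightarrow> n \<in> X \<Longrightarrow> r m \<inter> r n = r x \<inter> r y \<Longrightarrow>
      r m \<union> r n = r x \<union> r y \<Longrightarrow> ht m + ht n = ht x + ht y"
    and pair_count: "x \<in> X \<Longrightarrow> y \<in> X \<Longrightarrow> x \<noteq> y \<Longrightarrow>
      (card (sym_diff (r x) (r y)) - 1) choose (card (sym_diff (r x) (r y)) div 2 - 1)
      \<le> card {(m, n). m \<in> X \<and> n \<in> X \<and> le m n \<and> r m \<inter> r n = r x \<inter> r y \<and> r m \<union> r n = r x \<union> r y}"
begin

lemma finite_E: "finite E"
  using E_subset finite_subset by blast

lemma r_subset: "x \<in> X \<Longrightarrow> r x \<subseteq> E" and r_even: "x \<in> X \<Longrightarrow> even (card (r x))"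
  using r_bij by (auto simp: bij_betw_def)

lemma finite_r: "x \<in> X \<Longrightarrow> finite (r x)"
  using r_subset finite_E finite_subset by blast

lemma r_inj: "x \<in> X \<Longrightarrow> y \<in> X \<Longrightarrow> r x = r y \<Longrightarrow> x = y"
  using r_bij by (auto simp: bij_betw_def inj_on_def)

lemma r_surj: "S \<subseteq> E \<Longrightarrow> even (card S) \<Longrightarrow> \<exists>x\<in>X. r x = S"
proof -
  assume "S \<subseteq> E" "even (card S)"
  then have "S \<in> r ` X" using r_bij by (simp add: bij_betw_def)
  then show ?thesis by blast
qed

lemma finite_X: "finite X"
proof -
  have "finite {S. S \<subseteq> E \<and> even (card S)}" using finite_E by simp
  then show ?thesis using r_bij bij_betw_finite by blast
qed

text \<open>The spinors with \<open>g\<close> as largest nonzero coordinate, that is, the cone over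
  a Schubert cell; on it \<open>p (r g)\<close> can be cancelled.\<close>

definition cell :: "'i \<Rightarrow> (nat set \<Rightarrow> 'k::field) \<Rightarrow> bool" where
  "cell g p \<longleftrightarrow> pure_spinor E p \<and> p (r g) \<noteq> 0 \<and> (\<forall>t\<in>X. \<not> le t g \<longrightarrow> p (r t) = 0)"

lemma cell_nonempty:
  assumes "g \<in> X" shows "cell g (\<lambda>A. if A = r g then 1 else 0)"
  using assms r_inj le_refl by (auto simp: cell_def pure_spinor_delta)

text \<open>With z the next step from h towards g, the spinor \<open>p + t * F p\<close> lies in the
  cell of z for every nonzero \<open>t\<close> and is \<open>p\<close> at \<open>t = 0\<close>.
  Vanishing thus passes from the cell of z, which is closer to g, to that of h.\<close>

lemma cell_descend:
  fixes c :: "'i list \<Rightarrow> 'k::field"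
  assumes inf: "infinite (UNIV :: 'k set)" and g: "g \<in> X"
    and van: "\<And>p. cell g p \<Longrightarrow> chain_form c S (p \<circ> r) = 0"
    and "h \<in> X" "le h g" "cell h p"
  shows "chain_form c S (p \<circ> r) = 0"
  using assms(4-)
proof (induction "ht g - ht h" arbitrary: h p rule: less_induct)
  case less
  show ?case
  proof (cases "h = g")
    case True
    then show ?thesis using van less.prems by simp
  next
    case False
    obtain a b z where ab: "a \<in> E" "b \<in> E" "a \<noteq> b" and z: "z \<in> X" "z \<noteq> h" "le h z" "le z g"
      and rz: "r h = toggle b (toggle a (r z))"
      and lift: "\<And>t t'. t \<in> X \<Longrightarrow> t' \<in> X \<Longrightarrow> r t' = toggle b (toggle a (r t)) \<Longrightarrow> (a \<in> r t) = (a \<in> r z) \<Longrightarrow>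
           (b \<in> r t) = (b \<in> r z) \<Longrightarrow> le t' h \<Longrightarrow> le t z"
      using cover[OF less.prems(1) g less.prems(2) False] by blast
    \<comment> \<open>This choice of generators carries the coordinate at h to the coordinate at z,
      where \<open>p\<close> itself vanishes.\<close>
    define s s' where "s \<longleftrightarrow> a \<in> r z" and "s' \<longleftrightarrow> b \<in> r z"
    let ?q = "cliff a s (cliff b s' p)"
    have p: "pure_spinor E p" "p (r h) \<noteq> 0" "\<And>t. t \<in> X \<Longrightarrow> \<not> le t h \<Longrightarrow> p (r t) = 0"
      using less.prems(3) by (auto simp: cell_def)
    have "cell z (\<lambda>A. p A + t * ?q A)" if t: "t \<noteq> 0" for t
      unfolding cell_def
    proof (intro conjI ballI impI)
      show "pure_spinor E (\<lambda>A. p A + t * ?q A)"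
        using ab p finite_E by (intro pure_spinor_cliff2) auto
      have "\<not> le z h" using z le_antisym less.prems(1) by blast
      then have "p (r z) = 0" using p z by blast
      moreover have "cliff2_coeff a s b s' (r z) \<noteq> (0::'k)"
        using cliff2_coeff_unit[of a "r z" s b s', where ?'k = 'k] by (auto simp: s_def s'_def)
      ultimately show "p (r z) + t * ?q (r z) \<noteq> 0"
        using cliff2_eq[OF ab(3), of s s' p "r z"] p t by (simp flip: rz)
    next
      fix y assume y: "y \<in> X" "\<not> le y z"
      then have "\<not> le y h" using le_trans less.prems(1) z by blast
      then have "p (r y) = 0" using p y by blast
      moreover have "?q (r y) = 0"
      proof (cases "(a \<in> r y) = s \<and> (b \<in> r y) = s'")
        case False
        then show ?thesis using cliff2_eq[OF ab(3), of s s' p "r y"] by (auto simp: cliff2_coeff_def)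
      next
        case True
        let ?R = "toggle b (toggle a (r y))"
        have "?R \<subseteq> E" using r_subset[OF y(1)] ab by (auto simp: mem_toggle split: if_splits)
        moreover have "even (card ?R)"
        proof -
          have tog: "even (card (toggle x A)) = odd (card A)" if "finite A" for x A
            using that by (auto simp: toggle_def card_gt_0_iff)
          have "finite (toggle a (r y))" using finite_r[OF y(1)] by (simp add: toggle_def)
          then show ?thesis using tog[of _ b] tog[of _ a] finite_r[OF y(1)] r_even[OF y(1)] by auto
        qed
        ultimately obtain y' where y': "y' \<in> X" "r y' = ?R" using r_surj by blast
        \<comment> \<open>If \<open>y'\<close> were below \<open>h\<close>, the lifting clause of
          \<open>cover\<close> would put \<open>y\<close> below \<open>z\<close>.\<close>
        have "\<not> le y' h" using lift[of y y'] y y' True by (auto simp: s_def s'_def)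
        then have "p ?R = 0" using p y' by metis
        then show ?thesis using cliff2_eq[OF ab(3), of s s' p "r y"] by simp
      qed
      ultimately show "p (r y) + t * ?q (r y) = 0" by simp
    qed
    moreover have "ht g - ht z < ht g - ht h"
      using ht_mono[of h z] ht_mono[of z g] z less.prems(1) g
      by (cases "z = g") (auto intro: diff_less_mono2)
    ultimately have "chain_form c S ((\<lambda>A. p A + t * ?q A) \<circ> r) = 0" if "t \<notin> {0}" for t
      using less.hyps[of z] z that by simp
    then have "chain_form c S (\<lambda>i. p (r i) + t * ?q (r i)) = 0" if "t \<notin> {0}" for t
      using that by (simp add: o_def)
    then have "chain_form c S (\<lambda>i. p (r i)) = 0"
      by (rule chain_form_curve[OF inf finite.insertI[OF finite.emptyI]])
    then show ?thesis by (simp add: o_def)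
  qed
qed

definition chain :: "'i list \<Rightarrow> bool" where
  "chain L \<longleftrightarrow> set L \<subseteq> X \<and> sorted_wrt le L"

lemma chain_le_last:
  assumes "chain L" "x \<in> set L" shows "le x (last L)"
proof -
  have "L \<noteq> []" using assms by auto
  then obtain L' y where L: "L = L' @ [y]" by (metis rev_exhaust)
  then show ?thesis using assms le_refl by (auto simp: chain_def sorted_wrt_append)
qed

lemma chain_hd_le:
  assumes "chain L" "x \<in> set L" shows "le (hd L) x"
  using assms le_refl by (cases L) (auto simp: chain_def)

text \<open>On the cell of \<open>g\<close> only chains below \<open>g\<close> contribute. Those
  with a smaller top are settled on the cell of that top, to which the relation descends. All others
  end in \<open>g\<close>; cancelling the nonzero factor \<open>p (r g)\<close> leaves a relation
  between chains shorter by one.\<close>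

lemma cell_independent:
  fixes c :: "'i list \<Rightarrow> 'k::field"
  assumes inf: "infinite (UNIV :: 'k set)"
  shows "finite S \<Longrightarrow> (\<And>L. L \<in> S \<Longrightarrow> chain L \<and> length L = n) \<Longrightarrow> g \<in> X \<Longrightarrow>
    (\<And>p. cell g p \<Longrightarrow> chain_form c S (p \<circ> r) = 0) \<Longrightarrow>
    L \<in> S \<Longrightarrow> (\<And>x. x \<in> set L \<Longrightarrow> le x g) \<Longrightarrow> c L = 0"
proof (induction n arbitrary: S c g L)
  case 0
  have "S = {[]}" using 0(2,5) by auto
  moreover have "L = []" using 0(2,5) by auto
  ultimately show ?case using 0(4)[OF cell_nonempty[OF 0(3)]] by (simp add: chain_form_def)
next
  case (Suc n)
  have small: "c L = 0" if "g \<in> X" "\<And>p. cell g p \<Longrightarrow> chain_form c S (p \<circ> r) = 0"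
      "L \<in> S" "\<And>x. x \<in> set L \<Longrightarrow> le x g" for L g
    using that
  proof (induction "ht g" arbitrary: g L rule: less_induct)
    case less
    have van: "c M = 0" if M: "M \<in> S" "\<And>x. x \<in> set M \<Longrightarrow> le x g" "last M \<noteq> g" for M
    proof -
      have ch: "chain M" "M \<noteq> []" using Suc.prems(2)[OF M(1)] by auto
      then have h: "last M \<in> X" "le (last M) g" using M(2) by (auto simp: chain_def)
      have "ht (last M) < ht g" using ht_mono[OF h(1) less.prems(1) h(2) M(3)] .
      then show ?thesis
      proof (rule less.hyps[OF _ h(1) _ M(1)])
        show "chain_form c S (p \<circ> r) = 0" if "cell (last M) p" for p
          using cell_descend[OF inf less.prems(1) less.prems(2) h that] .
        show "le x (last M)" if "x \<in> set M" for x using chain_le_last[OF ch(1) that] .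
      qed
    qed
    show ?case
    proof (cases "last L = g")
      case False
      then show ?thesis using van less.prems by blast
    next
      case True
      define S1 where "S1 = {M \<in> S. last M = g}"
      define c' where "c' M = c (M @ [g])" for M
      have ne: "M \<noteq> []" if "M \<in> S" for M using Suc.prems(2)[OF that] by auto
      have bl: "M = butlast M @ [g]" if "M \<in> S1" for M
        using that ne[of M] by (auto simp: S1_def)
      have fin: "finite S1" using Suc.prems(1) by (simp add: S1_def)
      have "chain_form c' (butlast ` S1) (p \<circ> r) = 0" if p: "cell g p" for p
      proof -
        have zero: "c M * prod_list (map (p \<circ> r) M) = 0" if "M \<in> S - S1" for M
        proof (cases "\<forall>x\<in>set M. le x g")
          case True
          then show ?thesis using van[of M] that by (auto simp: S1_def)
        next
          case False
          then obtain x where "x \<in> set M" "\<not> le x g" by blast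
          moreover from this have "x \<in> X" using that Suc.prems(2)[of M] by (auto simp: chain_def)
          ultimately have "p (r x) = 0" "x \<in> set M" using p by (auto simp: cell_def)
          then have "prod_list (map (p \<circ> r) M) = 0" by (force simp: prod_list_zero_iff)
          then show ?thesis by simp
        qed
        have "0 = chain_form c S (p \<circ> r)" using less.prems(2)[OF p] by simp
        also have "\<dots> = (\<Sum>M\<in>S1. c M * prod_list (map (p \<circ> r) M))"
          unfolding chain_form_def using Suc.prems(1) zero
          by (intro sum.mono_neutral_right) (auto simp: S1_def)
        also have "\<dots> = (\<Sum>M\<in>S1. c' (butlast M) * prod_list (map (p \<circ> r) (butlast M)) * p (r g))"
        proof (intro sum.cong refl)
          fix M assume "M \<in> S1"
          from bl[OF this] obtain M' where M': "M = M' @ [g]" by blast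
          show "c M * prod_list (map (p \<circ> r) M) = c' (butlast M) * prod_list (map (p \<circ> r) (butlast M)) * p (r g)"
            unfolding M' c'_def by simp
        qed
        also have "\<dots> = chain_form c' (butlast ` S1) (p \<circ> r) * p (r g)"
        proof -
          have "inj_on butlast S1" by (rule inj_onI) (metis bl)
          then show ?thesis unfolding chain_form_def
            by (simp add: sum.reindex sum_distrib_right)
        qed
        finally show ?thesis using p by (simp add: cell_def)
      qed
      moreover have "chain M \<and> length M = n" if "M \<in> butlast ` S1" for M
      proof -
        from that obtain M' where "M' \<in> S1" "M = butlast M'" by blast
        then have "M @ [g] \<in> S" using bl[of M'] by (auto simp: S1_def)
        then show ?thesis using Suc.prems(2)[of "M @ [g]"] by (auto simp: chain_def sorted_wrt_append)
      qed
      moreover have "butlast L \<in> butlast ` S1" using less.prems True by (auto simp: S1_def)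
      moreover have "le x g" if "x \<in> set (butlast L)" for x
        using that less.prems(4) in_set_butlastD by metis
      ultimately have "c' (butlast L) = 0"
        using Suc.IH[of "butlast ` S1" g c' "butlast L"] fin less.prems(1) by blast
      moreover have "L = butlast L @ [g]" using bl[of L] less.prems True by (auto simp: S1_def)
      ultimately show ?thesis by (simp add: c'_def)
    qed
  qed
  show ?case using small Suc.prems by blast
qed

end

section \<open>Straightening\<close>

context pfaffian_poset
begin

definition pff :: "'i \<Rightarrow> 'k::comm_ring_1 mpoly" where
  "pff x = pf (\<lambda>i j. Var (i, star d j)) (r x)"

definition pmon :: "'i list \<Rightarrow> 'k::comm_ring_1 mpoly" where
  "pmon L = prod_list (map pff L)"

lemma pmon_simps [simp]: "pmon [] = 1" "pmon (x # L) = pff x * pmon L" "pmon (L @ M) = pmon L * pmon M"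
  by (simp_all add: pmon_def)

text \<open>In the chart a pure spinor is \<open>p {}\<close> times the vector of its Pfaffians. All
  words have the same length \<open>n\<close>, so evaluating the relation gives the form up to the
  common factor \<open>p {} ^ n\<close>; density extends the vanishing to the cells.\<close>

lemma chain_form_eq_0:
  fixes c :: "'i list \<Rightarrow> 'k::field"
  assumes inf: "infinite (UNIV :: 'k set)"
    and S: "\<And>L. L \<in> S \<Longrightarrow> set L \<subseteq> X \<and> length L = n"
    and rel: "(\<Sum>L\<in>S. Const (c L) * pmon L) = 0"
    and g: "g \<in> X" "cell g p"
  shows "chain_form c S (p \<circ> r) = 0"
proof (rule pure_spinor_dense[OF inf finite_E _ r_subset[OF g(1)] r_even[OF g(1)]])
  show "pure_spinor E p" "p (r g) \<noteq> 0" using g by (auto simp: cell_def)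
next
  fix p :: "nat set \<Rightarrow> 'k" assume p: "pure_spinor E p" "p {} \<noteq> 0"
  define q where "q A = inverse (p {}) * p A" for A
  have q: "pure_spinor E q" "q {} = 1"
    using pure_spinor_scale[OF p(1), of "inverse (p {})"] p(2) by (simp_all add: q_def[abs_def])
  \<comment> \<open>Columns of the patch are named by elements of the base point, and Pfaffians read
    them through \<open>star d\<close>; the second star undoes the first.\<close>
  define z where "z = (\<lambda>(i, j). q {i, star d j})"
  have ev: "mpoly_eval z (pff x) = q (r x)" if "x \<in> X" for x
  proof -
    have "mpoly_eval z (pff x) = pfaffian (\<lambda>i j. q {i, star d (star d j)}) (sorted_list_of_set (r x))"
      by (simp add: pff_def pf_def mpoly_eval_pfaffian z_def)
    also have "\<dots> = pfaffian (\<lambda>i j. q {i, j}) (sorted_list_of_set (r x))"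
    proof (rule pfaffian_cong)
      fix us i vs j assume l: "sorted_list_of_set (r x) = us @ i # vs" "j \<in> set vs"
      have "j \<in> set (sorted_list_of_set (r x))" unfolding l(1) using l(2) by simp
      then have "j \<in> {1..2 * d}" using finite_r[OF that] r_subset[OF that] E_subset by auto
      then show "q {i, star d (star d j)} = q {i, j}" by (simp add: star_def)
    qed
    also have "\<dots> = q (r x)"
      using pure_spinor_pfaffian[OF finite_E q r_subset[OF that]] by simp
    finally show ?thesis .
  qed
  have evm: "p {} ^ n * mpoly_eval z (pmon L) = prod_list (map (p \<circ> r) L)" if "L \<in> S" for L
  proof -
    have pq: "p A = p {} * q A" for A using p(2) by (simp add: q_def)
    have "p {} ^ length M * mpoly_eval z (pmon M) = prod_list (map (p \<circ> r) M)" if "set M \<subseteq> X" for M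
      using that
    proof (induction M)
      case (Cons x M)
      have IH: "p {} ^ length M * mpoly_eval z (pmon M) = prod_list (map (p \<circ> r) M)"
        using Cons.prems by (intro Cons.IH) simp
      have "p {} ^ length (x # M) * mpoly_eval z (pmon (x # M)) = (p {} * q (r x)) * (p {} ^ length M * mpoly_eval z (pmon M))"
        using Cons.prems ev[of x] by (simp add: mpoly_eval_mult algebra_simps)
      then show ?case unfolding IH pq[of "r x", symmetric] by (simp add: o_def)
    qed simp
    then show ?thesis using S[OF that] by blast
  qed
  have "0 = p {} ^ n * mpoly_eval z (\<Sum>L\<in>S. Const (c L) * pmon L)" using rel by simp
  also have "\<dots> = (\<Sum>L\<in>S. c L * (p {} ^ n * mpoly_eval z (pmon L)))"
    by (simp add: mpoly_eval_sum mpoly_eval_mult sum_distrib_left algebra_simps)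
  also have "\<dots> = chain_form c S (p \<circ> r)"
    unfolding chain_form_def using evm by (intro sum.cong) auto
  finally show "chain_form c S (p \<circ> r) = 0" by simp
qed

text \<open>Each coefficient is tested on the cell of the top of its own chain, where that chain
  lies below the top.\<close>

lemma chain_independent:
  fixes c :: "'i list \<Rightarrow> 'k::field"
  assumes inf: "infinite (UNIV :: 'k set)" and "finite S"
    and S: "\<And>L. L \<in> S \<Longrightarrow> chain L \<and> length L = n"
    and rel: "(\<Sum>L\<in>S. Const (c L) * pmon L) = 0"
    and L: "L \<in> S"
  shows "c L = 0"
proof (cases "L = []")
  case True
  then have "n = 0" using S[OF L] by simp
  then have "M = []" if "M \<in> S" for M using S[OF that] by simp
  then have "S = {[]}" using L by blast
  then have "Const (c []) = 0" using rel by simp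
  then have "mpoly_eval (\<lambda>_. 0) (Const (c [])) = mpoly_eval (\<lambda>_. 0) 0" by (rule arg_cong)
  then show ?thesis using True by simp
next
  case False
  then have g: "last L \<in> X" using S[OF L] by (auto simp: chain_def)
  show ?thesis
  proof (rule cell_independent[OF inf assms(2) S g _ L])
    show "chain_form c S (p \<circ> r) = 0" if "cell (last L) p" for p
      using S by (intro chain_form_eq_0[OF inf _ rel g that]) (auto simp: chain_def)
    show "le x (last L)" if "x \<in> set L" for x using chain_le_last S[OF L] that by blast
  qed
qed

lemma pair_straightening:
  assumes inf: "infinite (UNIV :: 'k::field set)" and two: "(2::'k) \<noteq> 0" and \<iota>: "\<iota> * \<iota> = (-1::'k)"
    and xy: "x \<in> X" "y \<in> X" "\<not> le x y"
  shows "(pff x * pff y :: 'k mpoly) \<in> mpv.span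
    {pff m * pff n | m n. m \<in> X \<and> n \<in> X \<and> le m x \<and> le m y \<and> le x n \<and> le y n
       \<and> r m \<inter> r n = r x \<inter> r y \<and> r m \<union> r n = r x \<union> r y}"
proof -
  define Q where "Q = {(m, n). m \<in> X \<and> n \<in> X \<and> le m n \<and> r m \<inter> r n = r x \<inter> r y \<and> r m \<union> r n = r x \<union> r y}"
  define G where "G = (\<lambda>(m, n). pff m * pff n :: 'k mpoly)"
  define li where "li = (\<lambda>(m, n). [m, n] :: 'i list)"
  have li_inj: "inj_on li A" for A by (auto simp: li_def inj_on_def)
  have li_pmon: "pmon (li q) = G q" for q by (simp add: li_def G_def split: prod.splits)
  have "Q \<subseteq> X \<times> X" by (auto simp: Q_def)
  then have finQ: "finite Q" using finite_X finite_subset by blast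
  have li_chain: "chain (li q) \<and> length (li q) = 2" if "q \<in> Q" for q
    using that by (auto simp: Q_def li_def chain_def)
  have ind: "u q = 0" if A: "A \<subseteq> Q" and rel: "(\<Sum>q\<in>A. Const (u q) * G q) = 0" and q: "q \<in> A" for A u q
  proof -
    have "(\<Sum>L\<in>li ` A. Const (u (the_inv_into A li L)) * pmon L) = 0"
      using rel by (simp add: sum.reindex[OF li_inj] the_inv_into_f_f[OF li_inj] li_pmon)
    then have "u (the_inv_into A li (li q)) = 0"
    proof (rule chain_independent[OF inf _ _ _, rotated 2])
      show "chain L \<and> length L = 2" if "L \<in> li ` A" for L using that li_chain A by blast
    qed (use finite_subset[OF A finQ] q in auto)
    then show ?thesis by (simp add: the_inv_into_f_f[OF li_inj q])
  qed
  have Ginj: "inj_on G Q"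
  proof (rule inj_onI, rule ccontr)
    fix q q' assume *: "q \<in> Q" "q' \<in> Q" "G q = G q'" "q \<noteq> q'"
    have "(\<Sum>k\<in>{q, q'}. Const (if k = q then 1 else -1) * G k) = 0"
      using * by (simp add: Const_uminus)
    from ind[OF _ this, of q] * show False by simp
  qed
  have Gind: "mpv.independent (G ` Q)"
  proof
    assume "mpv.dependent (G ` Q)"
    then obtain u where u: "\<exists>v\<in>G ` Q. u v \<noteq> 0" "(\<Sum>v\<in>G ` Q. Const (u v) * v) = 0"
      using mpv.dependent_finite[of "G ` Q"] finQ by auto
    then have "(\<Sum>q\<in>Q. Const (u (G q)) * G q) = 0" by (simp add: sum.reindex[OF Ginj])
    from ind[OF _ this] u(1) show False by blast
  qed
  \<comment> \<open>The weight of the pair: \<open>C\<close> lies in both labels and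
    \<open>D\<close> in exactly one. Every pair of this weight comes from a subset of
    \<open>D\<close>.\<close>
  define C where "C = r x \<inter> r y"
  define D where "D = sym_diff (r x) (r y)"
  have ne: "x \<noteq> y" using xy le_refl by auto
  then have D0: "D \<noteq> {}" using r_inj[OF xy(1,2)] by (auto simp: D_def)
  have fin: "finite C" "finite D" using finite_r xy by (auto simp: C_def D_def)
  obtain T :: "'k mpoly set" where T: "finite T" "card T \<le> (card D - 1) choose (card D div 2 - 1)"
    "\<And>S. S \<subseteq> D \<Longrightarrow> pf (\<lambda>i j. Var (i, star d j)) (C \<union> S) * pf (\<lambda>i j. Var (i, star d j)) (C \<union> (D - S)) \<in> mpv.span T"
    using pf_products_span[OF \<iota> two fin _ D0, of "\<lambda>i j. Var (i, star d j)"] by (auto simp: C_def D_def)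
  have inT: "pff m * pff n \<in> mpv.span T" if mn: "r m \<inter> r n = r x \<inter> r y" "r m \<union> r n = r x \<union> r y" for m n
  proof -
    have "r m - C \<subseteq> D" "C \<union> (r m - C) = r m" "C \<union> (D - (r m - C)) = r n"
      using mn by (auto simp: C_def D_def set_eq_iff)
    then show ?thesis using T(3)[of "r m - C"] by (simp add: pff_def)
  qed
  \<comment> \<open>Otherwise this product together with the standard pairs would be an independent
    family with more than \<open>card T\<close> members inside the span of \<open>T\<close>.\<close>
  have "pff x * pff y \<in> mpv.span (G ` Q)"
  proof (rule ccontr)
    assume no: "pff x * pff y \<notin> mpv.span (G ` Q)"
    then have "mpv.independent (insert (pff x * pff y) (G ` Q))"
      using Gind by (simp add: mpv.independent_insert)
    moreover have "insert (pff x * pff y) (G ` Q) \<subseteq> mpv.span T"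
      using inT by (auto simp: G_def Q_def)
    ultimately have "card (insert (pff x * pff y) (G ` Q)) \<le> card T"
      using mpv.independent_span_bound[OF T(1)] by blast
    moreover have "pff x * pff y \<notin> G ` Q" using no mpv.span_base by blast
    ultimately have "Suc (card Q) \<le> card T" using finQ card_image[OF Ginj] by simp
    then show False using T(2) pair_count[OF xy(1,2) ne] by (simp add: Q_def D_def)
  qed
  then obtain u where "pff x * pff y = (\<Sum>v\<in>G ` Q. Const (u v) * v)"
    using mpv.span_finite[of "G ` Q"] finQ by auto
  then have xy_eq: "pff x * pff y = (\<Sum>q\<in>Q. Const (u (G q)) * G q)"
    by (simp add: sum.reindex[OF Ginj])
  \<comment> \<open>On the cell of \<open>snd q\<close> one of the coordinates at x and y vanishes,
    so the product does, and the standard pairs below \<open>snd q\<close> are independent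
    there.\<close>
  have zero: "u (G q) = 0" if q: "q \<in> Q" "\<not> (le x (snd q) \<and> le y (snd q))" for q
  proof -
    define g where "g = snd q"
    \<comment> \<open>The coefficient -1 at \<open>[x, y]\<close> turns the expansion of the product
      into a homogeneous relation of degree 2.\<close>
    define c where "c L = (if L = [x, y] then -1 else u (G (the_inv_into Q li L)))" for L
    have gX: "g \<in> X" using q(1) by (auto simp: Q_def g_def)
    have xyn: "[x, y] \<notin> li ` Q" using xy(3) by (auto simp: Q_def li_def)
    have cli: "c (li q) = u (G q)" if "q \<in> Q" for q
    proof -
      have "li q \<noteq> [x, y]" using imageI[OF that, of li] xyn by metis
      then show ?thesis using that by (simp add: c_def the_inv_into_f_f[OF li_inj])
    qed
    have sumQ: "(\<Sum>L\<in>li ` Q. Const (c L) * pmon L) = pff x * pff y"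
      unfolding xy_eq by (simp add: sum.reindex[OF li_inj] cli li_pmon)
    have rel: "(\<Sum>L\<in>insert [x, y] (li ` Q). Const (c L) * pmon L) = 0"
      using finQ xyn sumQ by (simp add: c_def Const_uminus)
    have van: "chain_form c (li ` Q) (p \<circ> r) = 0" if p: "cell g p" for p
    proof -
      have "chain_form c (insert [x, y] (li ` Q)) (p \<circ> r) = 0"
        using xy li_chain by (intro chain_form_eq_0[OF inf _ rel gX p, of 2]) (auto simp: chain_def)
      moreover have "p (r x) * p (r y) = 0" using p q(2) xy by (auto simp: cell_def g_def)
      ultimately show ?thesis using finQ xyn by (simp add: chain_form_def)
    qed
    have "c (li q) = 0"
    proof (rule cell_independent[OF inf _ _ gX van])
      show "finite (li ` Q)" using finQ by simp
      show "chain L \<and> length L = 2" if "L \<in> li ` Q" for L using that li_chain by blast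
      show "li q \<in> li ` Q" using q(1) by simp
      show "le z g" if "z \<in> set (li q)" for z
        using that q(1) le_refl[OF gX] by (auto simp: Q_def g_def li_def)
    qed
    then show ?thesis using cli[OF q(1)] by simp
  qed
  have mem: "Const (u (G q)) * G q \<in> mpv.span
    {pff m * pff n | m n. m \<in> X \<and> n \<in> X \<and> le m x \<and> le m y \<and> le x n \<and> le y n
       \<and> r m \<inter> r n = r x \<inter> r y \<and> r m \<union> r n = r x \<union> r y}" if "q \<in> Q" for q
  proof (cases "le x (snd q) \<and> le y (snd q)")
    case False
    then show ?thesis using zero[OF that] mpv.span_zero by simp
  next
    case True
    obtain m n where q: "q = (m, n)" by (cases q)
    then have "m \<in> X" "n \<in> X" "r m \<inter> r n = r x \<inter> r y" "r m \<union> r n = r x \<union> r y" "le x n" "le y n"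
      using that True by (auto simp: Q_def)
    \<comment> \<open>The cells only bound the larger factor; the bound on the smaller one follows
      from equality of weights.\<close>
    moreover from this have "le m x \<and> le m y" using weight_le xy by blast
    ultimately show ?thesis unfolding q G_def by (intro mpv.span_scale mpv.span_base) auto
  qed
  show ?thesis unfolding xy_eq by (rule mpv.span_sum) (rule mem)
qed

text \<open>Twice the degree of the monomial: a Pfaffian of degree s is labelled by 2s
  elements.\<close>

definition pdeg :: "'i list \<Rightarrow> nat" where
  "pdeg L = sum_list (map (\<lambda>x. card (r x)) L)"

text \<open>Replacing an incomparable pair by m below both and n above both keeps the sum of heights
  and spreads them apart. The sum of squared heights therefore grows, while it is bounded by the
  length times the square of the largest height.\<close>

lemma chain_straightening:
  assumes inf: "infinite (UNIV :: 'k::field set)" and two: "(2::'k) \<noteq> 0" and \<iota>: "\<iota> * \<iota> = (-1::'k)"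
    and "set L \<subseteq> X"
  shows "(pmon L :: 'k mpoly) \<in> mpv.span
    {pmon M | M. chain M \<and> length M = length L \<and> pdeg M = pdeg L
       \<and> (\<forall>x\<in>set L. le (hd M) x \<and> le x (last M))}"
  using assms(4)
proof (induction "length L * (Max (ht ` X))\<^sup>2 - sum_list (map (\<lambda>x. (ht x)\<^sup>2) L)" arbitrary: L rule: less_induct)
  case less
  let ?B = "\<lambda>L. {pmon M :: 'k mpoly | M. chain M \<and> length M = length L \<and> pdeg M = pdeg L
       \<and> (\<forall>x\<in>set L. le (hd M) x \<and> le x (last M))}"
  \<comment> \<open>Sorting by height puts all comparable pairs in order, so a pair that still
    violates the chain condition is incomparable.\<close>
  let ?K = "sort_key ht L"
  have perm: "mset ?K = mset L" by simp
  have sum_perm: "sum_list (map h ?K) = sum_list (map h L)" for h :: "'i \<Rightarrow> nat"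
    using arg_cong[OF perm, of "\<lambda>M. sum_mset (image_mset h M)"] by (simp only: mset_map[symmetric] sum_mset_sum_list)
  have pK: "pmon ?K = (pmon L :: 'k mpoly)" "pdeg ?K = pdeg L"
    using arg_cong[OF perm, of "\<lambda>M. prod_mset (image_mset pff M) :: 'k mpoly"] sum_perm
    unfolding pmon_def pdeg_def by (simp_all only: mset_map[symmetric] prod_mset_prod_list)
  show ?case
  proof (cases "sorted_wrt le ?K")
    case True
    then have "chain ?K" using less.prems by (simp add: chain_def)
    moreover from this have "\<forall>x\<in>set L. le (hd ?K) x \<and> le x (last ?K)"
      using chain_hd_le[of ?K] chain_le_last[of ?K] by simp
    ultimately have "pmon ?K \<in> ?B L" using pK(2) by (intro CollectI exI[of _ ?K]) simp
    then have "pmon ?K \<in> mpv.span (?B L)" by (rule mpv.span_base)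
    then show ?thesis unfolding pK(1) .
  next
    case False
    from not_sorted_wrtD[OF this] obtain us x vs y ws
      where K: "?K = us @ x # vs @ y # ws" and nle: "\<not> le x y" by (elim exE conjE)
    have xy: "x \<in> X" "y \<in> X" and rest: "set (us @ vs @ ws) \<subseteq> X"
      using less.prems set_sort[of ht L] unfolding K by auto
    have "sorted (map ht ?K)" by simp
    then have htxy: "ht x \<le> ht y" unfolding K by (simp add: sorted_append)
    have nle2: "\<not> le y x" using ht_mono[OF xy(2,1)] htxy nle by force
    let ?R = "us @ vs @ ws"
    have pL: "pmon L = (pff x * pff y * pmon ?R :: 'k mpoly)"
      unfolding pK(1)[symmetric] K by (simp add: algebra_simps)
    have step: "pff m * pff n * pmon ?R \<in> mpv.span (?B L)"
      if mn: "m \<in> X" "n \<in> X" "le m x" "le m y" "le x n" "le y n"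
        "r m \<inter> r n = r x \<inter> r y" "r m \<union> r n = r x \<union> r y" for m n
    proof -
      let ?M = "m # n # ?R"
      have len: "length ?M = length L"
        using arg_cong[OF K, of length] by simp
      have setM: "set ?M \<subseteq> X" using mn rest by auto
      have setL: "set L = insert x (insert y (set ?R))" using arg_cong[OF K, of set] by auto
      have card: "card (r m) + card (r n) = card (r x) + card (r y)"
        using card_Un_Int[of "r m" "r n"] card_Un_Int[of "r x" "r y"] finite_r mn xy by simp
      have deg: "pdeg ?M = pdeg L"
        unfolding pK(2)[symmetric] K using card by (simp add: pdeg_def)
      have sq: "sum_list (map (\<lambda>x. (ht x)\<^sup>2) L) < sum_list (map (\<lambda>x. (ht x)\<^sup>2) ?M)"
      proof -
        have mx: "ht m < ht x" using ht_mono[OF mn(1) xy(1) mn(3)] mn(4) nle by auto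
        have yn: "ht y < ht n" using ht_mono[OF xy(2) mn(2) mn(6)] mn(5) nle by auto
        have xn: "ht x < ht n" using ht_mono[OF xy(1) mn(2) mn(5)] mn(6) nle2 by auto
        have sum: "ht m + ht n = ht x + ht y" using weight_ht xy mn by blast
        \<comment> \<open>With \<open>ht n = ht x + e\<close> and \<open>ht y = ht m + e\<close> the
          gain in squares is \<open>2 * e * (ht x - ht m)\<close>.\<close>
        define e where "e = ht n - ht x"
        have e: "ht n = ht x + e" "ht y = ht m + e" "e > 0" using xn sum by (auto simp: e_def)
        have me: "e * ht m < e * ht x" using mx e by simp
        have "(ht x)\<^sup>2 + (ht y)\<^sup>2 < (ht m)\<^sup>2 + (ht n)\<^sup>2"
          unfolding e(1,2) power2_eq_square using add_strict_mono[OF me me]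
          by (simp only: algebra_simps)
        then show ?thesis unfolding sum_perm[of "\<lambda>x. (ht x)\<^sup>2", symmetric] K by simp
      qed
      have bound: "sum_list (map (\<lambda>x. (ht x)\<^sup>2) M) \<le> length M * (Max (ht ` X))\<^sup>2" if "set M \<subseteq> X" for M
        using that
      proof (induction M)
        case (Cons a M)
        have "ht a \<le> Max (ht ` X)" using Cons.prems finite_X by simp
        then have "(ht a)\<^sup>2 \<le> (Max (ht ` X))\<^sup>2" by (rule power_mono) simp
        moreover have "sum_list (map (\<lambda>x. (ht x)\<^sup>2) M) \<le> length M * (Max (ht ` X))\<^sup>2"
          using Cons.prems by (intro Cons.IH) simp
        ultimately show ?case
          unfolding list.map sum_list.Cons length_Cons mult_Suc by (rule add_mono)
      qed simp
      have IH: "pmon ?M \<in> mpv.span (?B ?M)"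
      proof (rule less.hyps[OF _ setM])
        show "length ?M * (Max (ht ` X))\<^sup>2 - sum_list (map (\<lambda>x. (ht x)\<^sup>2) ?M)
           < length L * (Max (ht ` X))\<^sup>2 - sum_list (map (\<lambda>x. (ht x)\<^sup>2) L)"
          unfolding len using sq bound[OF setM] unfolding len by linarith
      qed
      have sub: "?B ?M \<subseteq> ?B L"
      proof clarify
        fix M assume M: "chain M" "length M = length ?M" "pdeg M = pdeg ?M"
          and b: "\<forall>x\<in>set ?M. le (hd M) x \<and> le x (last M)"
        have "M \<noteq> []" using M(2) by auto
        then have X: "hd M \<in> X" "last M \<in> X" using M(1) by (auto simp: chain_def)
        have "le (hd M) z \<and> le z (last M)" if "z \<in> set L" for z
          using that b mn xy le_trans[OF X(1) mn(1) xy(1)] le_trans[OF X(1) mn(1) xy(2)]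
            le_trans[OF xy(1) mn(2) X(2)] le_trans[OF xy(2) mn(2) X(2)] unfolding setL by auto
        then show "\<exists>M'. (pmon M :: 'k mpoly) = pmon M' \<and> chain M' \<and> length M' = length L \<and> pdeg M' = pdeg L
           \<and> (\<forall>x\<in>set L. le (hd M') x \<and> le x (last M'))"
          using M len deg by (intro exI[of _ M]) simp
      qed
      have "pmon ?M \<in> mpv.span (?B L)" by (rule subsetD[OF mpv.span_mono[OF sub] IH])
      then show ?thesis by (simp add: algebra_simps)
    qed
    have "mpv.span {pff m * pff n | m n. m \<in> X \<and> n \<in> X \<and> le m x \<and> le m y \<and> le x n \<and> le y n
       \<and> r m \<inter> r n = r x \<inter> r y \<and> r m \<union> r n = r x \<union> r y} \<subseteq> {q. q * pmon ?R \<in> mpv.span (?B L)}"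
    proof (rule mpv.span_minimal)
      show "mpv.subspace {q. q * pmon ?R \<in> mpv.span (?B L)}"
        by (rule mpv.subspaceI)
           (auto simp: mpv.span_zero distrib_right mult.assoc intro: mpv.span_add mpv.span_scale)
    qed (use step in auto)
    from subsetD[OF this pair_straightening[OF inf two \<iota> xy nle]] show ?thesis unfolding pL by (rule CollectD)
  qed
qed

end

section \<open>Standard monomials relative to the base point\<close>

context pfaffian_poset
begin

definition standard :: "'i \<Rightarrow> 'i list \<Rightarrow> bool" where
  "standard b L \<longleftrightarrow> chain L \<and> (\<forall>x\<in>set L. x \<noteq> b \<and> (le x b \<or> le b x))"

lemma pff_base:
  assumes "r b = {}" shows "pff b = 1"
  using assms by (simp add: pff_def pf_def)

lemma pmon_replicate_base:
  assumes "r b = {}" shows "pmon (replicate n b) = 1"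
  by (induction n) (simp_all add: pff_base[OF assms])

lemma pmon_filter_base:
  assumes "r b = {}" shows "pmon (filter (\<lambda>x. x \<noteq> b) L) = pmon L"
  by (induction L) (simp_all add: pff_base[OF assms])

text \<open>Only the base point has an empty label. Conversely read, a list longer than its
  \<open>pdeg\<close> must contain the base point.\<close>

lemma chain_length_le_pdeg:
  assumes "b \<in> X" "r b = {}" "set L \<subseteq> X" "b \<notin> set L"
  shows "length L \<le> pdeg L"
  using assms(3,4)
proof (induction L)
  case (Cons x L)
  have "r x \<noteq> {}" using r_inj[of x b] Cons.prems assms(1,2) by auto
  then have "1 \<le> card (r x)" using finite_r[of x] Cons.prems by (simp add: Suc_le_eq card_gt_0_iff)
  then show ?case using Cons by (auto simp: pdeg_def)
qed (simp add: pdeg_def)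

lemma standard_straightening:
  assumes inf: "infinite (UNIV :: 'k::field set)" and two: "(2::'k) \<noteq> 0" and \<iota>: "\<iota> * \<iota> = (-1::'k)"
    and b: "b \<in> X" "r b = {}" and L: "set L \<subseteq> X"
    and ag: "a \<in> X" "g \<in> X" "le a b" "le b g"
  shows "(pmon L :: 'k mpoly) \<in> mpv.span
    {pmon M | M. standard b M \<and> (\<forall>x\<in>set L. (\<not> le a x \<longrightarrow> M \<noteq> [] \<and> \<not> le a (hd M))
        \<and> (\<not> le x g \<longrightarrow> M \<noteq> [] \<and> \<not> le (last M) g))}"
proof -
  \<comment> \<open>After padding with enough copies of the base point, the degree forces the base point to
    survive in every chain of the straightened expression.\<close>
  let ?L = "L @ replicate (pdeg L + 1) b"
  have pL: "pmon ?L = (pmon L :: 'k mpoly)" by (simp add: pmon_replicate_base[OF b(2)] pff_base[OF b(2)])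
  have dL: "pdeg ?L = pdeg L" by (simp add: pdeg_def b(2) sum_list_replicate)
  have sL: "set ?L \<subseteq> X" using L b by auto
  have "pmon L \<in> mpv.span {pmon M :: 'k mpoly | M. chain M \<and> length M = length ?L \<and> pdeg M = pdeg ?L
       \<and> (\<forall>x\<in>set ?L. le (hd M) x \<and> le x (last M))}"
    using chain_straightening[OF inf two \<iota> sL] unfolding pL .
  also have "\<dots> \<subseteq> mpv.span {pmon M | M. standard b M \<and> (\<forall>x\<in>set L. (\<not> le a x \<longrightarrow> M \<noteq> [] \<and> \<not> le a (hd M))
        \<and> (\<not> le x g \<longrightarrow> M \<noteq> [] \<and> \<not> le (last M) g))}"
  proof (rule mpv.span_mono, clarify)
    fix M assume M: "chain M" "length M = length ?L" "pdeg M = pdeg ?L"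
      and bd: "\<forall>x\<in>set ?L. le (hd M) x \<and> le x (last M)"
    let ?M = "filter (\<lambda>x. x \<noteq> b) M"
    have MX: "set M \<subseteq> X" "sorted_wrt le M" using M(1) by (auto simp: chain_def)
    have bM: "b \<in> set M"
    proof (rule ccontr)
      assume "b \<notin> set M"
      from chain_length_le_pdeg[OF b MX(1) this] show False using M(2) unfolding M(3) dL by simp
    qed
    then have Mne: "M \<noteq> []" by auto
    have "le x b \<or> le b x" if "x \<in> set M" for x
    proof -
      from bM obtain us vs where "M = us @ b # vs" by (meson split_list)
      then show ?thesis using that MX(2) le_refl[OF b(1)] by (auto simp: sorted_wrt_append)
    qed
    then have std: "standard b ?M" using MX by (auto simp: standard_def chain_def sorted_wrt_filter)
    have hX: "hd M \<in> X" "last M \<in> X" using Mne MX(1) by auto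
    \<comment> \<open>As \<open>hd M\<close> is below x, it cannot be above a. Hence it differs from
      b, survives the removal of the copies of b and is still the head.\<close>
    have low: "?M \<noteq> [] \<and> \<not> le a (hd ?M)" if x: "x \<in> set L" "\<not> le a x" for x
    proof -
      have "\<not> le a (hd M)" using le_trans[OF ag(1) hX(1)] x L bd by auto
      moreover from this have "hd M \<noteq> b" using ag by auto
      ultimately show ?thesis using Mne by (cases M) auto
    qed
    have high: "?M \<noteq> [] \<and> \<not> le (last ?M) g" if x: "x \<in> set L" "\<not> le x g" for x
    proof -
      have "\<not> le (last M) g" using le_trans[OF _ hX(2) ag(2)] x L bd by auto
      moreover from this have "last M \<noteq> b" using ag by auto
      ultimately show ?thesis using Mne by (cases M rule: rev_cases) auto
    qed
    show "\<exists>M'. (pmon M :: 'k mpoly) = pmon M' \<and> standard b M' \<and> (\<forall>x\<in>set L. (\<not> le a x \<longrightarrow> M' \<noteq> [] \<and> \<not> le a (hd M'))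
        \<and> (\<not> le x g \<longrightarrow> M' \<noteq> [] \<and> \<not> le (last M') g))"
      using std low high by (intro exI[of _ ?M]) (simp add: pmon_filter_base[OF b(2)])
  qed
  finally show ?thesis .
qed

text \<open>Copies of \<open>b\<close>, inserted between the members below and above
  \<open>b\<close>, make all chains equally long without changing the monomials. Deleting them
  recovers the chain, so distinct chains stay distinct.\<close>

lemma standard_independent:
  fixes c :: "'i list \<Rightarrow> 'k::field"
  assumes inf: "infinite (UNIV :: 'k set)" and b: "b \<in> X" "r b = {}" and fin: "finite S"
    and S: "\<And>L. L \<in> S \<Longrightarrow> standard b L"
    and rel: "(\<Sum>L\<in>S. Const (c L) * pmon L) = 0"
    and L: "L \<in> S"
  shows "c L = 0"
proof -
  define N where "N = Max (length ` S)"
  have len: "length M \<le> N" if "M \<in> S" for M using that fin by (simp add: N_def)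
  define pad where "pad M = takeWhile (\<lambda>x. le x b) M @ replicate (N - length M) b @ dropWhile (\<lambda>x. le x b) M" for M
  have pad_filter: "filter (\<lambda>x. x \<noteq> b) (pad M) = M" if "M \<in> S" for M
  proof -
    have nb: "x \<noteq> b" if "x \<in> set M" for x using S[OF \<open>M \<in> S\<close>] that by (auto simp: standard_def)
    have "filter (\<lambda>x. x \<noteq> b) (takeWhile (\<lambda>x. le x b) M) = takeWhile (\<lambda>x. le x b) M"
      using nb by (intro filter_True) (auto dest: set_takeWhileD)
    moreover have "filter (\<lambda>x. x \<noteq> b) (dropWhile (\<lambda>x. le x b) M) = dropWhile (\<lambda>x. le x b) M"
      using nb by (intro filter_True) (auto dest: set_dropWhileD)
    ultimately show ?thesis by (simp add: pad_def)
  qed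
  have pad_pmon: "pmon (pad M) = pmon M" if "M \<in> S" for M
    by (subst pmon_filter_base[OF b(2), symmetric]) (simp only: pad_filter[OF that])
  have pad_chain: "chain (pad M) \<and> length (pad M) = N" if MS: "M \<in> S" for M
  proof
    have M: "set M \<subseteq> X" "sorted_wrt le M" "\<And>x. x \<in> set M \<Longrightarrow> le x b \<or> le b x"
      using S[OF MS] by (auto simp: standard_def chain_def)
    let ?T = "takeWhile (\<lambda>x. le x b) M" and ?D = "dropWhile (\<lambda>x. le x b) M"
    have TD: "sorted_wrt le (?T @ ?D)" using M(2) by simp
    \<comment> \<open>The first member not below b is above it by comparability, and then so are its
      successors.\<close>
    have D: "le b x" if "x \<in> set ?D" for x
    proof (cases ?D)
      case (Cons y ys)
      have y: "\<not> le y b" "y \<in> set M" using hd_dropWhile[of "\<lambda>x. le x b" M] Cons set_dropWhileD[of y "\<lambda>x. le x b" M] by auto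
      then have by1: "le b y" using M(3) by blast
      show ?thesis
      proof (cases "x = y")
        case False
        then have "le y x" using TD that Cons by (auto simp: sorted_wrt_append)
        then show ?thesis using le_trans[OF b(1) _ _ by1] M(1) y set_dropWhileD[OF that] by auto
      qed (use by1 in simp)
    next
      case Nil
      then show ?thesis using that by (simp only: list.set empty_iff)
    qed
    have T: "le x b" if "x \<in> set ?T" for x using set_takeWhileD[OF that] by simp
    have "sorted_wrt le (replicate (N - length M) b)"
      using le_refl[OF b(1)] by (auto simp: sorted_wrt_iff_nth_less)
    moreover have "sorted_wrt le ?T \<and> sorted_wrt le ?D \<and> (\<forall>x\<in>set ?T. \<forall>y\<in>set ?D. le x y)"
      using TD unfolding sorted_wrt_append .
    moreover have "le x y" if "x \<in> set ?T" "y \<in> set (replicate (N - length M) b)" for x y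
      using T[OF that(1)] that(2) by simp
    moreover have "le x y" if "x \<in> set (replicate (N - length M) b)" "y \<in> set ?D" for x y
      using D[OF that(2)] that(1) by simp
    ultimately have "sorted_wrt le (pad M)"
      unfolding pad_def sorted_wrt_append set_append by blast
    moreover have "set (pad M) \<subseteq> X" using M(1) b by (auto simp: pad_def dest: set_takeWhileD set_dropWhileD)
    ultimately show "chain (pad M)" by (simp add: chain_def)
    have "length ?T + length ?D = length M" by (metis length_append takeWhile_dropWhile_id)
    then show "length (pad M) = N" using len[OF MS] by (simp add: pad_def)
  qed
  have inj: "inj_on pad S" by (rule inj_onI) (metis pad_filter)
  define c' where "c' M = c (filter (\<lambda>x. x \<noteq> b) M)" for M
  have "(\<Sum>M\<in>pad ` S. Const (c' M) * pmon M) = (\<Sum>M\<in>S. Const (c M) * pmon M)"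
    unfolding sum.reindex[OF inj] by (intro sum.cong refl) (simp add: c'_def pad_filter pad_pmon)
  then have rel': "(\<Sum>M\<in>pad ` S. Const (c' M) * pmon M) = 0" using rel by simp
  have "c' (pad L) = 0"
  proof (rule chain_independent[OF inf _ _ rel'])
    show "finite (pad ` S)" using fin by simp
    show "chain M \<and> length M = N" if "M \<in> pad ` S" for M using that pad_chain by blast
    show "pad L \<in> pad ` S" using L by simp
  qed
  then show ?thesis by (simp add: c'_def pad_filter[OF L])
qed

end

section \<open>The order on maximal isotropic coordinate subspaces\<close>

lemma card_below_eq_card_indices:
  fixes A :: "nat set"
  assumes "finite A"
  shows "card (A \<inter> {..m}) = card {i. i < card A \<and> sorted_list_of_set A ! i \<le> m}"
proof -
  let ?xs = "sorted_list_of_set A"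
  have "{x \<in> set xs. x \<le> m} = (!) xs ` {i. i < length xs \<and> xs ! i \<le> m}" for xs :: "nat list"
    by (auto simp: in_set_conv_nth)
  from this[of ?xs] have "A \<inter> {..m} = (!) ?xs ` {i. i < card A \<and> ?xs ! i \<le> m}"
    using assms by (simp add: Int_def)
  moreover have "inj_on ((!) ?xs) {i. i < card A \<and> ?xs ! i \<le> m}"
    using assms by (auto simp: inj_on_def nth_eq_iff_index_eq)
  ultimately show ?thesis by (simp add: card_image)
qed

text \<open>Sorted entries and counting function determine each other: the entry with index
  \<open>i\<close>, counted from 0, is at most \<open>m\<close> exactly if more than
  \<open>i\<close> entries are.\<close>

lemma leqI_iff_card_below:
  assumes "finite v" "finite w" "card v = card w"
  shows "leqI v w \<longleftrightarrow> (\<forall>m. card (w \<inter> {..m}) \<le> card (v \<inter> {..m}))"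
proof -
  let ?xs = "sorted_list_of_set v" and ?ys = "sorted_list_of_set w" and ?n = "card w"
  have leqI: "leqI v w \<longleftrightarrow> (\<forall>i<?n. ?xs ! i \<le> ?ys ! i)"
    using assms by (auto simp: leqI_def list_all2_conv_all_nth)
  have cx: "card (v \<inter> {..m}) = card {i. i < ?n \<and> ?xs ! i \<le> m}"
    and cy: "card (w \<inter> {..m}) = card {i. i < ?n \<and> ?ys ! i \<le> m}" for m
    using card_below_eq_card_indices assms by metis+
  show ?thesis unfolding leqI cx cy
  proof (intro iffI allI impI)
    fix m assume "\<forall>i<?n. ?xs ! i \<le> ?ys ! i"
    then show "card {i. i < ?n \<and> ?ys ! i \<le> m} \<le> card {i. i < ?n \<and> ?xs ! i \<le> m}"
      by (intro card_mono) (auto intro: order_trans)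
  next
    fix i assume *: "\<forall>m. card {i. i < ?n \<and> ?ys ! i \<le> m} \<le> card {i. i < ?n \<and> ?xs ! i \<le> m}" and i: "i < ?n"
    show "?xs ! i \<le> ?ys ! i"
    proof (rule ccontr)
      assume neg: "\<not> ?xs ! i \<le> ?ys ! i"
      have sx: "?xs ! j \<le> ?xs ! k" if "j \<le> k" "k < ?n" for j k
        using that assms sorted_nth_mono[of ?xs j k] by simp
      have sy: "?ys ! j \<le> ?ys ! k" if "j \<le> k" "k < ?n" for j k
        using that assms sorted_nth_mono[of ?ys j k] by simp
      \<comment> \<open>Compare the counts at \<open>?ys ! i\<close>: at least \<open>i + 1\<close>
        entries of \<open>w\<close> but at most \<open>i\<close> entries of \<open>v\<close> are
        that small.\<close>
      have "card {..i} \<le> card {k. k < ?n \<and> ?ys ! k \<le> ?ys ! i}"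
        using i sy by (intro card_mono) auto
      moreover have "card {k. k < ?n \<and> ?xs ! k \<le> ?ys ! i} \<le> card {..<i}"
      proof (intro card_mono subsetI)
        fix k assume "k \<in> {k. k < ?n \<and> ?xs ! k \<le> ?ys ! i}"
        then show "k \<in> {..<i}" using sx[of i k] neg by force
      qed simp
      moreover have "card {k. k < ?n \<and> ?ys ! k \<le> ?ys ! i} \<le> card {k. k < ?n \<and> ?xs ! k \<le> ?ys ! i}"
        using * by blast
      ultimately show False by simp
    qed
  qed
qed

text \<open>An element of \<open>Iset d\<close> is encoded by the set of those \<open>j \<le> d\<close> with \<open>star d j\<close> in it.\<close>
definition flipped :: "nat \<Rightarrow> nat set \<Rightarrow> nat set" where
  "flipped d \<theta> = {j \<in> {1..d}. j \<notin> \<theta>}"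

definition of_flipped :: "nat \<Rightarrow> nat set \<Rightarrow> nat set" where
  "of_flipped d N = ({1..d} - N) \<union> star d ` N"

definition count_below :: "nat set \<Rightarrow> nat \<Rightarrow> nat" where
  "count_below N m = card (N \<inter> {..m})"

text \<open>Flipping \<open>j\<close> exchanges it for the large number \<open>star d j\<close>, so
  flipping more indices, or smaller ones, gives a larger element.\<close>

definition prefix_le :: "nat \<Rightarrow> nat set \<Rightarrow> nat set \<Rightarrow> bool" where
  "prefix_le d N M \<longleftrightarrow> (\<forall>m\<le>d. count_below N m \<le> count_below M m)"

lemma star_star: "x \<le> 2 * d \<Longrightarrow> star d (star d x) = x"
  by (simp add: star_def)

lemma star_inj: "inj_on (star d) {..2 * d}"
  by (auto simp: inj_on_def star_def)

lemma IsetD: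
  assumes "\<theta> \<in> Iset d"
  shows "\<theta> \<subseteq> {1..2 * d}" "finite \<theta>" "card \<theta> = d"
    "\<And>j. j \<in> {1..2 * d} \<Longrightarrow> star d j \<in> \<theta> \<longleftrightarrow> j \<notin> \<theta>"
  using assms finite_subset by (auto simp: Iset_def)

lemma flipped_star:
  assumes "\<theta> \<in> Iset d"
  shows "{x \<in> \<theta>. x > d} = star d ` flipped d \<theta>"
proof (intro equalityI subsetI)
  fix x assume x: "x \<in> {x \<in> \<theta>. x > d}"
  then have "x \<in> {1..2 * d}" using IsetD(1)[OF assms] by auto
  then have "star d x \<in> flipped d \<theta>" "x = star d (star d x)"
    using x IsetD(4)[OF assms, of x] by (auto simp: flipped_def star_def)
  then show "x \<in> star d ` flipped d \<theta>" by blast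
next
  fix x assume "x \<in> star d ` flipped d \<theta>"
  then obtain j where "j \<in> {1..d}" "j \<notin> \<theta>" "x = star d j" by (auto simp: flipped_def)
  then show "x \<in> {x \<in> \<theta>. x > d}" using IsetD(4)[OF assms, of j] by (auto simp: star_def)
qed

lemma flipped_subset: "flipped d \<theta> \<subseteq> {1..d}"
  by (auto simp: flipped_def)

lemma finite_flipped [simp]: "finite (flipped d \<theta>)"
  by (simp add: flipped_def)

lemma flipped_even:
  assumes "\<theta> \<in> Iset d" shows "even (card (flipped d \<theta>))"
proof -
  have "inj_on (star d) (flipped d \<theta>)"
    by (rule inj_on_subset[OF star_inj[of d]]) (auto simp: flipped_def)
  then have "card (flipped d \<theta>) = card {x \<in> \<theta>. x > d}"
    unfolding flipped_star[OF assms] by (simp add: card_image)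
  then show ?thesis using assms by (simp add: Iset_def)
qed

lemma of_flipped_flipped:
  assumes "\<theta> \<in> Iset d" shows "of_flipped d (flipped d \<theta>) = \<theta>"
  unfolding of_flipped_def flipped_star[OF assms, symmetric]
  using IsetD(1)[OF assms] by (auto simp: flipped_def)

lemma flipped_of_flipped:
  assumes "N \<subseteq> {1..d}" shows "flipped d (of_flipped d N) = N"
proof -
  have "star d k > d" if "k \<in> N" for k using subsetD[OF assms that] by (auto simp: star_def)
  then show ?thesis using assms by (fastforce simp: flipped_def of_flipped_def)
qed

lemma of_flipped_Iset:
  assumes "N \<subseteq> {1..d}" "even (card N)" shows "of_flipped d N \<in> Iset d"
proof -
  have fin: "finite N" using assms finite_subset by blast
  have inj: "inj_on (star d) N" by (rule inj_on_subset[OF star_inj[of d]]) (use assms in auto)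
  have gt: "star d j > d" "star d j \<le> 2 * d" if "j \<in> N" for j
    using subsetD[OF assms(1) that] by (auto simp: star_def)
  have "card (of_flipped d N) = card ({1..d} - N) + card (star d ` N)"
    unfolding of_flipped_def using fin gt by (intro card_Un_disjoint) (auto, force)
  also have "\<dots> = d"
    using assms fin card_image[OF inj] card_mono[OF _ assms(1)] by (simp add: card_Diff_subset)
  finally have "card (of_flipped d N) = d" .
  moreover have "of_flipped d N \<subseteq> {1..2 * d}"
    using assms gt by (force simp: of_flipped_def)
  moreover have "(m \<in> of_flipped d N) \<noteq> (star d m \<in> of_flipped d N)" if "m \<in> {1..2 * d}" for m
  proof (cases "m \<le> d")
    case True
    then have "m \<in> of_flipped d N \<longleftrightarrow> m \<notin> N" using that gt by (force simp: of_flipped_def)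
    moreover have "star d m \<in> of_flipped d N \<longleftrightarrow> m \<in> N"
    proof
      assume "star d m \<in> of_flipped d N"
      moreover have "star d m \<notin> {1..d}" using True by (auto simp: star_def)
      ultimately obtain j where "j \<in> N" "star d m = star d j" by (auto simp: of_flipped_def)
      then show "m \<in> N" using inj_onD[OF star_inj, of d m j] True assms by force
    qed (auto simp: of_flipped_def)
    ultimately show ?thesis by blast
  next
    case False
    then have s: "star d m \<in> {1..d}" "star d (star d m) = m" using that by (auto simp: star_def)
    have "star d m \<in> of_flipped d N \<longleftrightarrow> star d m \<notin> N"
      using s(1) gt by (force simp: of_flipped_def)
    moreover have "m \<in> of_flipped d N \<longleftrightarrow> star d m \<in> N"
    proof
      assume "m \<in> of_flipped d N"
      then obtain j where "j \<in> N" "m = star d j" using False by (auto simp: of_flipped_def)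
      then show "star d m \<in> N" using star_star[of j d] assms by auto
    next
      assume "star d m \<in> N"
      then show "m \<in> of_flipped d N" unfolding of_flipped_def using s(2) by (metis UnI2 imageI)
    qed
    ultimately show ?thesis by blast
  qed
  moreover have "{x \<in> of_flipped d N. x > d} = star d ` N"
    using gt by (auto simp: of_flipped_def)
  ultimately show ?thesis using assms(2) card_image[OF inj] by (simp add: Iset_def)
qed

text \<open>Up to \<open>d\<close> the missing elements are the flipped ones. Beyond
  \<open>d\<close>, the elements greater than \<open>m\<close> are the stars of the flipped indices
  up to \<open>2 * d - m\<close>, so the upper half of the counts is governed by the lower
  half.\<close>

lemma card_below_Iset:
  assumes "\<theta> \<in> Iset d"
  shows "m \<le> d \<Longrightarrow> card (\<theta> \<inter> {..m}) = m - count_below (flipped d \<theta>) m"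
    and "d \<le> m \<Longrightarrow> card (\<theta> \<inter> {..m}) = d - count_below (flipped d \<theta>) (2 * d - m)"
proof -
  assume m: "m \<le> d"
  have "\<theta> \<inter> {..m} = {1..m} - (flipped d \<theta> \<inter> {..m})"
    using IsetD(1)[OF assms] m by (auto simp: flipped_def)
  moreover have "flipped d \<theta> \<inter> {..m} \<subseteq> {1..m}" by (auto simp: flipped_def)
  ultimately show "card (\<theta> \<inter> {..m}) = m - count_below (flipped d \<theta>) m"
    by (simp add: card_Diff_subset count_below_def)
next
  assume m: "d \<le> m"
  have "\<theta> \<inter> {m<..} = star d ` (flipped d \<theta> \<inter> {..2 * d - m})"
  proof -
    have "\<theta> \<inter> {m<..} = {x \<in> \<theta>. x > d} \<inter> {m<..}" using m by auto
    also have "\<dots> = star d ` flipped d \<theta> \<inter> {m<..}" unfolding flipped_star[OF assms] ..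
    also have "\<dots> = star d ` (flipped d \<theta> \<inter> {..2 * d - m})"
      by (auto simp: flipped_def star_def)
    finally show ?thesis .
  qed
  moreover have "inj_on (star d) (flipped d \<theta> \<inter> {..2 * d - m})"
    by (rule inj_on_subset[OF star_inj[of d]]) (auto simp: flipped_def)
  ultimately have "card (\<theta> \<inter> {m<..}) = count_below (flipped d \<theta>) (2 * d - m)"
    by (simp add: card_image count_below_def)
  moreover have "d = card (\<theta> \<inter> {..m}) + card (\<theta> \<inter> {m<..})"
  proof -
    have "card ((\<theta> \<inter> {..m}) \<union> (\<theta> \<inter> {m<..})) = card (\<theta> \<inter> {..m}) + card (\<theta> \<inter> {m<..})"
      using IsetD(2)[OF assms] by (intro card_Un_disjoint) auto
    moreover have "(\<theta> \<inter> {..m}) \<union> (\<theta> \<inter> {m<..}) = \<theta>" by auto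
    ultimately have "card \<theta> = card (\<theta> \<inter> {..m}) + card (\<theta> \<inter> {m<..})" by simp
    then show ?thesis using IsetD(3)[OF assms] by simp
  qed
  ultimately show "card (\<theta> \<inter> {..m}) = d - count_below (flipped d \<theta>) (2 * d - m)" by simp
qed

lemma count_below_flipped_le: "count_below (flipped d \<theta>) m \<le> m"
proof -
  have "count_below (flipped d \<theta>) m \<le> card {1..m}"
    unfolding count_below_def by (intro card_mono) (auto simp: flipped_def)
  then show ?thesis by simp
qed

lemma leqI_iff_prefix_le:
  assumes "\<theta> \<in> Iset d" "\<phi> \<in> Iset d"
  shows "leqI \<theta> \<phi> \<longleftrightarrow> prefix_le d (flipped d \<theta>) (flipped d \<phi>)"
proof -
  have "leqI \<theta> \<phi> \<longleftrightarrow> (\<forall>m. card (\<phi> \<inter> {..m}) \<le> card (\<theta> \<inter> {..m}))"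
    using leqI_iff_card_below IsetD(2,3)[OF assms(1)] IsetD(2,3)[OF assms(2)] by simp
  also have "\<dots> \<longleftrightarrow> prefix_le d (flipped d \<theta>) (flipped d \<phi>)"
    unfolding prefix_le_def
  proof (intro iffI allI impI)
    fix m assume *: "\<forall>m. card (\<phi> \<inter> {..m}) \<le> card (\<theta> \<inter> {..m})" and m: "m \<le> d"
    have "m - count_below (flipped d \<phi>) m \<le> m - count_below (flipped d \<theta>) m"
      using *[rule_format, of m] card_below_Iset(1)[OF assms(1) m] card_below_Iset(1)[OF assms(2) m] by simp
    then show "count_below (flipped d \<theta>) m \<le> count_below (flipped d \<phi>) m"
      using count_below_flipped_le[of d \<theta> m] count_below_flipped_le[of d \<phi> m] by linarith
  next
    fix m assume *: "\<forall>m\<le>d. count_below (flipped d \<theta>) m \<le> count_below (flipped d \<phi>) m"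
    show "card (\<phi> \<inter> {..m}) \<le> card (\<theta> \<inter> {..m})"
    proof (cases "m \<le> d")
      case True
      then show ?thesis using * card_below_Iset(1)[OF assms(1) True] card_below_Iset(1)[OF assms(2) True]
        by (simp add: diff_le_mono2)
    next
      case False
      then have m: "d \<le> m" "2 * d - m \<le> d" by auto
      show ?thesis using * m(2) card_below_Iset(2)[OF assms(1) m(1)] card_below_Iset(2)[OF assms(2) m(1)]
        by (simp add: diff_le_mono2)
    qed
  qed
  finally show ?thesis .
qed

lemma count_below_toggle:
  "int (count_below (toggle i A) m) = int (count_below A m) + (if i \<le> m then (if i \<in> A then -1 else 1) else 0)"
proof -
  have fin: "finite (A \<inter> {..m})" by simp
  consider "\<not> i \<le> m" | "i \<le> m" "i \<in> A" | "i \<le> m" "i \<notin> A" by blast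
  then show ?thesis
  proof cases
    case 1
    then have "toggle i A \<inter> {..m} = A \<inter> {..m}" by (auto simp: toggle_def)
    then show ?thesis using 1 by (simp add: count_below_def)
  next
    case 2
    then have "A \<inter> {..m} = insert i (toggle i A \<inter> {..m})" "i \<notin> toggle i A \<inter> {..m}"
      by (auto simp: toggle_def)
    then have "count_below A m = Suc (count_below (toggle i A) m)"
      unfolding count_below_def by simp
    then show ?thesis using 2 by simp
  next
    case 3
    then have "toggle i A \<inter> {..m} = insert i (A \<inter> {..m})" by (auto simp: toggle_def)
    then have "count_below (toggle i A) m = Suc (count_below A m)"
      unfolding count_below_def using 3 by simp
    then show ?thesis using 3 by simp
  qed
qed

lemma count_below_Suc: "count_below A (Suc m) = count_below A m + (if Suc m \<in> A then 1 else 0)"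
proof -
  have "A \<inter> {..Suc m} = (if Suc m \<in> A then insert (Suc m) (A \<inter> {..m}) else A \<inter> {..m})"
    by (auto simp: le_Suc_eq)
  then show ?thesis by (simp add: count_below_def)
qed

lemma count_below_mono: "m \<le> n \<Longrightarrow> count_below A m \<le> count_below A n"
  unfolding count_below_def by (intro card_mono) auto

lemma count_below_all:
  assumes "A \<subseteq> {1..d}" shows "count_below A d = card A"
proof -
  have "A \<inter> {..d} = A" using assms by auto
  then show ?thesis by (simp add: count_below_def)
qed

lemma count_below_inj:
  assumes "N \<subseteq> {1..d}" "M \<subseteq> {1..d}" "\<And>m. m \<le> d \<Longrightarrow> count_below N m = count_below M m"
  shows "N = M"
proof -
  have "j \<in> N \<longleftrightarrow> j \<in> M" if "j \<in> {1..d}" for j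
  proof -
    have "j \<noteq> 0" using that by simp
    then obtain k where j: "j = Suc k" by (cases j) auto
    then show ?thesis using assms(3)[of j] assms(3)[of k] that count_below_Suc[of N k] count_below_Suc[of M k]
      by (auto split: if_splits)
  qed
  then show ?thesis using assms(1,2) by blast
qed

text \<open>Since the memberships agree, toggling changes both counting functions by the same
  amount. This yields the lifting clause of \<open>cover\<close>.\<close>

lemma prefix_le_toggle2:
  assumes "i \<noteq> j" "(i \<in> T) = (i \<in> M)" "(j \<in> T) = (j \<in> M)"
    and "prefix_le d (toggle j (toggle i T)) (toggle j (toggle i M))"
  shows "prefix_le d T M"
  unfolding prefix_le_def
proof (intro allI impI)
  fix m assume "m \<le> d"
  then have "int (count_below (toggle j (toggle i T)) m) \<le> int (count_below (toggle j (toggle i M)) m)"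
    using assms(4) by (simp add: prefix_le_def)
  then have "int (count_below T m) \<le> int (count_below M m)"
    using assms(1-3) unfolding count_below_toggle mem_toggle by (auto split: if_splits)
  then show "count_below T m \<le> count_below M m" by simp
qed

text \<open>The moves used belong to simple roots of type D: lowering an element by one, or
  inserting \<open>d - 1\<close> and \<open>d\<close> together. The first raises the counting
  function by 1 at a single place, the second by 1 at \<open>d - 1\<close> and by 2 at
  \<open>d\<close>.\<close>

lemma prefix_le_step:
  assumes N: "N \<subseteq> {1..d}" "even (card N)" and M: "M \<subseteq> {1..d}" "even (card M)"
    and le: "prefix_le d N M" and ne: "N \<noteq> M"
  shows "\<exists>i\<in>{1..d}. \<exists>j\<in>{1..d}. i \<noteq> j \<and> prefix_le d N (toggle j (toggle i N)) \<and> prefix_le d (toggle j (toggle i N)) M"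
proof -
  have le': "count_below N k \<le> count_below M k" if "k \<le> d" for k using le that by (simp add: prefix_le_def)
  \<comment> \<open>The first place where \<open>M\<close> is ahead: there \<open>M\<close> has an
    element that \<open>N\<close> lacks, and \<open>N\<close> stays strictly behind until its next
    element.\<close>
  define m where "m = (LEAST m. m \<le> d \<and> count_below N m \<noteq> count_below M m)"
  have "\<exists>m. m \<le> d \<and> count_below N m \<noteq> count_below M m"
    using count_below_inj[OF N(1) M(1)] ne by blast
  then have m: "m \<le> d \<and> count_below N m \<noteq> count_below M m" unfolding m_def by (rule LeastI_ex)
  then have lt: "count_below N m < count_below M m" using le'[of m] by simp
  have "m \<noteq> 0"
  proof
    assume "m = 0"
    moreover have "N \<inter> {..0} = {}" "M \<inter> {..0} = {}" using N M by auto
    ultimately show False using lt by (simp add: count_below_def)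
  qed
  then obtain m0 where m0: "m = Suc m0" by (cases m) auto
  have "\<not> (m0 \<le> d \<and> count_below N m0 \<noteq> count_below M m0)"
    using not_less_Least[of m0 "\<lambda>m. m \<le> d \<and> count_below N m \<noteq> count_below M m"] m0 unfolding m_def[symmetric] by simp
  then have eq0: "count_below N m0 = count_below M m0" using m m0 by simp
  then have mN: "m \<notin> N" "m \<in> M" using lt unfolding m0 count_below_Suc by (auto split: if_splits)
  have stable: "count_below N k = count_below N m" if "m \<le> k" "\<And>x. x \<in> N \<Longrightarrow> m < x \<Longrightarrow> k < x" for k
  proof -
    have "N \<inter> {..k} = N \<inter> {..m}" using that by (auto simp: not_le[symmetric])
    then show ?thesis by (simp add: count_below_def)
  qed
  have gt: "count_below N k < count_below M k" if "m \<le> k" "\<And>x. x \<in> N \<Longrightarrow> m < x \<Longrightarrow> k < x" for k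
    using stable[OF that] lt count_below_mono[OF that(1), of M] by simp
  show ?thesis
  proof (cases "\<exists>x\<in>N. m < x")
    case True
    \<comment> \<open>The next element of \<open>N\<close> after \<open>m\<close> is moved down to
      \<open>b = a - 1\<close>. Only the count at \<open>b\<close> changes, and there
      \<open>M\<close> is still strictly ahead.\<close>
    define a where "a = (LEAST x. x \<in> N \<and> m < x)"
    have ex: "\<exists>x. x \<in> N \<and> m < x" using True by blast
    have a: "a \<in> N \<and> m < a" unfolding a_def by (rule LeastI_ex[OF ex])
    have amin: "a \<le> x" if "x \<in> N" "m < x" for x unfolding a_def using that by (intro Least_le conjI)
    obtain b where b: "a = Suc b" using a by (cases a) auto
    have bN: "b \<notin> N"
    proof
      assume "b \<in> N"
      moreover from this have "m < b" using a b mN by (cases "b = m") auto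
      ultimately show False using amin[of b] b by simp
    qed
    have bd: "a \<in> {1..d}" "b \<in> {1..d}" using a b N \<open>m \<noteq> 0\<close> by auto
    have ct: "int (count_below (toggle b (toggle a N)) k) = int (count_below N k) + (if k = b then 1 else 0)" for k
      unfolding count_below_toggle mem_toggle using a b bN by auto
    have gtb: "count_below N b < count_below M b"
    proof (rule gt)
      show "m \<le> b" using a b by simp
      show "b < x" if "x \<in> N" "m < x" for x using amin[OF that] b by simp
    qed
    have "int (count_below (toggle b (toggle a N)) k) \<le> int (count_below M k)" if "k \<le> d" for k
      using ct[of k] le'[OF that] gtb by (cases "k = b") auto
    then have "prefix_le d (toggle b (toggle a N)) M" by (simp add: prefix_le_def)
    moreover have "int (count_below N k) \<le> int (count_below (toggle b (toggle a N)) k)" for k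
      unfolding ct by simp
    then have "prefix_le d N (toggle b (toggle a N))" by (simp add: prefix_le_def)
    ultimately show ?thesis using bd b by (intro bexI[of _ a] bexI[of _ b]) auto
  next
    case False
    \<comment> \<open>Here \<open>N\<close> has no element from \<open>m\<close> on. Both
      cardinalities are even, so the lead of \<open>M\<close> at \<open>d\<close> is not 1: this
      gives \<open>m < d\<close>, and below a lead of at least 2, which is the room needed for two
      new elements.\<close>
    have "m \<noteq> d"
    proof
      assume md: "m = d"
      have "card N = count_below N d" "card M = count_below M d"
        using count_below_all N M by auto
      then have "card M = Suc (card N)"
        using eq0 mN unfolding md[symmetric] m0 count_below_Suc by simp
      then show False using N M by simp
    qed
    then have md: "m < d" using m by simp
    obtain b where b: "d = Suc b" using md by (cases d) auto
    have nN: "x \<notin> N" if "m \<le> x" for x using False mN that by (cases "x = m") auto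
    have nN: "d \<notin> N" "b \<notin> N" using nN[of d] nN[of b] md b by auto
    have bd: "d \<in> {1..d}" "b \<in> {1..d}" using b md \<open>m \<noteq> 0\<close> by auto
    have ct: "int (count_below (toggle b (toggle d N)) k) = int (count_below N k) + (if b \<le> k then 1 else 0) + (if d \<le> k then 1 else 0)" for k
      unfolding count_below_toggle mem_toggle using nN b by auto
    have "count_below N b < count_below M b" "count_below N d < count_below M d"
      using gt[of b] gt[of d] False md b by auto
    moreover have "count_below N d + 2 \<le> count_below M d"
    proof -
      have "even (count_below N d)" "even (count_below M d)" using count_below_all N M by auto
      then show ?thesis using \<open>count_below N d < count_below M d\<close> by presburger
    qed
    ultimately have "int (count_below (toggle b (toggle d N)) k) \<le> int (count_below M k)" if "k \<le> d" for k
      using ct[of k] le'[OF that] that b by (cases "k = d"; cases "k = b") auto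
    then have "prefix_le d (toggle b (toggle d N)) M" by (simp add: prefix_le_def)
    moreover have "int (count_below N k) \<le> int (count_below (toggle b (toggle d N)) k)" for k
      unfolding ct by simp
    then have "prefix_le d N (toggle b (toggle d N))" by (simp add: prefix_le_def)
    ultimately show ?thesis using bd b by (intro bexI[of _ d] bexI[of _ b]) auto
  qed
qed

section \<open>Counting standard pairs\<close>

text \<open>\<open>B\<close> marks one side of a ballot sequence along \<open>D\<close>. This is the
  condition under which, for \<open>C\<close> disjoint from \<open>D\<close>, the set
  \<open>C \<union> (D - B)\<close> precedes \<open>C \<union> B\<close> in
  \<open>prefix_le\<close>.\<close>

definition ballot :: "nat set \<Rightarrow> nat set \<Rightarrow> bool" where
  "ballot D B \<longleftrightarrow> B \<subseteq> D \<and> (\<forall>m. card (D \<inter> {..m}) \<le> 2 * card (B \<inter> {..m}))"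

definition ballots :: "nat set \<Rightarrow> nat \<Rightarrow> nat set set" where
  "ballots D k = {B. ballot D B \<and> card (D - B) = k}"

lemma finite_ballots: "finite D \<Longrightarrow> finite {B. ballot D B}" "finite D \<Longrightarrow> finite (ballots D k)"
  by (rule finite_subset[of _ "Pow D"]; auto simp: ballots_def ballot_def)+

lemma ballot_card:
  assumes "finite D" "ballot D B" shows "card D \<le> 2 * card B"
proof (cases "D = {}")
  case False
  have "D \<inter> {..Max D} = D" "B \<inter> {..Max D} = B" using assms by (auto simp: ballot_def)
  moreover have "card (D \<inter> {..Max D}) \<le> 2 * card (B \<inter> {..Max D})" using assms(2) unfolding ballot_def by blast
  ultimately show ?thesis by simp
qed simp

lemma ballot_insert:
  assumes "finite D" "\<And>x. x \<in> D \<Longrightarrow> x < z" "ballot D B" "B' = B \<or> B' = insert z B"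
    "Suc (card D) \<le> 2 * card B'"
  shows "ballot (insert z D) B'"
  unfolding ballot_def
proof (intro conjI allI)
  show "B' \<subseteq> insert z D" using assms(3,4) by (auto simp: ballot_def)
  fix m
  have BD: "B \<subseteq> D" using assms(3) by (simp add: ballot_def)
  show "card (insert z D \<inter> {..m}) \<le> 2 * card (B' \<inter> {..m})"
  proof (cases "z \<le> m")
    case True
    have "x \<le> m" if "x \<in> D" for x using assms(2)[OF that] True by simp
    then have "insert z D \<inter> {..m} = insert z D" "B' \<inter> {..m} = B'"
      using assms(4) BD True by auto
    moreover have "z \<notin> D" using assms(2) by blast
    ultimately show ?thesis using assms(1,5) by simp
  next
    case False
    then have "insert z D \<inter> {..m} = D \<inter> {..m}" "B' \<inter> {..m} = B \<inter> {..m}" using assms(4) by auto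
    then show ?thesis using assms(3) by (simp add: ballot_def)
  qed
qed

text \<open>The left side is the ballot number. It satisfies Pascal's recursion, as do the ballots
  when the largest element of \<open>D\<close> is put into \<open>B\<close> or left out. In the
  boundary case \<open>2 * k = card D + 1\<close> it is 0 by symmetry of the binomial
  coefficients.\<close>

lemma card_ballots_ge:
  assumes "finite D" "2 * k \<le> card D + 1"
  shows "int (card D choose k) - (if k = 0 then 0 else int (card D choose (k - 1))) \<le> int (card (ballots D k))"
  using assms
proof (induction D arbitrary: k rule: finite_linorder_max_induct)
  case empty
  then have "k = 0" by simp
  moreover have "ballots {} 0 = {{}}" by (auto simp: ballots_def ballot_def)
  ultimately show ?case by simp
next
  case (insert z D)
  have zD: "z \<notin> D" using insert.hyps by auto
  have card: "card (insert z D) = Suc (card D)" using insert.hyps zD by simp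
  have sub1: "insert z ` ballots D k \<subseteq> ballots (insert z D) k"
  proof
    fix B' assume "B' \<in> insert z ` ballots D k"
    then obtain B where B: "ballot D B" "card (D - B) = k" "B' = insert z B" by (auto simp: ballots_def)
    have BD: "B \<subseteq> D" using B(1) by (simp add: ballot_def)
    then have "finite B" "z \<notin> B" using insert.hyps zD finite_subset by auto
    then have "Suc (card D) \<le> 2 * card B'" using ballot_card[OF insert.hyps(1) B(1)] B(3) by simp
    then have "ballot (insert z D) B'" using ballot_insert[of D z B B'] insert.hyps B by blast
    moreover have "insert z D - B' = D - B" using zD B(3) by auto
    ultimately show "B' \<in> ballots (insert z D) k" using B by (simp add: ballots_def)
  qed
  have inj: "inj_on (insert z) (ballots D k)"
  proof (rule inj_onI)
    fix B B' assume "B \<in> ballots D k" "B' \<in> ballots D k" "insert z B = insert z B'"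
    moreover from this have "z \<notin> B" "z \<notin> B'" using zD by (auto simp: ballots_def ballot_def)
    ultimately show "B = B'" by (metis Diff_insert_absorb)
  qed
  have fin: "finite (ballots (insert z D) k)" using insert.hyps by (simp add: finite_ballots)
  have IH: "int (card D choose k) - (if k = 0 then 0 else int (card D choose (k - 1))) \<le> int (card (ballots D k))"
    if "2 * k \<le> card D + 1" for k using insert.IH that by blast
  show ?case
  proof (cases k)
    case 0
    have "card (ballots D 0) \<le> card (ballots (insert z D) 0)"
      using card_mono[OF fin sub1] card_image[OF inj] unfolding 0 by simp
    then show ?thesis using IH[of 0] unfolding 0 by simp
  next
    case (Suc j)
    show ?thesis
    proof (cases "2 * k \<le> card D + 1")
      case False
      then have "card D = 2 * j" using insert.prems card Suc by simp
      then have "Suc (card D) choose k = Suc (card D) choose j"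
        using binomial_symmetric[of k "Suc (card D)"] Suc by simp
      then show ?thesis using card Suc by simp
    next
      case True
      have sub2: "ballots D j \<subseteq> ballots (insert z D) k"
      proof
        fix B assume "B \<in> ballots D j"
        then have B: "ballot D B" "card (D - B) = j" by (auto simp: ballots_def)
        have BD: "B \<subseteq> D" "finite B" using B(1) insert.hyps finite_subset by (auto simp: ballot_def)
        have cB: "card B + j = card D" using B(2) BD insert.hyps card_mono[of D B] by (simp add: card_Diff_subset)
        then have "Suc (card D) \<le> 2 * card B" using True Suc by simp
        then have "ballot (insert z D) B" using ballot_insert[of D z B B] insert.hyps B by blast
        moreover have "insert z D - B = insert z (D - B)" using BD zD by auto
        ultimately show "B \<in> ballots (insert z D) k" using B zD insert.hyps Suc by (simp add: ballots_def)
      qed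
      have disj: "insert z ` ballots D k \<inter> ballots D j = {}" using zD by (auto simp: ballots_def ballot_def)
      have "card (ballots D k) + card (ballots D j) = card (insert z ` ballots D k \<union> ballots D j)"
        using insert.hyps disj finite_ballots card_image[OF inj] by (subst card_Un_disjoint) auto
      also have "\<dots> \<le> card (ballots (insert z D) k)" using fin sub1 sub2 by (intro card_mono) auto
      finally have sum: "int (card (ballots D k)) + int (card (ballots D j)) \<le> int (card (ballots (insert z D) k))" by simp
      have "int (Suc (card D) choose k) = int (card D choose k) + int (card D choose j)" unfolding Suc by simp
      moreover have "int (Suc (card D) choose j) = int (card D choose j) + (if j = 0 then 0 else int (card D choose (j - 1)))"
        by (cases j) auto
      ultimately show ?thesis using sum IH[OF True] IH[of j] True unfolding card Suc by auto
    qed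
  qed
qed

text \<open>The ballot numbers for \<open>k \<le> K\<close> telescope to a single binomial
  coefficient.\<close>

lemma card_ballot_ge:
  assumes "finite D" "2 * K \<le> card D + 1"
  shows "card D choose K \<le> card {B. ballot D B}"
proof -
  have "int (card D choose K) = (\<Sum>k\<le>K. int (card D choose k) - (if k = 0 then 0 else int (card D choose (k - 1))))"
    by (induction K) auto
  also have "\<dots> \<le> (\<Sum>k\<le>K. int (card (ballots D k)))"
    using assms by (intro sum_mono card_ballots_ge) auto
  also have "\<dots> = int (card (\<Union>k\<le>K. ballots D k))"
    using assms(1) finite_ballots by (subst card_UN_disjoint) (auto simp: ballots_def)
  also have "\<dots> \<le> int (card {B. ballot D B})"
    using card_mono[OF finite_ballots(1)[OF assms(1)], of "\<Union>k\<le>K. ballots D k"]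
    by (auto simp: ballots_def)
  finally show ?thesis by simp
qed

lemma card_sym_diff:
  assumes "finite A" "finite B"
  shows "card (sym_diff A B) + 2 * card (A \<inter> B) = card A + card B"
proof -
  have "card (sym_diff A B) = card (A - B) + card (B - A)" using assms by (intro card_Un_disjoint) auto
  moreover have "card A = card (A - B) + card (A \<inter> B)" "card B = card (B - A) + card (A \<inter> B)"
    using assms by (auto simp: card_Diff_subset_Int Int_commute card_mono)
  ultimately show ?thesis by simp
qed

lemma count_below_Un_Int:
  "count_below A m + count_below B m = count_below (A \<union> B) m + count_below (A \<inter> B) m"
proof -
  have "(A \<inter> {..m}) \<union> (B \<inter> {..m}) = (A \<union> B) \<inter> {..m}" "(A \<inter> {..m}) \<inter> (B \<inter> {..m}) = (A \<inter> B) \<inter> {..m}" by auto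
  then show ?thesis using card_Un_Int[of "A \<inter> {..m}" "B \<inter> {..m}"] by (simp add: count_below_def)
qed

lemma prefix_pairs_count:
  assumes A: "A \<subseteq> {1..d}" "even (card A)" and B: "B \<subseteq> {1..d}" "even (card B)" and "A \<noteq> B"
  shows "(card (sym_diff A B) - 1) choose (card (sym_diff A B) div 2 - 1)
    \<le> card {(M, N). M \<subseteq> {1..d} \<and> even (card M) \<and> N \<subseteq> {1..d} \<and> even (card N) \<and> prefix_le d M N
       \<and> M \<inter> N = A \<inter> B \<and> M \<union> N = A \<union> B}" (is "?lhs \<le> card ?P")
proof -
  define C where "C = A \<inter> B"
  define D where "D = sym_diff A B"
  have finAB: "finite A" "finite B"
    using finite_subset[OF A(1)] finite_subset[OF B(1)] by simp_all
  then have fin: "finite A" "finite B" "finite C" "finite D" by (auto simp: C_def D_def)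
  have D0: "D \<noteq> {}" using assms(5) by (auto simp: D_def)
  have CD: "C \<inter> D = {}" "C \<subseteq> {1..d}" "D \<subseteq> {1..d}" using A B by (auto simp: C_def D_def)
  have "even (card D + 2 * card C)" using card_sym_diff[OF fin(1,2)] A B by (simp add: C_def D_def)
  then have evD: "even (card D)" by simp
  define z where "z = Max D"
  define D' where "D' = D - {z}"
  have zD: "z \<in> D" using D0 fin by (simp add: z_def)
  have lt: "x < z" if "x \<in> D'" for x using that fin by (auto simp: D'_def z_def less_le)
  have D_eq: "D = insert z D'" "z \<notin> D'" "finite D'" using zD fin by (auto simp: D'_def)
  then have cD: "card D = Suc (card D')" by simp
  \<comment> \<open>Parity decides whether the maximum \<open>z\<close> joins a ballot
    \<open>X\<close> of the other elements. As \<open>D'\<close> has odd size, \<open>X\<close>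
    holds a strict majority of it, so either choice is a ballot of \<open>D\<close>.\<close>
  define top where "top X = (if even (card (C \<union> X)) then X else insert z X)" for X
  define pr where "pr X = (C \<union> (D - top X), C \<union> top X)" for X
  have sub: "pr ` {X. ballot D' X} \<subseteq> ?P"
  proof
    fix q assume "q \<in> pr ` {X. ballot D' X}"
    then obtain X where X: "ballot D' X" and q: "q = pr X" by blast
    have XD: "X \<subseteq> D'" using X by (simp add: ballot_def)
    have finX: "finite X" "z \<notin> X" using XD D_eq finite_subset by auto
    have tX: "top X \<subseteq> D" "finite (top X)" using XD D_eq finX by (auto simp: top_def)
    have "card X \<le> card (top X)" using finX by (auto simp: top_def)
    moreover have "odd (card D')" using evD cD by simp
    then have "card D' \<noteq> 2 * card X" by auto
    with ballot_card[OF D_eq(3) X] have "Suc (card D') \<le> 2 * card X" by simp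
    ultimately have c: "Suc (card D') \<le> 2 * card (top X)" by linarith
    have c': "top X = X \<or> top X = insert z X" by (simp add: top_def)
    have "ballot (insert z D') (top X)" by (rule ballot_insert[OF D_eq(3) _ X c' c]) (rule lt)
    then have bal: "card (D \<inter> {..m}) \<le> 2 * card (top X \<inter> {..m})" for m
      by (simp add: D_eq(1) ballot_def)
    have ev: "even (card (C \<union> top X))"
    proof (cases "even (card (C \<union> X))")
      case False
      have "z \<notin> C \<union> X" using zD CD finX by auto
      then show ?thesis using False finX fin by (simp add: top_def)
    qed (simp add: top_def)
    have U: "(C \<union> (D - top X)) \<inter> (C \<union> top X) = A \<inter> B" "(C \<union> (D - top X)) \<union> (C \<union> top X) = A \<union> B"
      using CD tX by (auto simp: C_def D_def)
    have "card (C \<union> (D - top X)) + card (C \<union> top X) = card A + card B"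
      using card_Un_Int[of "C \<union> (D - top X)" "C \<union> top X"] card_Un_Int[of A B] fin tX unfolding U by simp
    then have "even (card (C \<union> (D - top X)) + card (C \<union> top X))" using A B by simp
    then have ev': "even (card (C \<union> (D - top X)))" using ev by simp
    have le: "prefix_le d (C \<union> (D - top X)) (C \<union> top X)"
      unfolding prefix_le_def
    proof (intro allI impI)
      fix m
      have disj: "count_below (C \<union> Y) m = count_below C m + count_below Y m" if "Y \<subseteq> D" for Y
      proof -
        have "C \<inter> Y = {}" using CD that by auto
        then show ?thesis using count_below_Un_Int[of C m Y] by (simp add: count_below_def)
      qed
      have "count_below (D - top X) m + count_below (top X) m = count_below D m"
      proof -
        have "(D - top X) \<union> top X = D" "(D - top X) \<inter> top X = {}" using tX by auto
        then show ?thesis using count_below_Un_Int[of "D - top X" m "top X"] by (simp add: count_below_def)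
      qed
      then have "count_below (D - top X) m \<le> count_below (top X) m"
        using bal[of m] by (simp add: count_below_def)
      then show "count_below (C \<union> (D - top X)) m \<le> count_below (C \<union> top X) m"
        using disj[of "D - top X"] disj[OF tX(1)] by simp
    qed
    have s: "C \<union> (D - top X) \<subseteq> {1..d}" "C \<union> top X \<subseteq> {1..d}" using CD tX by auto
    show "q \<in> ?P" unfolding q pr_def mem_Collect_eq prod.case
      by (intro conjI s ev ev' le U)
  qed
  have inj: "inj_on pr {X. ballot D' X}"
  proof (rule inj_onI)
    fix X Y assume XY: "X \<in> {X. ballot D' X}" "Y \<in> {X. ballot D' X}" "pr X = pr Y"
    have "X \<subseteq> D'" "Y \<subseteq> D'" using XY(1,2) by (simp_all add: ballot_def)
    have rec: "(C \<union> top W) \<inter> D' = W" if "W \<subseteq> D'" for W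
    proof -
      have "C \<inter> D' = {}" using CD(1) by (auto simp: D'_def)
      moreover have "top W \<inter> D' = W" using that D_eq(2) by (auto simp: top_def)
      ultimately show ?thesis by blast
    qed
    have "C \<union> top X = C \<union> top Y" using arg_cong[OF XY(3), of snd] unfolding pr_def snd_conv .
    then have "(C \<union> top X) \<inter> D' = (C \<union> top Y) \<inter> D'" by (rule arg_cong)
    then show "X = Y" unfolding rec[OF \<open>X \<subseteq> D'\<close>] rec[OF \<open>Y \<subseteq> D'\<close>] .
  qed
  have finP: "finite ?P"
    by (rule finite_subset[of _ "Pow {1..d} \<times> Pow {1..d}"]) (blast, simp)
  have "card {X. ballot D' X} \<le> card ?P" by (rule card_inj_on_le[OF inj sub finP])
  moreover have "card D' choose (card D div 2 - 1) \<le> card {X. ballot D' X}"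
    using evD cD by (intro card_ballot_ge[OF D_eq(3)]) simp
  ultimately have "card D' choose (card D div 2 - 1) \<le> card ?P" by linarith
  moreover have "card D - 1 = card D'" using cD by simp
  ultimately show ?thesis unfolding D_def by (simp only:)
qed

section \<open>Transport of the order to the labels of the chart at \<beta>\<close>

definition opposite :: "nat \<Rightarrow> nat set \<Rightarrow> nat \<Rightarrow> nat" where
  "opposite d \<beta> j = (if j \<in> \<beta> then star d j else j)"

context
  fixes d :: nat and \<beta> :: "nat set"
  assumes \<beta>: "\<beta> \<in> Iset d"
begin

abbreviation opp :: "nat \<Rightarrow> nat" where
  "opp \<equiv> opposite d \<beta>"

lemma star_mem_base: "j \<in> {1..d} \<Longrightarrow> star d j \<in> \<beta> \<longleftrightarrow> j \<notin> \<beta>"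
  by (rule IsetD(4)[OF \<beta>]) simp

lemma opposite_in: "j \<in> {1..d} \<Longrightarrow> opp j \<in> {1..2 * d} - \<beta>"
proof (cases "j \<in> \<beta>")
  case True
  assume j: "j \<in> {1..d}"
  then have "star d j \<notin> \<beta>" using star_mem_base True by simp
  moreover have "star d j \<in> {1..2 * d}" using j by (simp add: star_def) linarith
  ultimately show ?thesis using True by (simp add: opposite_def)
qed (simp add: opposite_def)

lemma opposite_surj:
  assumes "x \<in> {1..2 * d} - \<beta>" shows "\<exists>j\<in>{1..d}. x = opp j"
proof (cases "x \<le> d")
  case True
  then show ?thesis using assms by (intro bexI[of _ x]) (simp_all add: opposite_def)
next
  case False
  then have s: "star d x \<in> {1..d}" "star d (star d x) = x" using assms by (auto simp: star_def)
  moreover have "star d x \<in> \<beta>" using star_mem_base[OF s(1)] s(2) assms by simp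
  ultimately show ?thesis by (intro bexI[of _ "star d x"]) (simp_all add: opposite_def)
qed

lemma opposite_inj: "inj_on (opp) {1..d}"
proof (rule inj_onI)
  fix i j assume "i \<in> {1..d}" "j \<in> {1..d}" "opp i = opp j"
  then show "i = j" unfolding opposite_def star_def
    by (cases "i \<in> \<beta>"; cases "j \<in> \<beta>") (simp_all, linarith+)
qed

lemma opposite_eq_iff: "i \<in> {1..d} \<Longrightarrow> j \<in> {1..d} \<Longrightarrow> opp i = opp j \<longleftrightarrow> i = j"
  by (rule inj_on_eq_iff[OF opposite_inj])

lemma opposite_mem:
  assumes "\<theta> \<in> Iset d" "j \<in> {1..d}"
  shows "opp j \<in> \<theta> - \<beta> \<longleftrightarrow> (j \<in> flipped d \<theta>) \<noteq> (j \<in> flipped d \<beta>)"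
proof -
  have st: "star d j \<in> \<theta> \<longleftrightarrow> j \<notin> \<theta>" using assms by (intro IsetD(4)[OF assms(1)]) simp
  have fl: "j \<in> flipped d \<theta> \<longleftrightarrow> j \<notin> \<theta>" "j \<in> flipped d \<beta> \<longleftrightarrow> j \<notin> \<beta>"
    using assms(2) by (simp_all add: flipped_def)
  show ?thesis unfolding fl using st star_mem_base[OF assms(2)]
    by (cases "j \<in> \<beta>") (simp_all add: opposite_def)
qed

lemma opposite_ext:
  assumes "A \<subseteq> {1..2 * d} - \<beta>" "B \<subseteq> {1..2 * d} - \<beta>"
  shows "A = B \<longleftrightarrow> (\<forall>j\<in>{1..d}. opp j \<in> A \<longleftrightarrow> opp j \<in> B)"
proof
  assume *: "\<forall>j\<in>{1..d}. opp j \<in> A \<longleftrightarrow> opp j \<in> B"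
  have "x \<in> A \<longleftrightarrow> x \<in> B" if "x \<in> {1..2 * d} - \<beta>" for x
    using opposite_surj[OF that] * by auto
  then show "A = B" using assms by blast
qed simp

lemma Iset_diff_subset: "\<theta> \<in> Iset d \<Longrightarrow> \<theta> - \<beta> \<subseteq> {1..2 * d} - \<beta>"
  using IsetD(1) by blast

lemma opposite_image_subset: "S \<subseteq> {1..d} \<Longrightarrow> opp ` S \<subseteq> {1..2 * d} - \<beta>"
  by (rule image_subsetI) (rule opposite_in, rule subsetD)

text \<open>Passing to the chart at \<beta> amounts to a symmetric difference with the fixed set
  \<open>flipped d \<beta>\<close>. Toggles, parity and symmetric differences of pairs survive this,
  so the combinatorics can be done with \<open>flipped\<close>, independently of \<beta>.\<close>

lemma diff_eq_image:
  assumes "\<theta> \<in> Iset d"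
  shows "\<theta> - \<beta> = opp ` sym_diff (flipped d \<theta>) (flipped d \<beta>)"
proof -
  have sub: "sym_diff (flipped d \<theta>) (flipped d \<beta>) \<subseteq> {1..d}"
    using flipped_subset[of d \<theta>] flipped_subset[of d \<beta>] by blast
  show ?thesis
    unfolding opposite_ext[OF Iset_diff_subset[OF assms] opposite_image_subset[OF sub]]
  proof
    fix j assume j: "j \<in> {1..d}"
    show "opp j \<in> \<theta> - \<beta> \<longleftrightarrow> opp j \<in> opp ` sym_diff (flipped d \<theta>) (flipped d \<beta>)"
      unfolding opposite_mem[OF assms j] inj_on_image_mem_iff[OF opposite_inj j sub] by blast
  qed
qed

lemma card_diff_image:
  assumes "S \<subseteq> {1..d}" shows "card (opp ` S) = card S"
  using inj_on_subset[OF opposite_inj assms] by (rule card_image)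

lemma sym_diff_diff:
  assumes "\<theta> \<in> Iset d" "\<phi> \<in> Iset d"
  shows "sym_diff (\<theta> - \<beta>) (\<phi> - \<beta>) = opp ` sym_diff (flipped d \<theta>) (flipped d \<phi>)"
proof -
  have sub: "sym_diff (flipped d \<theta>) (flipped d \<phi>) \<subseteq> {1..d}"
    using flipped_subset[of d \<theta>] flipped_subset[of d \<phi>] by blast
  have sub': "sym_diff (\<theta> - \<beta>) (\<phi> - \<beta>) \<subseteq> {1..2 * d} - \<beta>"
    using Iset_diff_subset[OF assms(1)] Iset_diff_subset[OF assms(2)] by blast
  show ?thesis unfolding opposite_ext[OF sub' opposite_image_subset[OF sub]]
  proof
    fix j assume j: "j \<in> {1..d}"
    show "opp j \<in> sym_diff (\<theta> - \<beta>) (\<phi> - \<beta>) \<longleftrightarrow>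
      opp j \<in> opp ` sym_diff (flipped d \<theta>) (flipped d \<phi>)"
      unfolding inj_on_image_mem_iff[OF opposite_inj j sub]
      using opposite_mem[OF assms(1) j] opposite_mem[OF assms(2) j] by blast
  qed
qed

lemma flipped_eq_iff: "\<theta> \<in> Iset d \<Longrightarrow> \<phi> \<in> Iset d \<Longrightarrow> flipped d \<theta> = flipped d \<phi> \<longleftrightarrow> \<theta> = \<phi>"
  by (metis of_flipped_flipped)

lemma diff_toggle:
  assumes "\<theta> \<in> Iset d" "\<phi> \<in> Iset d" "i \<in> {1..d}" "j \<in> {1..d}"
  shows "\<phi> - \<beta> = toggle (opp j) (toggle (opp i) (\<theta> - \<beta>))
     \<longleftrightarrow> flipped d \<phi> = toggle j (toggle i (flipped d \<theta>))"
proof -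
  have sub: "toggle (opp j) (toggle (opp i) (\<theta> - \<beta>)) \<subseteq> {1..2 * d} - \<beta>"
    using Iset_diff_subset[OF assms(1)] opposite_in[OF assms(3)] opposite_in[OF assms(4)]
    by (auto simp: mem_toggle split: if_splits)
  have "\<phi> - \<beta> = toggle (opp j) (toggle (opp i) (\<theta> - \<beta>)) \<longleftrightarrow>
    (\<forall>k\<in>{1..d}. k \<in> flipped d \<phi> \<longleftrightarrow> k \<in> toggle j (toggle i (flipped d \<theta>)))"
    unfolding opposite_ext[OF Iset_diff_subset[OF assms(2)] sub]
  proof (intro ball_cong refl)
    fix k assume k: "k \<in> {1..d}"
    show "(opp k \<in> \<phi> - \<beta>) = (opp k \<in> toggle (opp j) (toggle (opp i) (\<theta> - \<beta>)))
      \<longleftrightarrow> (k \<in> flipped d \<phi>) = (k \<in> toggle j (toggle i (flipped d \<theta>)))"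
      unfolding mem_toggle opposite_eq_iff[OF k assms(3)] opposite_eq_iff[OF k assms(4)]
        opposite_eq_iff[OF assms(4,3)] opposite_mem[OF assms(2) k]
      using opposite_mem[OF assms(1) k] opposite_mem[OF assms(1,3)] opposite_mem[OF assms(1,4)] by auto
  qed
  also have "\<dots> \<longleftrightarrow> flipped d \<phi> = toggle j (toggle i (flipped d \<theta>))"
  proof -
    have "toggle j (toggle i (flipped d \<theta>)) \<subseteq> {1..d}"
      using flipped_subset[of d \<theta>] assms(3,4) by (auto simp: mem_toggle split: if_splits)
    then show ?thesis using flipped_subset[of d \<phi>] by blast
  qed
  finally show ?thesis .
qed

text \<open>At an index flipped in \<beta>, lying in both sets and lying in neither are exchanged.
  Intersection and union are therefore altered, but agreement of both is preserved.\<close>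

lemma weight_iff:
  assumes "\<mu> \<in> Iset d" "\<nu> \<in> Iset d" "\<theta> \<in> Iset d" "\<phi> \<in> Iset d"
  shows "(\<mu> - \<beta>) \<inter> (\<nu> - \<beta>) = (\<theta> - \<beta>) \<inter> (\<phi> - \<beta>) \<and> (\<mu> - \<beta>) \<union> (\<nu> - \<beta>) = (\<theta> - \<beta>) \<union> (\<phi> - \<beta>) \<longleftrightarrow>
    flipped d \<mu> \<inter> flipped d \<nu> = flipped d \<theta> \<inter> flipped d \<phi> \<and> flipped d \<mu> \<union> flipped d \<nu> = flipped d \<theta> \<union> flipped d \<phi>"
    (is "?L \<longleftrightarrow> ?R")
proof -
  note sub = assms[THEN Iset_diff_subset]
  have ext: "A = B \<longleftrightarrow> (\<forall>j\<in>U. j \<in> A \<longleftrightarrow> j \<in> B)" if "A \<subseteq> U" "B \<subseteq> U" for A B U :: "nat set"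
    using that by blast
  have fl: "flipped d \<mu> \<inter> flipped d \<nu> \<subseteq> {1..d}" "flipped d \<theta> \<inter> flipped d \<phi> \<subseteq> {1..d}"
    "flipped d \<mu> \<union> flipped d \<nu> \<subseteq> {1..d}" "flipped d \<theta> \<union> flipped d \<phi> \<subseteq> {1..d}"
    by (auto simp: flipped_def)
  have df: "(\<mu> - \<beta>) \<inter> (\<nu> - \<beta>) \<subseteq> {1..2 * d} - \<beta>" "(\<theta> - \<beta>) \<inter> (\<phi> - \<beta>) \<subseteq> {1..2 * d} - \<beta>"
    "(\<mu> - \<beta>) \<union> (\<nu> - \<beta>) \<subseteq> {1..2 * d} - \<beta>" "(\<theta> - \<beta>) \<union> (\<phi> - \<beta>) \<subseteq> {1..2 * d} - \<beta>"
    using sub by (simp_all add: le_infI1)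
  show ?thesis
    unfolding opposite_ext[OF df(1,2)] opposite_ext[OF df(3,4)] ext[OF fl(1,2)] ext[OF fl(3,4)]
      ball_conj_distrib[symmetric]
  proof (intro ball_cong refl)
    fix j assume j: "j \<in> {1..d}"
    show "((opp j \<in> (\<mu> - \<beta>) \<inter> (\<nu> - \<beta>)) = (opp j \<in> (\<theta> - \<beta>) \<inter> (\<phi> - \<beta>))
     \<and> (opp j \<in> (\<mu> - \<beta>) \<union> (\<nu> - \<beta>)) = (opp j \<in> (\<theta> - \<beta>) \<union> (\<phi> - \<beta>)))
     \<longleftrightarrow> ((j \<in> flipped d \<mu> \<inter> flipped d \<nu>) = (j \<in> flipped d \<theta> \<inter> flipped d \<phi>)
     \<and> (j \<in> flipped d \<mu> \<union> flipped d \<nu>) = (j \<in> flipped d \<theta> \<union> flipped d \<phi>))"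
      unfolding Int_iff Un_iff opposite_mem[OF assms(1) j] opposite_mem[OF assms(2) j]
        opposite_mem[OF assms(3) j] opposite_mem[OF assms(4) j]
      by (cases "j \<in> flipped d \<beta>") auto
  qed
qed

lemma bij_betw_diff: "bij_betw (\<lambda>\<theta>. \<theta> - \<beta>) (Iset d) {S. S \<subseteq> {1..2 * d} - \<beta> \<and> even (card S)}"
  unfolding bij_betw_def
proof (intro conjI equalityI subsetI)
  show "inj_on (\<lambda>\<theta>. \<theta> - \<beta>) (Iset d)"
  proof (rule inj_onI)
    fix \<theta> \<phi> assume *: "\<theta> \<in> Iset d" "\<phi> \<in> Iset d" "\<theta> - \<beta> = \<phi> - \<beta>"
    have "j \<in> flipped d \<theta> \<longleftrightarrow> j \<in> flipped d \<phi>" if "j \<in> {1..d}" for j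
      using opposite_mem[OF *(1) that] opposite_mem[OF *(2) that] *(3) by auto
    then have "flipped d \<theta> = flipped d \<phi>" using flipped_subset[of d \<theta>] flipped_subset[of d \<phi>] by blast
    then show "\<theta> = \<phi>" using flipped_eq_iff[OF *(1,2)] by simp
  qed
next
  fix S assume "S \<in> (\<lambda>\<theta>. \<theta> - \<beta>) ` Iset d"
  then obtain \<theta> where t: "\<theta> \<in> Iset d" and S: "S = \<theta> - \<beta>" by blast
  have "card S = card (sym_diff (flipped d \<theta>) (flipped d \<beta>))"
    unfolding S diff_eq_image[OF t] using flipped_subset[of d \<theta>] flipped_subset[of d \<beta>]
    by (intro card_diff_image) blast
  moreover have "even (card (sym_diff (flipped d \<theta>) (flipped d \<beta>)) + 2 * card (flipped d \<theta> \<inter> flipped d \<beta>))"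
    using card_sym_diff[of "flipped d \<theta>" "flipped d \<beta>"] flipped_even[OF t] flipped_even[OF \<beta>] by simp
  ultimately show "S \<in> {S. S \<subseteq> {1..2 * d} - \<beta> \<and> even (card S)}" using Iset_diff_subset[OF t] S by simp
next
  fix S assume "S \<in> {S. S \<subseteq> {1..2 * d} - \<beta> \<and> even (card S)}"
  then have S: "S \<subseteq> {1..2 * d} - \<beta>" "even (card S)" by auto
  define M where "M = {j \<in> {1..d}. opp j \<in> S}"
  have M: "M \<subseteq> {1..d}" "finite M" by (auto simp: M_def)
  have "S = opp ` M"
  proof (intro equalityI subsetI)
    fix x assume x: "x \<in> S"
    then obtain j where "j \<in> {1..d}" "x = opp j" using opposite_surj[of x] S(1) by blast
    then show "x \<in> opp ` M" using x by (simp add: M_def)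
  qed (auto simp: M_def)
  then have "even (card M)" using S(2) card_diff_image[OF M(1)] by simp
  define N where "N = sym_diff M (flipped d \<beta>)"
  have N: "N \<subseteq> {1..d}" using M flipped_subset[of d \<beta>] by (auto simp: N_def)
  have "even (card N + 2 * card (M \<inter> flipped d \<beta>))"
    using card_sym_diff[of M "flipped d \<beta>"] M \<open>even (card M)\<close> flipped_even[OF \<beta>] by (simp add: N_def)
  then have t: "of_flipped d N \<in> Iset d" using N by (intro of_flipped_Iset) auto
  have "S = of_flipped d N - \<beta>"
    unfolding opposite_ext[OF S(1) Iset_diff_subset[OF t]]
  proof
    fix j assume j: "j \<in> {1..d}"
    show "opp j \<in> S \<longleftrightarrow> opp j \<in> of_flipped d N - \<beta>"
      unfolding opposite_mem[OF t j] flipped_of_flipped[OF N] using j by (auto simp: N_def M_def)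
  qed
  then show "S \<in> (\<lambda>\<theta>. \<theta> - \<beta>) ` Iset d" using t by blast
qed

text \<open>The height sums the counting functions that define the order. These are additive over
  union and intersection, so their sums for a pair depend only on its weight; if n is above both x
  and y, this forces m below both.\<close>

lemma pfaffian_poset_Iset:
  "pfaffian_poset d ({1..2 * d} - \<beta>) (Iset d) (\<lambda>\<theta>. \<theta> - \<beta>) leqI (\<lambda>\<theta>. \<Sum>m\<le>d. count_below (flipped d \<theta>) m)"
proof
  show "{1..2 * d} - \<beta> \<subseteq> {1..2 * d}" by blast
  show "bij_betw (\<lambda>\<theta>. \<theta> - \<beta>) (Iset d) {S. S \<subseteq> {1..2 * d} - \<beta> \<and> even (card S)}" by (rule bij_betw_diff)
  show "leqI x x" if "x \<in> Iset d" for x using that by (simp add: leqI_iff_prefix_le prefix_le_def)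
  show "leqI x z" if "x \<in> Iset d" "y \<in> Iset d" "z \<in> Iset d" "leqI x y" "leqI y z" for x y z
    using that by (auto simp: leqI_iff_prefix_le prefix_le_def intro: order_trans)
  show "x = y" if "x \<in> Iset d" "y \<in> Iset d" "leqI x y" "leqI y x" for x y
  proof -
    have "flipped d x = flipped d y"
      using that by (intro count_below_inj[of _ d] flipped_subset)
        (auto simp: leqI_iff_prefix_le prefix_le_def intro: order_antisym)
    then show ?thesis using flipped_eq_iff that by blast
  qed
  show "(\<Sum>m\<le>d. count_below (flipped d x) m) < (\<Sum>m\<le>d. count_below (flipped d y) m)"
    if xy: "x \<in> Iset d" "y \<in> Iset d" "leqI x y" "x \<noteq> y" for x y
  proof -
    have le: "count_below (flipped d x) m \<le> count_below (flipped d y) m" if "m \<le> d" for m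
      using xy that by (simp add: leqI_iff_prefix_le prefix_le_def)
    have "flipped d x \<noteq> flipped d y" using flipped_eq_iff xy by blast
    then obtain m where "m \<le> d" "count_below (flipped d x) m \<noteq> count_below (flipped d y) m"
      using count_below_inj[OF flipped_subset flipped_subset] by blast
    then have "\<exists>m\<in>{..d}. count_below (flipped d x) m < count_below (flipped d y) m"
      using le by (intro bexI[of _ m]) (auto simp: le_less)
    then show ?thesis using le by (intro sum_strict_mono_ex1) auto
  qed
  show "\<exists>a b z. a \<in> {1..2 * d} - \<beta> \<and> b \<in> {1..2 * d} - \<beta> \<and> a \<noteq> b \<and> z \<in> Iset d \<and> z \<noteq> x \<and> leqI x z \<and> leqI z y
        \<and> x - \<beta> = toggle b (toggle a (z - \<beta>))
        \<and> (\<forall>t\<in>Iset d. \<forall>t'\<in>Iset d. t' - \<beta> = toggle b (toggle a (t - \<beta>)) \<longrightarrow> (a \<in> t - \<beta>) = (a \<in> z - \<beta>)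
             \<longrightarrow> (b \<in> t - \<beta>) = (b \<in> z - \<beta>) \<longrightarrow> leqI t' x \<longrightarrow> leqI t z)"
    if xy: "x \<in> Iset d" "y \<in> Iset d" "leqI x y" "x \<noteq> y" for x y
  proof -
    have ne: "flipped d x \<noteq> flipped d y" using flipped_eq_iff[OF xy(1,2)] xy(4) by simp
    have pl: "prefix_le d (flipped d x) (flipped d y)" using xy by (simp add: leqI_iff_prefix_le)
    obtain i j where ij: "i \<in> {1..d}" "j \<in> {1..d}" "i \<noteq> j"
      and le: "prefix_le d (flipped d x) (toggle j (toggle i (flipped d x)))"
        "prefix_le d (toggle j (toggle i (flipped d x))) (flipped d y)"
      using prefix_le_step[OF flipped_subset flipped_even[OF xy(1)] flipped_subset flipped_even[OF xy(2)] pl ne]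
      by blast
    define N where "N = toggle j (toggle i (flipped d x))"
    have N: "N \<subseteq> {1..d}"
      using flipped_subset[of d x] ij by (auto simp: N_def mem_toggle split: if_splits)
    have "even (card N)"
    proof -
      have tog: "even (card (toggle k A)) = odd (card A)" if "finite A" for k A
        using that by (auto simp: toggle_def card_gt_0_iff)
      have "finite (toggle i (flipped d x))" by (simp add: toggle_def)
      then show ?thesis using tog flipped_even[OF xy(1)] by (simp add: N_def)
    qed
    define z where "z = of_flipped d N"
    have z: "z \<in> Iset d" "flipped d z = N"
      using of_flipped_Iset[OF N \<open>even (card N)\<close>] flipped_of_flipped[OF N] by (auto simp: z_def)
    have xz: "flipped d x = toggle j (toggle i (flipped d z))"
      unfolding z(2) N_def by (simp add: toggle_commute[of i j])
    let ?a = "opp i" and ?b = "opp j"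
    have ab: "?a \<in> {1..2 * d} - \<beta>" "?b \<in> {1..2 * d} - \<beta>" "?a \<noteq> ?b"
      using opposite_in ij opposite_eq_iff by auto
    have "i \<in> N \<longleftrightarrow> i \<notin> flipped d x" using ij(3) by (auto simp: N_def mem_toggle)
    then have "z \<noteq> x" using z(2) by auto
    moreover have "leqI x z" "leqI z y" using le xy z by (auto simp: leqI_iff_prefix_le N_def)
    moreover have "x - \<beta> = toggle ?b (toggle ?a (z - \<beta>))"
      using diff_toggle[OF z(1) xy(1) ij(1,2)] xz by blast
    moreover have "leqI t z"
      if t: "t \<in> Iset d" "t' \<in> Iset d" "t' - \<beta> = toggle ?b (toggle ?a (t - \<beta>))"
        "(?a \<in> t - \<beta>) = (?a \<in> z - \<beta>)" "(?b \<in> t - \<beta>) = (?b \<in> z - \<beta>)" "leqI t' x" for t t'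
    proof -
      have t': "flipped d t' = toggle j (toggle i (flipped d t))"
        using diff_toggle[OF t(1,2) ij(1,2)] t(3) by blast
      have "(i \<in> flipped d t) = (i \<in> flipped d z)"
        using t(4) opposite_mem[OF t(1) ij(1)] opposite_mem[OF z(1) ij(1)] by blast
      moreover have "(j \<in> flipped d t) = (j \<in> flipped d z)"
        using t(5) opposite_mem[OF t(1) ij(2)] opposite_mem[OF z(1) ij(2)] by blast
      moreover have "prefix_le d (toggle j (toggle i (flipped d t))) (toggle j (toggle i (flipped d z)))"
        using t(6) t(2) xy(1) t' xz by (simp add: leqI_iff_prefix_le)
      ultimately have "prefix_le d (flipped d t) (flipped d z)" using prefix_le_toggle2[OF ij(3)] by blast
      then show ?thesis using t z by (simp add: leqI_iff_prefix_le)
    qed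
    ultimately show ?thesis using ab z(1)
      by (intro exI[of _ ?a] exI[of _ ?b] exI[of _ z] conjI ballI impI) simp_all
  qed
  have count_eq: "count_below (flipped d m) k + count_below (flipped d n) k = count_below (flipped d x) k + count_below (flipped d y) k"
    if xy: "x \<in> Iset d" "y \<in> Iset d" "m \<in> Iset d" "n \<in> Iset d"
      and w: "(m - \<beta>) \<inter> (n - \<beta>) = (x - \<beta>) \<inter> (y - \<beta>)" "(m - \<beta>) \<union> (n - \<beta>) = (x - \<beta>) \<union> (y - \<beta>)" for x y m n k
  proof -
    have "flipped d m \<inter> flipped d n = flipped d x \<inter> flipped d y \<and> flipped d m \<union> flipped d n = flipped d x \<union> flipped d y"
      using weight_iff[OF xy(3,4,1,2)] w by blast
    then show ?thesis using count_below_Un_Int[of "flipped d m" k "flipped d n"] count_below_Un_Int[of "flipped d x" k "flipped d y"]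
      by simp
  qed
  show "leqI m x \<and> leqI m y"
    if xy: "x \<in> Iset d" "y \<in> Iset d" "m \<in> Iset d" "n \<in> Iset d"
      and w: "(m - \<beta>) \<inter> (n - \<beta>) = (x - \<beta>) \<inter> (y - \<beta>)" "(m - \<beta>) \<union> (n - \<beta>) = (x - \<beta>) \<union> (y - \<beta>)"
      and le: "leqI x n" "leqI y n" for x y m n
  proof -
    have "count_below (flipped d m) k \<le> count_below (flipped d x) k \<and> count_below (flipped d m) k \<le> count_below (flipped d y) k"
      if "k \<le> d" for k
    proof -
      have "count_below (flipped d x) k \<le> count_below (flipped d n) k" "count_below (flipped d y) k \<le> count_below (flipped d n) k"
        using le xy that by (auto simp: leqI_iff_prefix_le prefix_le_def)
      then show ?thesis using count_eq[OF xy w, of k] by linarith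
    qed
    then show ?thesis using xy by (simp add: leqI_iff_prefix_le prefix_le_def)
  qed
  show "(\<Sum>k\<le>d. count_below (flipped d m) k) + (\<Sum>k\<le>d. count_below (flipped d n) k)
      = (\<Sum>k\<le>d. count_below (flipped d x) k) + (\<Sum>k\<le>d. count_below (flipped d y) k)"
    if xy: "x \<in> Iset d" "y \<in> Iset d" "m \<in> Iset d" "n \<in> Iset d"
      and w: "(m - \<beta>) \<inter> (n - \<beta>) = (x - \<beta>) \<inter> (y - \<beta>)" "(m - \<beta>) \<union> (n - \<beta>) = (x - \<beta>) \<union> (y - \<beta>)" for x y m n
    unfolding sum.distrib[symmetric] count_eq[OF xy w] ..
  show "(card (sym_diff (x - \<beta>) (y - \<beta>)) - 1) choose (card (sym_diff (x - \<beta>) (y - \<beta>)) div 2 - 1)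
      \<le> card {(m, n). m \<in> Iset d \<and> n \<in> Iset d \<and> leqI m n \<and> (m - \<beta>) \<inter> (n - \<beta>) = (x - \<beta>) \<inter> (y - \<beta>) \<and> (m - \<beta>) \<union> (n - \<beta>) = (x - \<beta>) \<union> (y - \<beta>)}"
    (is "_ \<le> card ?Q")
    if xy: "x \<in> Iset d" "y \<in> Iset d" "x \<noteq> y" for x y
  proof -
    have "sym_diff (flipped d x) (flipped d y) \<subseteq> {1..d}" using flipped_subset by blast
    then have c: "card (sym_diff (x - \<beta>) (y - \<beta>)) = card (sym_diff (flipped d x) (flipped d y))"
      unfolding sym_diff_diff[OF xy(1,2)] by (rule card_diff_image)
    have ne: "flipped d x \<noteq> flipped d y" using flipped_eq_iff xy by blast
    let ?P = "{(M, N). M \<subseteq> {1..d} \<and> even (card M) \<and> N \<subseteq> {1..d} \<and> even (card N) \<and> prefix_le d M N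
       \<and> M \<inter> N = flipped d x \<inter> flipped d y \<and> M \<union> N = flipped d x \<union> flipped d y}"
    have finI: "finite (Iset d)" by (rule finite_subset[of _ "Pow {1..2 * d}"]) (auto simp: Iset_def)
    have "card ?P \<le> card ?Q"
    proof (rule card_inj_on_le)
      show "inj_on (map_prod (of_flipped d) (of_flipped d)) ?P"
      proof (rule inj_on_subset)
        have "inj_on (of_flipped d) (Pow {1..d})"
          by (rule inj_on_inverseI[of _ "flipped d"]) (rule flipped_of_flipped, rule PowD)
        then show "inj_on (map_prod (of_flipped d) (of_flipped d)) (Pow {1..d} \<times> Pow {1..d})"
          by (intro map_prod_inj_on)
      qed blast
      show "map_prod (of_flipped d) (of_flipped d) ` ?P \<subseteq> ?Q"
      proof (rule image_subsetI)
        fix q assume "q \<in> ?P"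
        then obtain M N where q: "q = (M, N)" and M: "M \<subseteq> {1..d}" "even (card M)" and N: "N \<subseteq> {1..d}" "even (card N)"
          and le: "prefix_le d M N" and w: "M \<inter> N = flipped d x \<inter> flipped d y" "M \<union> N = flipped d x \<union> flipped d y"
          by blast
        note I = of_flipped_Iset[OF M] of_flipped_Iset[OF N]
        note F = flipped_of_flipped[OF M(1)] flipped_of_flipped[OF N(1)]
        have "leqI (of_flipped d M) (of_flipped d N)" using le I F by (simp add: leqI_iff_prefix_le)
        moreover have "(of_flipped d M - \<beta>) \<inter> (of_flipped d N - \<beta>) = (x - \<beta>) \<inter> (y - \<beta>)
            \<and> (of_flipped d M - \<beta>) \<union> (of_flipped d N - \<beta>) = (x - \<beta>) \<union> (y - \<beta>)"
          unfolding weight_iff[OF I xy(1,2)] F using w by blast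
        ultimately have "(of_flipped d M, of_flipped d N) \<in> ?Q" using I by blast
        then show "map_prod (of_flipped d) (of_flipped d) q \<in> ?Q" unfolding q map_prod_simp .
      qed
      show "finite ?Q" by (rule finite_subset[of _ "Iset d \<times> Iset d"]) (use finI in auto)
    qed
    moreover have "(card (sym_diff (flipped d x) (flipped d y)) - 1) choose (card (sym_diff (flipped d x) (flipped d y)) div 2 - 1) \<le> card ?P"
      by (rule prefix_pairs_count) (use flipped_subset flipped_even xy ne in auto)
    ultimately show ?thesis unfolding c by linarith
  qed
qed

end

section \<open>Standard monomials modulo the ideal\<close>

lemma mpoly_span_explicit:
  fixes h :: "'b \<Rightarrow> 'k::field mpoly"
  assumes "p \<in> mpv.span {h M | M. P M}"
  shows "\<exists>t u. finite t \<and> (\<forall>M\<in>t. P M) \<and> p = (\<Sum>M\<in>t. Const (u M) * h M)"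
proof -
  have "{h M | M. P M} = h ` Collect P" by blast
  with assms obtain T u where T: "finite T" "T \<subseteq> h ` Collect P" "p = (\<Sum>v\<in>T. Const (u v) * v)"
    unfolding mpv.span_explicit by auto
  from T(2) obtain U where U: "U \<subseteq> Collect P" "inj_on h U" "T = h ` U"
    unfolding subset_image_inj by blast
  have "finite U" using T(1) U by (simp add: finite_image_iff)
  moreover have "p = (\<Sum>M\<in>U. Const (u (h M)) * h M)"
    using T(3) U by (simp add: sum.reindex)
  ultimately show ?thesis using U(1)
    by (intro exI[of _ U] exI[of _ "\<lambda>M. u (h M)"]) auto
qed

lemma inP_0 [simp]: "inP d \<beta> 0"
  by (simp add: inP_def)

lemma inP_Const [simp]: "inP d \<beta> (Const c)"
  by (simp add: inP_def Const_def)

lemma inP_1 [simp]: "inP d \<beta> 1"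
  using inP_Const[of d \<beta> 1] by simp

lemma inP_Var: "v \<in> Rset d \<beta> \<Longrightarrow> inP d \<beta> (Var v)"
  by (simp add: inP_def Var_def)

lemma inP_add: "inP d \<beta> p \<Longrightarrow> inP d \<beta> q \<Longrightarrow> inP d \<beta> (p + q)"
  using keys_add[of p q] unfolding inP_def by blast

lemma inP_mult:
  assumes "inP d \<beta> p" "inP d \<beta> q" shows "inP d \<beta> (p * q)"
  unfolding inP_def
proof
  fix m assume "m \<in> Poly_Mapping.keys (p * q)"
  then obtain a b where "m = a + b" "a \<in> Poly_Mapping.keys p" "b \<in> Poly_Mapping.keys q"
    using keys_mult[of p q] by blast
  then show "Poly_Mapping.keys m \<subseteq> Rset d \<beta>"
    using assms keys_add[of a b] unfolding inP_def by blast
qed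

lemma inP_diff: "inP d \<beta> p \<Longrightarrow> inP d \<beta> q \<Longrightarrow> inP d \<beta> (p - q)"
  using keys_diff[of p q] unfolding inP_def by blast

lemma inP_pfaffian:
  assumes "\<And>x y. inP d \<beta> (N x y)" shows "inP d \<beta> (pfaffian N xs)"
proof (induction xs rule: length_induct)
  case (1 xs)
  have der: "inP d \<beta> (pder w H ys)"
    if "\<And>y. inP d \<beta> (w y)" "\<And>us y vs. ys = us @ y # vs \<Longrightarrow> inP d \<beta> (H (us @ vs))"
    for w :: "'a \<Rightarrow> 'b mpoly" and H ys
    using that
  proof (induction ys arbitrary: H)
    case (Cons y ys)
    have "inP d \<beta> (H (y # us @ vs))" if "ys = us @ z # vs" for us z vs
      using Cons.prems(2)[of "y # us" z vs] that by simp
    then have "inP d \<beta> (pder w (\<lambda>zs. H (y # zs)) ys)" by (intro Cons.IH Cons.prems(1))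
    moreover have "inP d \<beta> (H ys)" using Cons.prems(2)[of "[]" y ys] by simp
    ultimately show ?case using Cons.prems(1)[of y] by (simp add: inP_diff inP_mult)
  qed simp
  show ?case
  proof (cases xs)
    case (Cons x ys)
    show ?thesis unfolding Cons pfaffian_Cons
    proof (rule der)
      fix us y vs assume "ys = us @ y # vs"
      then have "length (us @ vs) < length xs" using Cons by simp
      then show "inP d \<beta> (pfaffian N (us @ vs))" using 1 by blast
    qed (rule assms)
  qed simp
qed

text \<open>Only entries for \<open>x < y\<close> in \<open>\<theta> - \<beta>\<close> are read, and
  these are coordinates of the patch. The auxiliary matrix is 0 elsewhere so that all its entries
  lie in P.\<close>

lemma inP_fpol:
  assumes "\<beta> \<in> Iset d" "\<theta> \<in> Iset d" shows "inP d \<beta> (fpol d \<theta> \<beta>)"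
proof -
  define N :: "nat \<Rightarrow> nat \<Rightarrow> 'a mpoly"
    where "N x y = (if (x, star d y) \<in> Rset d \<beta> then Var (x, star d y) else 0)" for x y
  have fin: "finite (\<theta> - \<beta>)" using IsetD(2)[OF assms(2)] by simp
  have "fpol d \<theta> \<beta> = pfaffian N (sorted_list_of_set (\<theta> - \<beta>))"
    unfolding fpol_def
  proof (rule pfaffian_cong)
    fix us x vs y assume l: "sorted_list_of_set (\<theta> - \<beta>) = us @ x # vs" "y \<in> set vs"
    have "sorted_wrt (<) (us @ x # vs)" unfolding l(1)[symmetric] by simp
    then have "x < y" using l(2) by (simp add: sorted_wrt_append)
    have "set (us @ x # vs) = \<theta> - \<beta>" unfolding l(1)[symmetric] using fin by simp
    then have "x \<in> \<theta> - \<beta>" "y \<in> \<theta> - \<beta>" using l(2) by auto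
    then have "x \<in> {1..2 * d}" "x \<notin> \<beta>" "y \<in> {1..2 * d}" "y \<notin> \<beta>" using IsetD(1)[OF assms(2)] by auto
    then have "(x, star d y) \<in> Rset d \<beta>"
      using \<open>x < y\<close> IsetD(4)[OF assms(1), of y] star_star[of y d] by (simp add: Rset_def)
    then show "Var (x, star d y) = N x y" by (simp add: N_def)
  qed
  also have "inP d \<beta> \<dots>" by (rule inP_pfaffian) (simp add: N_def inP_Var)
  finally show ?thesis .
qed

lemma inP_smon:
  assumes "\<beta> \<in> Iset d" "set L \<subseteq> Iset d" shows "inP d \<beta> (smon d \<beta> L)"
  using assms(2) by (induction L) (auto simp: smon_def intro!: inP_mult inP_fpol[OF assms(1)])

text \<open>A coordinate is the Pfaffian of a 2 by 2 matrix, for the \<theta> with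
  \<open>\<theta> - \<beta> = {i, star d c}\<close>.\<close>

lemma Var_eq_fpol:
  assumes \<beta>: "\<beta> \<in> Iset d" and v: "v \<in> Rset d \<beta>"
  shows "\<exists>\<theta>\<in>Iset d. Var v = (fpol d \<theta> \<beta> :: 'k::comm_ring_1 mpoly)"
proof -
  obtain i c where v': "v = (i, c)" by (cases v)
  then have i: "i \<in> {1..2 * d}" "i \<notin> \<beta>" "c \<in> \<beta>" "i < star d c" using v by (auto simp: Rset_def)
  have c: "c \<in> {1..2 * d}" using IsetD(1)[OF \<beta>] i by blast
  have "star d c \<notin> \<beta>" using IsetD(4)[OF \<beta> c] i by simp
  moreover have "star d c \<in> {1..2 * d}" using c by (simp add: star_def) linarith
  ultimately have "{i, star d c} \<in> {S. S \<subseteq> {1..2 * d} - \<beta> \<and> even (card S)}" using i by simp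
  then have "{i, star d c} \<in> (\<lambda>\<theta>. \<theta> - \<beta>) ` Iset d" using bij_betw_diff[OF \<beta>] by (simp add: bij_betw_def)
  then obtain \<theta> where t: "\<theta> \<in> Iset d" "\<theta> - \<beta> = {i, star d c}" by auto
  have "sorted_list_of_set {i, star d c} = [i, star d c]"
    using i(4) by (intro sorted_distinct_set_unique) auto
  then have "fpol d \<theta> \<beta> = (Var (i, star d (star d c)) :: 'k mpoly)"
    unfolding fpol_def t(2) by (simp add: pfaffian_Cons)
  then have "Var v = (fpol d \<theta> \<beta> :: 'k mpoly)" using star_star[of c d] c v' by simp
  then show ?thesis using t by blast
qed

text \<open>Since coordinates are Pfaffians, every monomial of P is a product of Pfaffians, in
  general not a standard one; this is the input for straightening.\<close>

lemma inP_span_smon: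
  assumes \<beta>: "\<beta> \<in> Iset d" and p: "inP d \<beta> (p :: 'k::field mpoly)"
  shows "p \<in> mpv.span {smon d \<beta> L | L. set L \<subseteq> Iset d}"
proof -
  let ?G = "{smon d \<beta> L :: 'k mpoly | L. set L \<subseteq> Iset d}"
  have mult: "q * q' \<in> ?G" if "q \<in> ?G" "q' \<in> ?G" for q q'
  proof -
    from that obtain L L' where "q = smon d \<beta> L" "q' = smon d \<beta> L'" "set L \<subseteq> Iset d" "set L' \<subseteq> Iset d" by blast
    then show ?thesis by (intro CollectI exI[of _ "L @ L'"]) (simp add: smon_def)
  qed
  have one: "1 \<in> ?G" by (intro CollectI exI[of _ "[]"]) (simp add: smon_def)
  have mon: "Poly_Mapping.keys m \<subseteq> Rset d \<beta> \<Longrightarrow> Poly_Mapping.single m 1 \<in> ?G" for m :: "nat \<times> nat \<Rightarrow>\<^sub>0 nat"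
  proof (induction m rule: poly_mapping_single_induct)
    case 1
    then show ?case using one by simp
  next
    case (2 m n)
    have "Poly_Mapping.keys m \<subseteq> Poly_Mapping.keys (m + n)" "Poly_Mapping.keys n \<subseteq> Poly_Mapping.keys (m + n)"
      by (auto simp: in_keys_iff lookup_add)
    then have "Poly_Mapping.single m 1 * Poly_Mapping.single n 1 \<in> ?G" using 2 by (intro mult) blast+
    then show ?case by (simp add: mult_single)
  next
    case (3 v n)
    show ?case
    proof (cases "n = 0")
      case True
      then show ?thesis using one by simp
    next
      case False
      then have "v \<in> Rset d \<beta>" using 3 by simp
      then obtain \<theta> where t: "\<theta> \<in> Iset d" "Var v = (fpol d \<theta> \<beta> :: 'k mpoly)" using Var_eq_fpol[OF \<beta>] by blast
      have V: "Var v \<in> ?G" unfolding t(2) using t(1) by (intro CollectI exI[of _ "[\<theta>]"]) (simp add: smon_def)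
      have "Poly_Mapping.single (Poly_Mapping.single v k) 1 \<in> ?G" for k :: nat
      proof (induction k)
        case 0
        then show ?case using one by simp
      next
        case (Suc k)
        have "Poly_Mapping.single (Poly_Mapping.single v (Suc k)) 1
            = Var v * Poly_Mapping.single (Poly_Mapping.single v k) (1::'k)"
          by (simp add: Var_def mult_single flip: single_add)
        then show ?case using mult[OF V Suc] by simp
      qed
      then show ?thesis .
    qed
  qed
  have "p = (\<Sum>m\<in>Poly_Mapping.keys p. Const (Poly_Mapping.lookup p m) * Poly_Mapping.single m 1)"
    by (subst poly_mapping_eq_sum_single) (simp add: Const_def mult_single)
  also have "\<dots> \<in> mpv.span ?G"
    using p mon by (intro mpv.span_sum mpv.span_scale mpv.span_base) (simp add: inP_def)
  finally show ?thesis .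
qed

lemma finite_Iset: "finite (Iset d)"
  by (rule finite_subset[of _ "Pow {1..2 * d}"]) (auto simp: Iset_def)

text \<open>Extending the coefficients by 0 gives all members the same finite index set, so that
  they can be added termwise.\<close>

lemma Ideal_iff:
  "p \<in> Ideal d \<alpha> \<beta> \<gamma> \<longleftrightarrow> (\<exists>a. (\<forall>\<tau>. inP d \<beta> (a \<tau>)) \<and>
     p = (\<Sum>\<tau>\<in>{\<tau> \<in> Iset d. \<not> leqI \<alpha> \<tau> \<or> \<not> leqI \<tau> \<gamma>}. a \<tau> * fpol d \<tau> \<beta>))"
    (is "_ \<longleftrightarrow> (\<exists>a. _ \<and> p = sum _ ?B)")
proof
  have fin: "finite ?B" using finite_Iset by simp
  assume "p \<in> Ideal d \<alpha> \<beta> \<gamma>"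
  then obtain S a where S: "S \<subseteq> ?B" "\<forall>\<tau>\<in>S. inP d \<beta> (a \<tau>)" "p = (\<Sum>\<tau>\<in>S. a \<tau> * fpol d \<tau> \<beta>)"
    unfolding Ideal_def by blast
  let ?a = "\<lambda>\<tau>. if \<tau> \<in> S then a \<tau> else 0"
  have "(\<Sum>\<tau>\<in>?B. ?a \<tau> * fpol d \<tau> \<beta>) = (\<Sum>\<tau>\<in>S. ?a \<tau> * fpol d \<tau> \<beta>)"
    using fin S(1) by (intro sum.mono_neutral_right) auto
  then have "p = (\<Sum>\<tau>\<in>?B. ?a \<tau> * fpol d \<tau> \<beta>)" using S(3) by simp
  moreover have "\<forall>\<tau>. inP d \<beta> (?a \<tau>)" using S(2) by simp
  ultimately show "\<exists>a. (\<forall>\<tau>. inP d \<beta> (a \<tau>)) \<and> p = (\<Sum>\<tau>\<in>?B. a \<tau> * fpol d \<tau> \<beta>)"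
    by (intro exI[of _ ?a] conjI)
next
  assume "\<exists>a. (\<forall>\<tau>. inP d \<beta> (a \<tau>)) \<and> p = (\<Sum>\<tau>\<in>?B. a \<tau> * fpol d \<tau> \<beta>)"
  then obtain a where "\<forall>\<tau>. inP d \<beta> (a \<tau>)" "p = (\<Sum>\<tau>\<in>?B. a \<tau> * fpol d \<tau> \<beta>)" by blast
  then show "p \<in> Ideal d \<alpha> \<beta> \<gamma>"
    unfolding Ideal_def using finite_Iset by (intro CollectI exI[of _ ?B] exI[of _ a]) simp
qed

lemma Ideal_subspace: "mpv.subspace (Ideal d \<alpha> \<beta> \<gamma> :: 'k::field mpoly set)"
proof (rule mpv.subspaceI)
  show "0 \<in> Ideal d \<alpha> \<beta> \<gamma>" unfolding Ideal_iff by (intro exI[of _ "\<lambda>_. 0"]) simp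
next
  fix p q :: "'k mpoly" assume "p \<in> Ideal d \<alpha> \<beta> \<gamma>" "q \<in> Ideal d \<alpha> \<beta> \<gamma>"
  then obtain a b where "\<forall>\<tau>. inP d \<beta> (a \<tau>)" "\<forall>\<tau>. inP d \<beta> (b \<tau>)"
    "p = (\<Sum>\<tau>\<in>{\<tau> \<in> Iset d. \<not> leqI \<alpha> \<tau> \<or> \<not> leqI \<tau> \<gamma>}. a \<tau> * fpol d \<tau> \<beta>)"
    "q = (\<Sum>\<tau>\<in>{\<tau> \<in> Iset d. \<not> leqI \<alpha> \<tau> \<or> \<not> leqI \<tau> \<gamma>}. b \<tau> * fpol d \<tau> \<beta>)"
    unfolding Ideal_iff by blast
  then show "p + q \<in> Ideal d \<alpha> \<beta> \<gamma>"
    unfolding Ideal_iff by (intro exI[of _ "\<lambda>\<tau>. a \<tau> + b \<tau>"]) (simp add: inP_add distrib_right sum.distrib)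
next
  fix c :: 'k and p :: "'k mpoly" assume "p \<in> Ideal d \<alpha> \<beta> \<gamma>"
  then obtain a where "\<forall>\<tau>. inP d \<beta> (a \<tau>)"
    "p = (\<Sum>\<tau>\<in>{\<tau> \<in> Iset d. \<not> leqI \<alpha> \<tau> \<or> \<not> leqI \<tau> \<gamma>}. a \<tau> * fpol d \<tau> \<beta>)"
    unfolding Ideal_iff by blast
  then show "Const c * p \<in> Ideal d \<alpha> \<beta> \<gamma>"
    unfolding Ideal_iff by (intro exI[of _ "\<lambda>\<tau>. Const c * a \<tau>"]) (simp add: inP_mult sum_distrib_left mult.assoc)
qed

lemma leqI_transp: "transp leqI"
  unfolding transp_def leqI_def using list_all2_trans[of "(\<le>)" "(\<le>)" "(\<le>)" ] order_trans by blast

lemma sqrt_minus_one: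
  assumes "algebraically_closed TYPE('k::field)" shows "\<exists>\<iota>::'k. \<iota> * \<iota> = -1"
proof -
  have "degree [:1, 0, 1::'k:] > 0" by simp
  then obtain x :: 'k where "poly [:1, 0, 1:] x = 0" using assms unfolding algebraically_closed_def by blast
  then have "1 + x * x = 0" by simp
  then have "x * x = -1" by (metis minus_unique)
  then show ?thesis by blast
qed

theorem theorem8p1:
  fixes d :: nat and \<alpha> \<beta> \<gamma> :: "nat set"
    and k :: "'k::field itself"
  assumes "algebraically_closed TYPE('k)"
    and "(2::'k) \<noteq> 0"
    and "d \<ge> 1"
    and "\<alpha> \<in> Iset d" and "\<beta> \<in> Iset d" and "\<gamma> \<in> Iset d"
    and "leqI \<alpha> \<beta>" and "leqI \<beta> \<gamma>"
  shows
    \<comment> \<open>linear independence modulo I\<close>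
    "(\<forall>S (c :: nat set list \<Rightarrow> 'k). finite S \<and> (\<forall>L\<in>S. standard_on d \<alpha> \<beta> \<gamma> L)
        \<and> (\<Sum>L\<in>S. Const (c L) * (smon d \<beta> L :: 'k mpoly)) \<in> Ideal d \<alpha> \<beta> \<gamma>
        \<longrightarrow> (\<forall>L\<in>S. c L = 0))
     \<and>
    \<comment> \<open>spanning modulo I\<close>
     (\<forall>p :: 'k mpoly. inP d \<beta> p \<longrightarrow>
        (\<exists>S (c :: nat set list \<Rightarrow> 'k). finite S \<and> (\<forall>L\<in>S. standard_on d \<alpha> \<beta> \<gamma> L)
           \<and> p - (\<Sum>L\<in>S. Const (c L) * smon d \<beta> L) \<in> Ideal d \<alpha> \<beta> \<gamma>))"
proof -
  note \<beta> = assms(5)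
  interpret pfaffian_poset d "{1..2 * d} - \<beta>" "Iset d" "\<lambda>\<theta>. \<theta> - \<beta>" leqI "\<lambda>\<theta>. \<Sum>m\<le>d. count_below (flipped d \<theta>) m"
    by (rule pfaffian_poset_Iset[OF \<beta>])
  have inf: "infinite (UNIV :: 'k set)" by (rule algebraically_closed_infinite[OF assms(1)])
  obtain \<iota> :: 'k where \<iota>: "\<iota> * \<iota> = -1" using sqrt_minus_one[OF assms(1)] by blast
  have fpol_eq: "fpol d \<theta> \<beta> = (pff \<theta> :: 'k mpoly)" for \<theta> by (simp add: fpol_def pff_def pf_def)
  have smon_eq: "smon d \<beta> L = (pmon L :: 'k mpoly)" for L by (simp add: smon_def pmon_def fpol_eq)
  \<comment> \<open>Transitivity turns comparison of neighbours into a chain, so the two notions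
    differ only by the conditions at the ends.\<close>
  have std_iff: "standard_on d \<alpha> \<beta> \<gamma> L \<longleftrightarrow>
     standard \<beta> L \<and> (L \<noteq> [] \<longrightarrow> leqI \<alpha> (hd L) \<and> leqI (last L) \<gamma>)" for L
    unfolding standard_on_def standard_def chain_def lessI_def sorted_wrt_iff_nth_Suc_transp[OF leqI_transp] by blast
  define Std where "Std = {pmon M :: 'k mpoly | M. standard \<beta> M}"
  \<comment> \<open>The ideal will be the span of \<open>Bad\<close>. Modulo it these standard
    monomials vanish and the remaining ones stay independent.\<close>
  define Bad where "Bad = {pmon M :: 'k mpoly | M. standard \<beta> M \<and> \<not> standard_on d \<alpha> \<beta> \<gamma> M}"
  have straight: "(pmon L :: 'k mpoly) \<in> mpv.span
    {pmon M | M. standard \<beta> M \<and> (\<forall>x\<in>set L. (\<not> leqI \<alpha> x \<longrightarrow> M \<noteq> [] \<and> \<not> leqI \<alpha> (hd M))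
        \<and> (\<not> leqI x \<gamma> \<longrightarrow> M \<noteq> [] \<and> \<not> leqI (last M) \<gamma>))}" if "set L \<subseteq> Iset d" for L
    using standard_straightening[OF inf assms(2) \<iota> \<beta> _ that assms(4,6,7,8)] by simp
  have pmon_Std: "pmon L \<in> mpv.span Std" if "set L \<subseteq> Iset d" for L
    using subsetD[OF mpv.span_mono straight[OF that], of Std] unfolding Std_def by blast
  have pmon_Bad: "pmon L \<in> mpv.span Bad"
    if "set L \<subseteq> Iset d" "x \<in> set L" "\<not> leqI \<alpha> x \<or> \<not> leqI x \<gamma>" for L x
  proof (rule subsetD[OF mpv.span_mono straight[OF that(1)]], clarify)
    fix M assume "standard \<beta> M" "\<forall>x\<in>set L. (\<not> leqI \<alpha> x \<longrightarrow> M \<noteq> [] \<and> \<not> leqI \<alpha> (hd M))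
        \<and> (\<not> leqI x \<gamma> \<longrightarrow> M \<noteq> [] \<and> \<not> leqI (last M) \<gamma>)"
    then have "standard \<beta> M \<and> \<not> standard_on d \<alpha> \<beta> \<gamma> M" using that(2,3) unfolding std_iff by blast
    then show "pmon M \<in> Bad" unfolding Bad_def by blast
  qed
  \<comment> \<open>Writing \<open>a\<close> through products of Pfaffians, each product with
    \<open>pff \<tau>\<close> has a factor outside the interval, and straightening keeps such a
    factor at an end of every chain.\<close>
  have gen_Bad: "a * pff \<tau> \<in> mpv.span Bad"
    if a: "inP d \<beta> a" and \<tau>: "\<tau> \<in> Iset d" "\<not> leqI \<alpha> \<tau> \<or> \<not> leqI \<tau> \<gamma>" for a \<tau>
  proof -
    have "mpv.span {smon d \<beta> L :: 'k mpoly | L. set L \<subseteq> Iset d} \<subseteq> {q. q * pff \<tau> \<in> mpv.span Bad}"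
    proof (rule mpv.span_minimal)
      show "mpv.subspace {q. q * pff \<tau> \<in> mpv.span Bad}"
        by (rule mpv.subspaceI)
           (auto simp: mpv.span_zero distrib_right mult.assoc intro: mpv.span_add mpv.span_scale)
      show "{smon d \<beta> L :: 'k mpoly | L. set L \<subseteq> Iset d} \<subseteq> {q. q * pff \<tau> \<in> mpv.span Bad}"
      proof clarify
        fix L assume "set L \<subseteq> Iset d"
        then have "pmon (\<tau> # L) \<in> mpv.span Bad" using \<tau> by (intro pmon_Bad[of _ \<tau>]) auto
        then show "smon d \<beta> L * pff \<tau> \<in> mpv.span Bad" by (simp add: smon_eq mult.commute)
      qed
    qed
    then show ?thesis using inP_span_smon[OF \<beta> a] by blast
  qed
  have Ideal_Bad: "q \<in> mpv.span Bad" if "q \<in> Ideal d \<alpha> \<beta> \<gamma>" for q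
  proof -
    from that obtain S a where S: "S \<subseteq> {\<tau> \<in> Iset d. \<not> leqI \<alpha> \<tau> \<or> \<not> leqI \<tau> \<gamma>}" "\<forall>\<tau>\<in>S. inP d \<beta> (a \<tau>)"
      "q = (\<Sum>\<tau>\<in>S. a \<tau> * fpol d \<tau> \<beta>)"
      unfolding Ideal_def by blast
    show ?thesis unfolding S(3) fpol_eq
    proof (rule mpv.span_sum)
      fix \<tau> assume "\<tau> \<in> S"
      then show "a \<tau> * pff \<tau> \<in> mpv.span Bad" using S(1,2) by (intro gen_Bad) auto
    qed
  qed
  \<comment> \<open>Conversely the first or the last factor of such a monomial is a generator of the
    ideal.\<close>
  have Bad_Ideal: "(pmon M :: 'k mpoly) \<in> Ideal d \<alpha> \<beta> \<gamma>" if M: "standard \<beta> M" "\<not> standard_on d \<alpha> \<beta> \<gamma> M" for M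
  proof -
    have "M \<noteq> []" "\<not> leqI \<alpha> (hd M) \<or> \<not> leqI (last M) \<gamma>" using M unfolding std_iff by blast+
    then obtain \<tau> where "\<tau> \<in> set M" "\<not> leqI \<alpha> \<tau> \<or> \<not> leqI \<tau> \<gamma>"
      using hd_in_set[of M] last_in_set[of M] by blast
    moreover from this obtain us vs where us: "M = us @ \<tau> # vs" by (meson split_list)
    moreover have MX: "set M \<subseteq> Iset d" using M(1) by (simp add: standard_def chain_def)
    ultimately have "\<tau> \<in> Iset d" "\<not> leqI \<alpha> \<tau> \<or> \<not> leqI \<tau> \<gamma>" by auto
    moreover have "inP d \<beta> (pmon (us @ vs) :: 'k mpoly)"
      unfolding smon_eq[symmetric] using MX us by (intro inP_smon[OF \<beta>]) auto
    moreover have "pmon M = (pmon (us @ vs) * fpol d \<tau> \<beta> :: 'k mpoly)" unfolding us by (simp add: fpol_eq algebra_simps)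
    ultimately show ?thesis unfolding Ideal_def
      by (intro CollectI exI[of _ "{\<tau>}"] exI[of _ "\<lambda>_. pmon (us @ vs)"]) simp
  qed
  show ?thesis
  proof (intro conjI allI impI ballI)
    fix S and c :: "nat set list \<Rightarrow> 'k" and L
    assume *: "finite S \<and> (\<forall>L\<in>S. standard_on d \<alpha> \<beta> \<gamma> L)
        \<and> (\<Sum>L\<in>S. Const (c L) * (smon d \<beta> L :: 'k mpoly)) \<in> Ideal d \<alpha> \<beta> \<gamma>" and L: "L \<in> S"
    have "(\<Sum>L\<in>S. Const (c L) * pmon L) \<in> mpv.span Bad" using * Ideal_Bad unfolding smon_eq by blast
    from mpoly_span_explicit[OF this[unfolded Bad_def]] obtain t u
      where t: "finite t" "\<forall>M\<in>t. standard \<beta> M \<and> \<not> standard_on d \<alpha> \<beta> \<gamma> M"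
        and eq: "(\<Sum>L\<in>S. Const (c L) * pmon L) = (\<Sum>M\<in>t. Const (u M) * pmon M)"
      by (elim exE conjE)
    \<comment> \<open>The two sides involve disjoint sets of standard monomials, so they combine
      into one relation with coefficients \<open>c\<close> and \<open>- u\<close>.\<close>
    define c' where "c' M = (if M \<in> S then c M else - u M)" for M
    have disj: "S \<inter> t = {}" using * t(2) by blast
    have "(\<Sum>M\<in>t. Const (c' M) * pmon M) = (\<Sum>M\<in>t. - (Const (u M) * pmon M))"
      using disj by (intro sum.cong refl) (auto simp: c'_def Const_uminus)
    moreover have "(\<Sum>M\<in>S. Const (c' M) * pmon M) = (\<Sum>M\<in>S. Const (c M) * pmon M)"
      by (intro sum.cong refl) (simp add: c'_def)
    ultimately have "(\<Sum>M\<in>S \<union> t. Const (c' M) * pmon M) = 0"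
      using * t(1) disj eq by (simp add: sum.union_disjoint sum_negf)
    moreover have "standard \<beta> M" if "M \<in> S \<union> t" for M using that * t(2) std_iff by blast
    moreover have "finite (S \<union> t)" using * t(1) by blast
    ultimately have "c' L = 0" using L by (intro standard_independent[OF inf \<beta>, of "S \<union> t" c' L]) simp_all
    then show "c L = 0" using L by (simp add: c'_def)
  next
    fix p :: "'k mpoly" assume p: "inP d \<beta> p"
    have "{smon d \<beta> L :: 'k mpoly | L. set L \<subseteq> Iset d} \<subseteq> mpv.span Std"
      using pmon_Std by (auto simp: smon_eq)
    from subsetD[OF mpv.span_minimal[OF this mpv.subspace_span] inP_span_smon[OF \<beta> p]]
    have "p \<in> mpv.span Std" .
    from mpoly_span_explicit[OF this[unfolded Std_def]] obtain t u
      where t: "finite t" "\<forall>M\<in>t. standard \<beta> M" "p = (\<Sum>M\<in>t. Const (u M) * pmon M)"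
      by (elim exE conjE)
    \<comment> \<open>Standard monomials violating an end condition lie in the ideal and are
      dropped.\<close>
    define S where "S = {M \<in> t. standard_on d \<alpha> \<beta> \<gamma> M}"
    have "p - (\<Sum>L\<in>S. Const (u L) * smon d \<beta> L) = (\<Sum>M\<in>t - S. Const (u M) * pmon M)"
      unfolding t(3) smon_eq using t(1) by (simp add: S_def sum_diff)
    also have "\<dots> \<in> Ideal d \<alpha> \<beta> \<gamma>"
    proof (rule mpv.subspace_sum[OF Ideal_subspace])
      fix M assume "M \<in> t - S"
      then have "(pmon M :: 'k mpoly) \<in> Ideal d \<alpha> \<beta> \<gamma>" using t(2) by (intro Bad_Ideal) (auto simp: S_def)
      then show "Const (u M) * pmon M \<in> Ideal d \<alpha> \<beta> \<gamma>" by (rule mpv.subspace_scale[OF Ideal_subspace])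
    qed
    finally show "\<exists>S (c :: nat set list \<Rightarrow> 'k). finite S \<and> (\<forall>L\<in>S. standard_on d \<alpha> \<beta> \<gamma> L)
           \<and> p - (\<Sum>L\<in>S. Const (c L) * smon d \<beta> L) \<in> Ideal d \<alpha> \<beta> \<gamma>"
      using t(1) by (intro exI[of _ S] exI[of _ u]) (simp add: S_def)
  qed
qed

end
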